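(* Let $x_0>0$, $c_L,c_R>0$, and let $c(x)=c_L$ for $0<x<x_0$, $c(x)=c_R$ for $x>x_0$. Let $u_0,v_0:\mathbb{R}_+\to\mathbb{R}$ be bounded, continuous almost everywhere, and zero in a neighborhood of $0$. Then there are $C,U_0,V_0\in\mathcal{G}(\mathbb{R}_+)$ with $C\approx c$, $U_0\approx u_0$, $V_0\approx v_0$, $C$ globally bounded and $\partial_xC$ of locally logarithmic growth, and with $U_0,V_0$ having representatives which vanish in a neighborhood of $0$ for every $\varepsilon$, such that the problem $$\begin{cases}(\partial_t+C(x)\,\partial_x)\,U(x,t)=0, & (x,t)\in(\mathbb{R}_+^* )^2,\\ (\partial_t-C(x)\,\partial_x)\,V(x,t)=0, & (x,t)\in(\mathbb{R}_+^* )^2,\\ U(x,0)=U_0(x),\quad V(x,0)=V_0(x), & x\ge 0,\\ U(0,t)=V(0,t), & t\ge 0,\end{cases}$$ has a unique solution $(U,V)\in\mathcal{G}(\mathbb{R}_+^2)\times\mathcal{G}(\mathbb{R}_+^2)$, and moreover $U\approx u$ and $V\approx v$, where $(u,v)$ is the solution of the classical problem $$(\partial_t+c\,\partial_x)u=0,\quad (\partial_t-c\,\partial_x)v=0,\quad u(x,0)=u_0(x),\quad v(x,0)=v_0(x),\quad u(0,t)=v(0,t)$$ obtained by imposing the passage (transmission) condition that $u$ and $v$ are continuous across $x=x_0$, i.e. the solution given by the explicit formulas in the context.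
   Context: $\mathbb{R}_+=[0,\infty)$, $\mathbb{R}_+^*=(0,\infty)$. **Classical solution with passage condition.** Let $\gamma_1(x,t,\cdot)$ (resp. $\gamma_2(x,t,\cdot)$) be the connected (continuous, broken at $x_0$) characteristic curve through $(x,t)$ for the speed $c$ (resp. $-c$). Explicitly, with $y(x)=\int_0^x ds/c(s)$, one has $\gamma_2(x,t,0)=y^{-1}(y(x)+t)$, and $\gamma_1(x,t,0)=y^{-1}(y(x)-t)$ when $y(x)\ge t$. Let $\Gamma=\{(x,t):t=y(x)\}$ be the characteristic of speed $c$ issuing from $(0,0)$, region (I) $=\{t<y(x)\}$ and region (II) $=\{t>y(x)\}$. Then $$v(x,t)=v_0(\gamma_2(x,t,0)),\qquad u(x,t)=\begin{cases}u_0(\gamma_1(x,t,0)) & \text{on (I)},\\ v(0,t_0),\ t_0=t-y(x), & \text{on (II)},\end{cases}$$ where $(0,t_0)$ is the point at which the characteristic $\gamma_1$ through $(x,t)$ meets the $t$-axis. ($\Gamma$ has measure zero.) **Colombeau algebra.** For $q\in\mathbb{N}$, $\mathcal{A}_q(\mathbb{R})=\{\chi\in\mathcal{D}(\mathbb{R}):\int\chi=1,\ \int x^k\chi(x)\,dx=0\text{ for }1\le k\le q\}$, and $\mathcal{A}_q(\mathbb{R}^m)$ is the set of functions $\varphi(x_1,\dots,x_m)=\prod_{j=1}^m\chi(x_j)$ with $\chi\in\mathcal{A}_q(\mathbb{R})$. For $\varphi\in\mathcal{A}_1(\mathbb{R}^m)$ and $\varepsilon\in\,]0,1[$, put $\varphi_\varepsilon(x)=\varepsilon^{-m}\varphi(x/\varepsilon)$.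 $\mathcal{E}[\mathbb{R}_+^m]$ is the algebra of maps $u:\mathcal{A}_1(\mathbb{R}^m)\times\mathbb{R}_+^m\to\mathbb{C}$ that are $C^\infty$ (up to the boundary) in the second variable. Write $u^\varepsilon(x)=u(\varphi_\varepsilon,x)$. * $u$ is *moderate* ($u\in\mathcal{E}_M[\mathbb{R}_+^m]$) if for every compact $K\subset\mathbb{R}_+^m$ and every differential operator $D=\partial_{x_1}^{k_1}\cdots\partial_{x_m}^{k_m}$ there is $N\in\mathbb{N}$ such that for all $\varphi\in\mathcal{A}_N(\mathbb{R}^m)$ there are $C,\eta>0$ with $\sup_{x\in K}|Du(\varphi_\varepsilon,x)|\le C\varepsilon^{-N}$ for $0<\varepsilon<\eta$. * $u\in\mathcal{N}[\mathbb{R}_+^m]$ if for every such $K$ and $D$ there is $N\in\mathbb{N}$ such that for all $q\ge N$ and all $\varphi\in\mathcal{A}_q(\mathbb{R}^m)$ there are $C,\eta>0$ with $\sup_{x\in K}|Du(\varphi_\varepsilon,x)|\le C\varepsilon^{q-N}$ for $0<\varepsilon<\eta$. $\mathcal{G}(\mathbb{R}_+^m)=\mathcal{E}_M[\mathbb{R}_+^m]/\mathcal{N}[\mathbb{R}_+^m]$. Operations, derivatives and restrictions are defined on representatives; restrictions to $\{t=0\}$ or $\{x=0\}$ (and viewing a function of $x$ alone as a function of $(x,t)$) use the correspondence $\chi\leftrightarrow\chi\otimes\chi$ between $\mathcal{A}_q(\mathbb{R})$ and $\mathcal{A}_q(\mathbb{R}^2)$. All equations for $U,V$ are equalities in $\mathcal{G}$.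 **Growth conditions.** $U\in\mathcal{G}(\mathbb{R}_+^m)$ is *globally bounded* if it has a representative $u$ for which there is $N\in\mathbb{N}$ such that for all $\varphi\in\mathcal{A}_N(\mathbb{R}^m)$ there are $c,\eta>0$ with $\sup_{y\in\mathbb{R}_+^m}|u(\varphi_\varepsilon,y)|\le c$ for $0<\varepsilon<\eta$. It is of *locally logarithmic growth* if it has a representative $u$ such that for every compact $K\subset\mathbb{R}_+^m$ there is $N\in\mathbb{N}$ such that for all $\varphi\in\mathcal{A}_N(\mathbb{R}^m)$ there are $c,\eta>0$ with $\sup_{y\in K}|u(\varphi_\varepsilon,y)|\le N\log(c/\varepsilon)$ for $0<\varepsilon<\eta$. **Association.** For $U\in\mathcal{G}(\mathbb{R}_+^m)$ and a locally integrable function $w$ on $\mathbb{R}_+^m$, $U\approx w$ ($U$ is associated to $w$) means that for a representative $u$ and every $\psi\in\mathcal{D}(\mathbb{R}_+^m)$ there is $N\in\mathbb{N}$ such that for all $\varphi\in\mathcal{A}_N(\mathbb{R}^m)$, $\lim_{\varepsilon\to0}\int u(\varphi_\varepsilon,y)\psi(y)\,dy=\int w(y)\psi(y)\,dy$. *)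

theory Defs
  imports "HOL-Analysis.Analysis"
begin

section \<open>Smooth functions up to the boundary\<close>

text \<open>
  The space \<open>\<real>\<^sub>+\<^sup>m\<close> is the orthant of a Euclidean space of dimension \<open>m\<close>; it is used below for
  \<^typ>\<open>real\<close> and \<^typ>\<open>real \<times> real\<close>.
\<close>

definition orthant :: "'a::euclidean_space set" where
  "orthant = {x. \<forall>b\<in>Basis. 0 \<le> x \<bullet> b}"

definition axis_line :: "'a::euclidean_space set \<Rightarrow> 'a \<Rightarrow> 'a \<Rightarrow> real set" where
  "axis_line S b x = {s. x + s *\<^sub>R b \<in> S}"

text \<open>
  Partial derivative within \<open>S\<close>, hence one-sided at those boundary points of the orthant
  where the line in direction \<open>b\<close> leaves it.
\<close>

definition partial :: "'a::euclidean_space set \<Rightarrow> 'a \<Rightarrow> ('a \<Rightarrow> complex) \<Rightarrow> 'a \<Rightarrow> complex" where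
  "partial S b f x = vector_derivative (\<lambda>s. f (x + s *\<^sub>R b)) (at 0 within axis_line S b x)"

text \<open>
  Differential operators are given by lists of basis vectors. For smooth functions the order of
  the list is immaterial, so these are exactly the operators given by multi-indices.
\<close>

primrec partials :: "'a::euclidean_space set \<Rightarrow> 'a list \<Rightarrow> ('a \<Rightarrow> complex) \<Rightarrow> 'a \<Rightarrow> complex" where
  "partials S [] f = f"
| "partials S (b # ds) f = partials S ds (partial S b f)"

definition axis_differentiable :: "'a::euclidean_space set \<Rightarrow> ('a \<Rightarrow> complex) \<Rightarrow> bool" where
  "axis_differentiable S f \<longleftrightarrow>
     (\<forall>b\<in>Basis. \<forall>x\<in>S. (\<lambda>s. f (x + s *\<^sub>R b)) differentiable (at 0 within axis_line S b x))"

definition smooth_on :: "'a::euclidean_space set \<Rightarrow> ('a \<Rightarrow> complex) \<Rightarrow> bool" where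
  "smooth_on S f \<longleftrightarrow>
     (\<forall>ds. set ds \<subseteq> Basis \<longrightarrow>
        continuous_on S (partials S ds f) \<and> axis_differentiable S (partials S ds f))"

text \<open>
  For \<open>S = orthant\<close> the support is a compact subset of the closed orthant; test functions need not
  vanish on its boundary.
\<close>

definition test_functions :: "'a::euclidean_space set \<Rightarrow> ('a \<Rightarrow> complex) set" where
  "test_functions S =
     {\<psi>. smooth_on S \<psi> \<and> (\<exists>K. compact K \<and> K \<subseteq> S \<and> (\<forall>x\<in>S - K. \<psi> x = 0))}"


section \<open>Mollifiers\<close>

text \<open>As everywhere in this theory, test functions are complex-valued.\<close>

definition mollifier1 :: "nat \<Rightarrow> (real \<Rightarrow> complex) set" where
  "mollifier1 q =
     {\<rho> \<in> test_functions UNIV.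
        (LINT x|lborel. \<rho> x) = 1 \<and>
        (\<forall>k\<in>{1..q}. (LINT x|lborel. complex_of_real (x ^ k) * \<rho> x) = 0)}"

definition tensor_power :: "(real \<Rightarrow> complex) \<Rightarrow> 'a::euclidean_space \<Rightarrow> complex" where
  "tensor_power \<rho> x = (\<Prod>b\<in>Basis. \<rho> (x \<bullet> b))"

definition mollifier :: "nat \<Rightarrow> ('a::euclidean_space \<Rightarrow> complex) set" where
  "mollifier q = tensor_power ` mollifier1 q"

text \<open>
  The inverse of \<^const>\<open>tensor_power\<close>, which is injective on \<open>mollifier1 1\<close> because its elements
  have integral 1.
\<close>

definition tensor_base :: "('a::euclidean_space \<Rightarrow> complex) \<Rightarrow> real \<Rightarrow> complex" where
  "tensor_base = inv_into (mollifier1 1) tensor_power"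

definition rescale :: "real \<Rightarrow> ('a::euclidean_space \<Rightarrow> complex) \<Rightarrow> 'a \<Rightarrow> complex" where
  "rescale \<epsilon> \<phi> x = \<phi> (x /\<^sub>R \<epsilon>) / complex_of_real (\<epsilon> ^ DIM('a))"


section \<open>Moderate and null representatives\<close>

text \<open>
  Representatives are total functions; their values at \<open>\<phi> \<notin> mollifier 1\<close> or outside the
  orthant are irrelevant and are identified in the quotient.
\<close>

type_synonym 'a net = "('a \<Rightarrow> complex) \<Rightarrow> 'a \<Rightarrow> complex"

definition smooth_net :: "'a::euclidean_space net \<Rightarrow> bool" where
  "smooth_net u \<longleftrightarrow> (\<forall>\<phi>\<in>mollifier 1. smooth_on orthant (u \<phi>))"

definition estimate ::
  "'a::euclidean_space net \<Rightarrow> ('a \<Rightarrow> complex) \<Rightarrow> 'a set \<Rightarrow> 'a list \<Rightarrow> real \<Rightarrow> bool" where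
  "estimate u \<phi> K ds r \<longleftrightarrow>
     (\<exists>C>0. \<exists>\<eta>>0. \<forall>\<epsilon>. 0 < \<epsilon> \<and> \<epsilon> < \<eta> \<longrightarrow>
        (\<forall>x\<in>K. norm (partials orthant ds (u (rescale \<epsilon> \<phi>)) x) \<le> C * \<epsilon> powr r))"

definition moderate :: "'a::euclidean_space net \<Rightarrow> bool" where
  "moderate u \<longleftrightarrow> smooth_net u \<and>
     (\<forall>K ds. compact K \<and> K \<subseteq> orthant \<and> set ds \<subseteq> Basis \<longrightarrow>
        (\<exists>N. \<forall>\<phi>\<in>mollifier N. estimate u \<phi> K ds (- real N)))"

definition null_net :: "'a::euclidean_space net \<Rightarrow> bool" where
  "null_net u \<longleftrightarrow> smooth_net u \<and>
     (\<forall>K ds. compact K \<and> K \<subseteq> orthant \<and> set ds \<subseteq> Basis \<longrightarrow>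
        (\<exists>N. \<forall>q\<ge>N. \<forall>\<phi>\<in>mollifier q. estimate u \<phi> K ds (real q - real N)))"

definition colombeau_rel :: "'a::euclidean_space net \<Rightarrow> 'a net \<Rightarrow> bool" where
  "colombeau_rel u v \<longleftrightarrow> moderate u \<and> moderate v \<and> null_net (\<lambda>\<phi> x. u \<phi> x - v \<phi> x)"


subsection \<open>Basic calculus\<close>

lemma axis_line_0: "x \<in> S \<Longrightarrow> 0 \<in> axis_line S b x"
  by (simp add: axis_line_def)

lemma has_vd_cong:
  assumes "x \<in> S" "\<And>y. y \<in> S \<Longrightarrow> f y = g y"
  shows "((\<lambda>s. f (x + s *\<^sub>R b)) has_vector_derivative d) (at 0 within axis_line S b x) \<longleftrightarrow>
         ((\<lambda>s. g (x + s *\<^sub>R b)) has_vector_derivative d) (at 0 within axis_line S b x)"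
proof -
  have "\<And>s. s \<in> axis_line S b x \<Longrightarrow> f (x + s *\<^sub>R b) = g (x + s *\<^sub>R b)"
    using assms(2) by (simp add: axis_line_def)
  note 1 = this and 2 = axis_line_0[OF assms(1)]
  show ?thesis
    by (rule iffI; rule has_vector_derivative_transform[OF 2]; (assumption | simp add: 1))
qed

lemma partial_cong:
  assumes "x \<in> S" "\<And>y. y \<in> S \<Longrightarrow> f y = g y"
  shows "partial S b f x = partial S b g x"
  unfolding partial_def vector_derivative_def
  using has_vd_cong[of x S f g b] assms by simp

lemma partials_cong:
  assumes "x \<in> S" "\<And>y. y \<in> S \<Longrightarrow> f y = g y"
  shows "partials S ds f x = partials S ds g x"
  using assms(2)
proof (induction ds arbitrary: f g)
  case Nil
  then show ?case using assms(1) by simp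
next
  case (Cons b ds)
  show ?case
    unfolding partials.simps by (rule Cons.IH) (use Cons.prems in \<open>auto intro: partial_cong\<close>)
qed

lemma axis_differentiable_cong:
  assumes "\<And>y. y \<in> S \<Longrightarrow> f y = g y"
  shows "axis_differentiable S f \<longleftrightarrow> axis_differentiable S g"
proof -
  have "(\<lambda>s. f (x + s *\<^sub>R b)) differentiable (at 0 within axis_line S b x) \<longleftrightarrow>
        (\<lambda>s. g (x + s *\<^sub>R b)) differentiable (at 0 within axis_line S b x)" if "x \<in> S" for x b
  proof -
    have *: "h differentiable F \<longleftrightarrow> (\<exists>d. (h has_vector_derivative d) F)"
      for h :: "real \<Rightarrow> complex" and F
      using vector_derivative_works differentiableI_vector by blast
    show ?thesis unfolding * using has_vd_cong[of x S f g b] assms that by simp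
  qed
  then show ?thesis by (simp add: axis_differentiable_def)
qed

lemma smooth_on_cong:
  assumes "\<And>y. y \<in> S \<Longrightarrow> f y = g y"
  shows "smooth_on S f \<longleftrightarrow> smooth_on S g"
proof -
  have *: "partials S ds f x = partials S ds g x" if "x \<in> S" for ds x
    using that assms by (rule partials_cong)
  have "continuous_on S (partials S ds f) \<longleftrightarrow> continuous_on S (partials S ds g)" for ds
    by (rule continuous_on_cong) (simp_all add: *)
  moreover have "axis_differentiable S (partials S ds f) \<longleftrightarrow> axis_differentiable S (partials S ds g)" for ds
    by (rule axis_differentiable_cong) (rule *)
  ultimately show ?thesis
    unfolding smooth_on_def by simp
qed

lemma smooth_on_continuous: "smooth_on S f \<Longrightarrow> continuous_on S f"
  unfolding smooth_on_def by (drule spec[of _ "[]"]) simp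

lemma smooth_on_axis_differentiable: "smooth_on S f \<Longrightarrow> axis_differentiable S f"
  unfolding smooth_on_def by (drule spec[of _ "[]"]) simp

lemma smooth_on_partial:
  "smooth_on S f \<Longrightarrow> b \<in> Basis \<Longrightarrow> smooth_on S (partial S b f)" for b :: "'a::euclidean_space"
  unfolding smooth_on_def
proof (intro allI impI)
  fix ds :: "'a list"
  assume *: "\<forall>ds. set ds \<subseteq> Basis \<longrightarrow>
      continuous_on S (partials S ds f) \<and> axis_differentiable S (partials S ds f)"
    and "b \<in> Basis" "set ds \<subseteq> Basis"
  then show "continuous_on S (partials S ds (partial S b f)) \<and>
      axis_differentiable S (partials S ds (partial S b f))"
    using *[rule_format, of "b # ds"] by simp
qed

lemma smooth_on_has_vd:
  assumes "smooth_on S f" "b \<in> Basis" "x \<in> S"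
  shows "((\<lambda>s. f (x + s *\<^sub>R b)) has_vector_derivative partial S b f x) (at 0 within axis_line S b x)"
  using smooth_on_axis_differentiable[OF assms(1)] assms(2,3)
  by (simp add: axis_differentiable_def partial_def flip: vector_derivative_works)

lemma smooth_on_coinduct:
  fixes f :: "'a::euclidean_space \<Rightarrow> complex"
  assumes "P f"
    and step: "\<And>f. P f \<Longrightarrow> continuous_on S f \<and> axis_differentiable S f \<and>
                (\<forall>b\<in>Basis. \<exists>g. P g \<and> (\<forall>x\<in>S. partial S b f x = g x))"
  shows "smooth_on S f"
proof -
  have *: "set ds \<subseteq> Basis \<longrightarrow> (\<exists>g. P g \<and> (\<forall>x\<in>S. partials S ds f x = g x))" for ds
    using \<open>P f\<close>
  proof (induction ds arbitrary: f)
    case Nil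
    then show ?case by auto
  next
    case (Cons b ds)
    show ?case
    proof
      assume ds: "set (b # ds) \<subseteq> Basis"
      then obtain g where g: "P g" "\<forall>x\<in>S. partial S b f x = g x"
        using step[OF Cons.prems] by auto
      obtain h where h: "P h" "\<forall>x\<in>S. partials S ds g x = h x"
        using Cons.IH[OF g(1)] ds by auto
      have "partials S ds (partial S b f) x = partials S ds g x" if "x \<in> S" for x
        by (rule partials_cong[OF that]) (use g(2) in blast)
      then show "\<exists>g. P g \<and> (\<forall>x\<in>S. partials S (b # ds) f x = g x)"
        using h by (intro exI[of _ h]) simp
    qed
  qed
  show ?thesis
    unfolding smooth_on_def
  proof (intro allI impI)
    fix ds :: "'a list"
    assume "set ds \<subseteq> Basis"
    then obtain g where g: "P g" "\<And>x. x \<in> S \<Longrightarrow> partials S ds f x = g x"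
      using * by blast
    have "continuous_on S (partials S ds f) \<longleftrightarrow> continuous_on S g"
      by (rule continuous_on_cong) (simp_all add: g(2))
    moreover have "axis_differentiable S (partials S ds f) \<longleftrightarrow> axis_differentiable S g"
      by (rule axis_differentiable_cong) (rule g(2))
    ultimately show "continuous_on S (partials S ds f) \<and> axis_differentiable S (partials S ds f)"
      using step[OF g(1)] by simp
  qed
qed

lemma orthant_nontrivial:
  assumes "x \<in> orthant" "b \<in> Basis"
  shows "at 0 within axis_line orthant b x \<noteq> bot"
proof -
  have "{0..} \<subseteq> axis_line orthant b x"
    using assms by (auto simp: axis_line_def orthant_def inner_add_left inner_Basis)
  then have "at (0::real) within {0..} \<le> at 0 within axis_line orthant b x"
    by (rule at_le)
  moreover have "at_right (0::real) \<le> at 0 within {0..}"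
    by (rule at_le) auto
  ultimately show ?thesis
    using trivial_limit_at_right_real[of "0::real"] bot.extremum_unique
    by (metis trivial_limit_def eventually_False order.trans)
qed

lemma partial_orthantI:
  assumes "x \<in> orthant" "b \<in> Basis"
    and "((\<lambda>s. f (x + s *\<^sub>R b)) has_vector_derivative d) (at 0 within axis_line orthant b x)"
  shows "partial orthant b f x = d"
  unfolding partial_def using orthant_nontrivial[OF assms(1,2)] assms(3)
  by (rule vector_derivative_within)

lemma smooth_on_orthantI:
  fixes f :: "'a::euclidean_space \<Rightarrow> complex"
  assumes "P f"
    and "\<And>f. P f \<Longrightarrow> continuous_on orthant f"
    and "\<And>f b. P f \<Longrightarrow> b \<in> Basis \<Longrightarrow>
           \<exists>g. P g \<and> (\<forall>x\<in>orthant.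
             ((\<lambda>s. f (x + s *\<^sub>R b)) has_vector_derivative g x) (at 0 within axis_line orthant b x))"
  shows "smooth_on orthant f"
  using assms(1)
proof (rule smooth_on_coinduct)
  fix f :: "'a \<Rightarrow> complex" assume f: "P f"
  show "continuous_on orthant f \<and> axis_differentiable orthant f \<and>
          (\<forall>b\<in>Basis. \<exists>g. P g \<and> (\<forall>x\<in>orthant. partial orthant b f x = g x))"
  proof (intro conjI ballI)
    show "continuous_on orthant f" using assms(2)[OF f] .
    show "axis_differentiable orthant f"
      unfolding axis_differentiable_def
    proof (intro ballI)
      fix b x :: 'a assume "b \<in> Basis" "x \<in> orthant"
      then obtain d where
        "((\<lambda>s. f (x + s *\<^sub>R b)) has_vector_derivative d) (at 0 within axis_line orthant b x)"
        using assms(3)[OF f] by blast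
      then show "(\<lambda>s. f (x + s *\<^sub>R b)) differentiable (at 0 within axis_line orthant b x)"
        by (rule differentiableI_vector)
    qed
    fix b :: 'a assume b: "b \<in> Basis"
    then obtain g where g: "P g" "\<And>x. x \<in> orthant \<Longrightarrow>
        ((\<lambda>s. f (x + s *\<^sub>R b)) has_vector_derivative g x) (at 0 within axis_line orthant b x)"
      using assms(3)[OF f] by blast
    then show "\<exists>g. P g \<and> (\<forall>x\<in>orthant. partial orthant b f x = g x)"
      using b by (intro exI[of _ g] conjI ballI partial_orthantI)
  qed
qed

lemma smooth_on_const: "smooth_on orthant (\<lambda>x::'a::euclidean_space. c)"
proof (rule smooth_on_orthantI[where P = "\<lambda>f. \<exists>c. f = (\<lambda>x. c)"])
  fix f :: "'a \<Rightarrow> complex" and b :: 'a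
  assume "\<exists>c. f = (\<lambda>x. c)"
  then obtain c where "f = (\<lambda>x. c)" by blast
  then show "\<exists>g. (\<exists>c. g = (\<lambda>x. c)) \<and> (\<forall>x\<in>orthant.
      ((\<lambda>s. f (x + s *\<^sub>R b)) has_vector_derivative g x) (at 0 within axis_line orthant b x))"
    by (intro exI[of _ "\<lambda>x. 0"]) (auto intro: has_vector_derivative_const)
qed auto

lemma smooth_on_lincomb:
  fixes f g :: "'a::euclidean_space \<Rightarrow> complex"
  assumes "smooth_on orthant f" "smooth_on orthant g"
  shows "smooth_on orthant (\<lambda>x. f x + c * g x)"
proof (rule smooth_on_orthantI[where
      P = "\<lambda>h. \<exists>f g. smooth_on orthant f \<and> smooth_on orthant g \<and> h = (\<lambda>x. f x + c * g x)"])
  fix h :: "'a \<Rightarrow> complex" and b :: 'a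
  assume "\<exists>f g. smooth_on orthant f \<and> smooth_on orthant g \<and> h = (\<lambda>x. f x + c * g x)" "b \<in> Basis"
  then obtain f g where fg: "smooth_on orthant f" "smooth_on orthant g" "b \<in> Basis"
    and h: "h = (\<lambda>x. f x + c * g x)" by blast
  show "\<exists>h'. (\<exists>f g. smooth_on orthant f \<and> smooth_on orthant g \<and> h' = (\<lambda>x. f x + c * g x)) \<and>
     (\<forall>x\<in>orthant. ((\<lambda>s. h (x + s *\<^sub>R b)) has_vector_derivative h' x) (at 0 within axis_line orthant b x))"
  proof (intro exI conjI ballI)
    show "smooth_on orthant (partial orthant b f)" "smooth_on orthant (partial orthant b g)"
      using fg by (simp_all add: smooth_on_partial)
    show "((\<lambda>s. h (x + s *\<^sub>R b)) has_vector_derivative partial orthant b f x + c * partial orthant b g x)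
        (at 0 within axis_line orthant b x)" if "x \<in> orthant" for x
      unfolding h using fg that
      by (intro has_vector_derivative_add has_vector_derivative_mult_right smooth_on_has_vd)
  qed simp
next
  show "continuous_on orthant h"
    if "\<exists>f g. smooth_on orthant f \<and> smooth_on orthant g \<and> h = (\<lambda>x. f x + c * g x)" for h :: "'a \<Rightarrow> complex"
    using that by (auto intro!: continuous_on_add continuous_on_mult_left dest: smooth_on_continuous)
qed (use assms in blast)

lemma partial_lincomb:
  fixes f g :: "'a::euclidean_space \<Rightarrow> complex"
  assumes "smooth_on orthant f" "smooth_on orthant g" "b \<in> Basis" "x \<in> orthant"
  shows "partial orthant b (\<lambda>x. f x + c * g x) x = partial orthant b f x + c * partial orthant b g x"
proof (rule partial_orthantI[OF assms(4,3)])
  show "((\<lambda>s. f (x + s *\<^sub>R b) + c * g (x + s *\<^sub>R b)) has_vector_derivative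
      partial orthant b f x + c * partial orthant b g x) (at 0 within axis_line orthant b x)"
    using assms by (intro has_vector_derivative_add has_vector_derivative_mult_right smooth_on_has_vd)
qed

lemma partials_lincomb:
  fixes f g :: "'a::euclidean_space \<Rightarrow> complex"
  assumes "smooth_on orthant f" "smooth_on orthant g" "set ds \<subseteq> Basis" "x \<in> orthant"
  shows "partials orthant ds (\<lambda>x. f x + c * g x) x = partials orthant ds f x + c * partials orthant ds g x"
  using assms(1-3)
proof (induction ds arbitrary: f g)
  case (Cons b ds)
  have "partials orthant (b # ds) (\<lambda>x. f x + c * g x) x =
      partials orthant ds (\<lambda>x. partial orthant b f x + c * partial orthant b g x) x"
    unfolding partials.simps using assms(4)
    by (rule partials_cong) (use Cons.prems in \<open>auto intro: partial_lincomb\<close>)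
  also have "\<dots> = partials orthant ds (partial orthant b f) x + c * partials orthant ds (partial orthant b g) x"
    using Cons by (simp add: smooth_on_partial)
  finally show ?case by simp
qed simp

lemma smooth_on_mult:
  fixes f g :: "'a::euclidean_space \<Rightarrow> complex"
  assumes "smooth_on orthant f" "smooth_on orthant g"
  shows "smooth_on orthant (\<lambda>x. f x * g x)"
proof -
  let ?s = "smooth_on (orthant :: 'a set)"
  let ?P = "\<lambda>h. \<exists>L. (\<forall>(f, g)\<in>set L. ?s f \<and> ?s g) \<and> h = (\<lambda>x. \<Sum>(f, g)\<leftarrow>L. f x * g x)"
  have cont: "continuous_on orthant (\<lambda>x. \<Sum>(f, g)\<leftarrow>L. f x * g x)"
    if "\<forall>(f, g)\<in>set L. ?s f \<and> ?s g" for L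
    using that by (induction L) (auto intro!: continuous_on_add continuous_on_mult dest: smooth_on_continuous)
  have deriv: "\<exists>M. (\<forall>(f, g)\<in>set M. ?s f \<and> ?s g) \<and> (\<forall>x\<in>orthant.
      ((\<lambda>s. \<Sum>(f, g)\<leftarrow>L. f (x + s *\<^sub>R b) * g (x + s *\<^sub>R b)) has_vector_derivative
        (\<Sum>(f, g)\<leftarrow>M. f x * g x)) (at 0 within axis_line orthant b x))"
    if "\<forall>(f, g)\<in>set L. ?s f \<and> ?s g" "b \<in> Basis" for L b
    using that(1)
  proof (induction L)
    case Nil
    show ?case by (rule exI[of _ "[]"]) auto
  next
    case (Cons p L)
    obtain f g where p: "p = (f, g)" by (cases p)
    obtain M where M: "\<forall>(f, g)\<in>set M. ?s f \<and> ?s g" "\<forall>x\<in>orthant.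
      ((\<lambda>s. \<Sum>(f, g)\<leftarrow>L. f (x + s *\<^sub>R b) * g (x + s *\<^sub>R b)) has_vector_derivative
        (\<Sum>(f, g)\<leftarrow>M. f x * g x)) (at 0 within axis_line orthant b x)"
      using Cons by auto
    have fg: "?s f" "?s g" using Cons.prems p by auto
    have "((\<lambda>s. f (x + s *\<^sub>R b) * g (x + s *\<^sub>R b)) has_vector_derivative
        f x * partial orthant b g x + partial orthant b f x * g x) (at 0 within axis_line orthant b x)"
      if "x \<in> orthant" for x
      using has_vector_derivative_mult[OF smooth_on_has_vd[OF fg(1) \<open>b \<in> Basis\<close> that]
          smooth_on_has_vd[OF fg(2) \<open>b \<in> Basis\<close> that]] by simp
    then show ?case
      using M fg p \<open>b \<in> Basis\<close>
      by (intro exI[of _ "(f, partial orthant b g) # (partial orthant b f, g) # M"])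
        (auto simp: add.assoc[symmetric] intro!: smooth_on_partial has_vector_derivative_add)
  qed
  show ?thesis
  proof (rule smooth_on_orthantI[where P = ?P])
    show "?P (\<lambda>x. f x * g x)"
      using assms by (intro exI[of _ "[(f, g)]"]) auto
    show "continuous_on orthant h" if "?P h" for h
      using that cont by blast
    show "\<exists>h'. ?P h' \<and> (\<forall>x\<in>orthant. ((\<lambda>s. h (x + s *\<^sub>R b)) has_vector_derivative h' x)
            (at 0 within axis_line orthant b x))" if hb: "?P h" "b \<in> Basis" for h b
    proof -
      obtain L where L: "\<forall>(f, g)\<in>set L. ?s f \<and> ?s g" "h = (\<lambda>x. \<Sum>(f, g)\<leftarrow>L. f x * g x)"
        using hb(1) by blast
      show ?thesis
        using deriv[OF L(1) hb(2)] unfolding L(2) by blast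
    qed
  qed
qed

lemma partial_mult:
  fixes f g :: "'a::euclidean_space \<Rightarrow> complex"
  assumes "smooth_on orthant f" "smooth_on orthant g" "b \<in> Basis" "x \<in> orthant"
  shows "partial orthant b (\<lambda>x. f x * g x) x = f x * partial orthant b g x + partial orthant b f x * g x"
  using has_vector_derivative_mult[OF smooth_on_has_vd[OF assms(1,3,4)] smooth_on_has_vd[OF assms(2,3,4)]]
  by (intro partial_orthantI assms) simp


subsection \<open>Stability of mollifiers\<close>

lemma partial_UNIV:
  fixes f :: "real \<Rightarrow> complex"
  assumes "(f has_vector_derivative d) (at x)"
  shows "partial UNIV 1 f x = d"
proof -
  have "(f \<circ> (\<lambda>s. x + s) has_vector_derivative 1 *\<^sub>R d) (at 0)"
    by (intro vector_diff_chain_at) (use assms in \<open>auto intro!: derivative_eq_intros\<close>)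
  then show ?thesis
    by (simp add: partial_def axis_line_def o_def vector_derivative_at)
qed

lemma smooth_on_UNIV_has_vd:
  fixes f :: "real \<Rightarrow> complex"
  assumes "smooth_on UNIV f"
  shows "(f has_vector_derivative partial UNIV 1 f x) (at x)"
proof -
  have "((\<lambda>s. f (x + s)) has_vector_derivative partial UNIV 1 f x) (at 0)"
    using smooth_on_has_vd[OF assms, of 1 x] by (simp add: axis_line_def)
  then have "((\<lambda>s. f (x + s)) \<circ> (\<lambda>y. y - x) has_vector_derivative 1 *\<^sub>R partial UNIV 1 f x) (at x)"
    by (intro vector_diff_chain_at) (auto intro!: derivative_eq_intros)
  then show ?thesis by (simp add: o_def)
qed

lemma smooth_on_UNIV_rescale:
  fixes f :: "real \<Rightarrow> complex"
  assumes "smooth_on UNIV f"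
  shows "smooth_on UNIV (\<lambda>x. c * f (a * x))"
proof (rule smooth_on_coinduct[where P = "\<lambda>h. \<exists>f c. smooth_on UNIV f \<and> h = (\<lambda>x. c * f (a * x))"])
  fix h :: "real \<Rightarrow> complex"
  assume "\<exists>f c. smooth_on UNIV f \<and> h = (\<lambda>x. c * f (a * x))"
  then obtain f c where f: "smooth_on UNIV f" and h: "h = (\<lambda>x. c * f (a * x))" by blast
  have d: "(h has_vector_derivative (c * of_real a) * partial UNIV 1 f (a * x)) (at x)" for x
  proof -
    have "(f \<circ> (\<lambda>x. a * x) has_vector_derivative a *\<^sub>R partial UNIV 1 f (a * x)) (at x)"
      by (intro vector_diff_chain_at smooth_on_UNIV_has_vd f) (auto intro!: derivative_eq_intros)
    then show ?thesis
      unfolding h o_def by (auto dest!: has_vector_derivative_mult_right[where a = c]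
          simp: scaleR_conv_of_real mult.assoc)
  qed
  have "(\<lambda>s. h (x + s)) differentiable (at 0)" for x
  proof -
    have "h \<circ> (\<lambda>s. x + s) differentiable (at 0)"
      by (intro differentiable_chain_at) (use d[of x] in \<open>auto intro: differentiableI_vector\<close>)
    then show ?thesis by (simp add: o_def)
  qed
  then have "axis_differentiable UNIV h"
    by (simp add: axis_differentiable_def axis_line_def)
  moreover have "continuous_on UNIV h"
    using d by (meson continuous_at_imp_continuous_on has_vector_derivative_continuous)
  moreover have "partial UNIV 1 h x = (c * of_real a) * partial UNIV 1 f (a * x)" for x
    by (rule partial_UNIV[OF d])
  ultimately show "continuous_on UNIV h \<and> axis_differentiable UNIV h \<and> (\<forall>b\<in>Basis. \<exists>g.
      (\<exists>f c. smooth_on UNIV f \<and> g = (\<lambda>x. c * f (a * x))) \<and> (\<forall>x\<in>UNIV. partial UNIV b h x = g x))"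
    using smooth_on_partial[OF f, of 1] by auto
qed (use assms in blast)

lemma test_functions_rescale:
  assumes "\<rho> \<in> test_functions (UNIV :: real set)" "0 < \<epsilon>"
  shows "rescale \<epsilon> \<rho> \<in> test_functions UNIV"
proof -
  obtain K where K: "compact K" "\<And>x. x \<notin> K \<Longrightarrow> \<rho> x = 0"
    using assms(1) by (auto simp: test_functions_def)
  have "smooth_on UNIV (\<lambda>x. of_real (inverse \<epsilon>) * \<rho> (inverse \<epsilon> * x))"
    using assms(1) by (intro smooth_on_UNIV_rescale) (auto simp: test_functions_def)
  moreover have "rescale \<epsilon> \<rho> = (\<lambda>x. of_real (inverse \<epsilon>) * \<rho> (inverse \<epsilon> * x))"
    by (auto simp: rescale_def field_simps)
  moreover have "compact ((\<lambda>x. \<epsilon> * x) ` K)"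
    using K(1) by (intro compact_continuous_image continuous_intros)
  moreover have "rescale \<epsilon> \<rho> x = 0" if "x \<notin> (\<lambda>x. \<epsilon> * x) ` K" for x
  proof -
    have "x = \<epsilon> * (x / \<epsilon>)" using assms(2) by simp
    then have "x / \<epsilon> \<notin> K" using that by blast
    then show ?thesis by (simp add: rescale_def K(2) divide_inverse mult.commute)
  qed
  ultimately show ?thesis
    unfolding test_functions_def by (intro CollectI conjI exI[of _ "(\<lambda>x. \<epsilon> * x) ` K"]) auto
qed

lemma moment_rescale:
  assumes "0 < \<epsilon>"
  shows "(LINT x|lborel. complex_of_real (x ^ k) * rescale \<epsilon> \<rho> x) =
         of_real (\<epsilon> ^ k) * (LINT x|lborel. complex_of_real (x ^ k) * \<rho> x)"
proof -
  have "(LINT x|lborel. complex_of_real (x ^ k) * rescale \<epsilon> \<rho> x) =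
      \<bar>\<epsilon>\<bar> *\<^sub>R (LINT x|lborel. complex_of_real ((0 + \<epsilon> * x) ^ k) * rescale \<epsilon> \<rho> (0 + \<epsilon> * x))"
    using assms by (intro lborel_integral_real_affine) simp
  also have "(\<lambda>x. complex_of_real ((0 + \<epsilon> * x) ^ k) * rescale \<epsilon> \<rho> (0 + \<epsilon> * x)) =
      (\<lambda>x. (of_real (\<epsilon> ^ k) / of_real \<epsilon>) * (complex_of_real (x ^ k) * \<rho> x))"
    using assms by (auto simp: rescale_def power_mult_distrib mult_ac simp flip: mult.assoc[of "inverse \<epsilon>"])
  finally show ?thesis
    using assms by (simp add: scaleR_conv_of_real)
qed

lemma mollifier1_rescale:
  assumes "\<rho> \<in> mollifier1 q" "0 < \<epsilon>"
  shows "rescale \<epsilon> \<rho> \<in> mollifier1 q"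
  using assms moment_rescale[OF assms(2), of 0 \<rho>] moment_rescale[OF assms(2), of _ \<rho>]
  by (simp add: mollifier1_def test_functions_rescale)

lemma rescale_tensor_power:
  "rescale \<epsilon> (tensor_power \<rho>) = (tensor_power (rescale \<epsilon> \<rho>) :: 'a::euclidean_space \<Rightarrow> complex)"
  by (rule ext) (simp add: rescale_def tensor_power_def prod_dividef)

lemma mollifier_rescale: "\<phi> \<in> mollifier q \<Longrightarrow> 0 < \<epsilon> \<Longrightarrow> rescale \<epsilon> \<phi> \<in> mollifier q"
  by (auto simp: mollifier_def rescale_tensor_power mollifier1_rescale)

lemma mollifier1_mono: "p \<le> q \<Longrightarrow> \<rho> \<in> mollifier1 q \<Longrightarrow> \<rho> \<in> mollifier1 p"
  by (simp add: mollifier1_def)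

lemma mollifier_mono: "p \<le> q \<Longrightarrow> \<phi> \<in> mollifier q \<Longrightarrow> \<phi> \<in> mollifier p"
  by (auto simp: mollifier_def mollifier1_mono)

lemma tensor_power_real [simp]: "tensor_power \<rho> = (\<rho> :: real \<Rightarrow> complex)"
  by (auto simp: tensor_power_def)

lemma mollifier_real: "mollifier q = mollifier1 q"
  by (auto simp: mollifier_def)

lemma tensor_power_prod: "tensor_power \<rho> (x, t) = \<rho> x * \<rho> t" for x t :: real
  by (simp add: tensor_power_def Basis_prod_def sum.union_disjoint prod.union_disjoint)

lemma tensor_base_tensor_power:
  assumes "\<rho> \<in> mollifier1 1"
  shows "tensor_base (tensor_power \<rho> :: real \<times> real \<Rightarrow> complex) = \<rho>"
proof -
  have "\<rho>' = \<rho>"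
    if "\<rho>' \<in> mollifier1 1" "\<rho> \<in> mollifier1 1"
      "(tensor_power \<rho>' :: real \<times> real \<Rightarrow> complex) = tensor_power \<rho>" for \<rho> \<rho>'
  proof
    fix x
    have "\<rho>' x * \<rho>' t = \<rho> x * \<rho> t" for t
      using that(3) by (metis tensor_power_prod)
    then have "(LINT t|lborel. \<rho>' x * \<rho>' t) = (LINT t|lborel. \<rho> x * \<rho> t)" by simp
    then show "\<rho>' x = \<rho> x" using that(1,2) by (simp add: mollifier1_def)
  qed
  then have "inj_on (tensor_power :: _ \<Rightarrow> real \<times> real \<Rightarrow> complex) (mollifier1 1)"
    by (auto simp: inj_on_def)
  then show ?thesis
    unfolding tensor_base_def using assms by (rule inv_into_f_f)
qed


subsection \<open>Moderateness estimates\<close>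

lemma estimate_weaken:
  assumes "estimate u \<phi> K ds r" "r' \<le> r"
  shows "estimate u \<phi> K ds r'"
proof -
  obtain C \<eta> where C: "C > 0" "\<eta> > 0"
    "\<And>\<epsilon> x. 0 < \<epsilon> \<Longrightarrow> \<epsilon> < \<eta> \<Longrightarrow> x \<in> K \<Longrightarrow>
       norm (partials orthant ds (u (rescale \<epsilon> \<phi>)) x) \<le> C * \<epsilon> powr r"
    using assms(1) unfolding estimate_def by blast
  have "norm (partials orthant ds (u (rescale \<epsilon> \<phi>)) x) \<le> C * \<epsilon> powr r'"
    if "0 < \<epsilon>" "\<epsilon> < min \<eta> 1" "x \<in> K" for \<epsilon> x
  proof -
    have "\<epsilon> powr r \<le> \<epsilon> powr r'"
      using that assms(2) by (intro powr_mono') auto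
    then show ?thesis
      using C(1) C(3)[of \<epsilon> x] that by (smt (verit) mult_left_mono)
  qed
  then show ?thesis
    unfolding estimate_def using C(1,2)
    by (intro exI[of _ C] conjI exI[of _ "min \<eta> 1"]) auto
qed

lemma smooth_net_rescale:
  "smooth_net u \<Longrightarrow> \<phi> \<in> mollifier 1 \<Longrightarrow> 0 < \<epsilon> \<Longrightarrow> smooth_on orthant (u (rescale \<epsilon> \<phi>))"
  by (simp add: smooth_net_def mollifier_rescale)

lemma estimate_lincomb:
  assumes "smooth_net u" "smooth_net v" "\<phi> \<in> mollifier 1" "K \<subseteq> orthant" "set ds \<subseteq> Basis"
    and "estimate u \<phi> K ds r" "estimate v \<phi> K ds r"
  shows "estimate (\<lambda>\<phi> x. u \<phi> x + c * v \<phi> x) \<phi> K ds r"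
proof -
  obtain C \<eta> where C: "C > 0" "\<eta> > 0"
    "\<And>\<epsilon> x. 0 < \<epsilon> \<Longrightarrow> \<epsilon> < \<eta> \<Longrightarrow> x \<in> K \<Longrightarrow>
       norm (partials orthant ds (u (rescale \<epsilon> \<phi>)) x) \<le> C * \<epsilon> powr r"
    using assms(6) unfolding estimate_def by blast
  obtain D \<theta> where D: "D > 0" "\<theta> > 0"
    "\<And>\<epsilon> x. 0 < \<epsilon> \<Longrightarrow> \<epsilon> < \<theta> \<Longrightarrow> x \<in> K \<Longrightarrow>
       norm (partials orthant ds (v (rescale \<epsilon> \<phi>)) x) \<le> D * \<epsilon> powr r"
    using assms(7) unfolding estimate_def by blast
  have "norm (partials orthant ds (\<lambda>x. u (rescale \<epsilon> \<phi>) x + c * v (rescale \<epsilon> \<phi>) x) x)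
      \<le> (C + norm c * D) * \<epsilon> powr r" if "0 < \<epsilon>" "\<epsilon> < min \<eta> \<theta>" "x \<in> K" for \<epsilon> x
  proof -
    have "partials orthant ds (\<lambda>x. u (rescale \<epsilon> \<phi>) x + c * v (rescale \<epsilon> \<phi>) x) x =
        partials orthant ds (u (rescale \<epsilon> \<phi>)) x + c * partials orthant ds (v (rescale \<epsilon> \<phi>)) x"
      using that assms by (intro partials_lincomb smooth_net_rescale) auto
    also have "norm \<dots> \<le> C * \<epsilon> powr r + norm c * (D * \<epsilon> powr r)"
      using C(3)[of \<epsilon> x] D(3)[of \<epsilon> x] that
      by (intro order_trans[OF norm_triangle_ineq] add_mono) (auto simp: norm_mult intro!: mult_left_mono)
    finally show ?thesis by (simp add: algebra_simps)
  qed
  moreover have "C + norm c * D > 0" using C D by (simp add: add_pos_nonneg)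
  ultimately show ?thesis
    unfolding estimate_def using C(2) D(2)
    by (intro exI[of _ "C + norm c * D"] conjI exI[of _ "min \<eta> \<theta>"]) auto
qed

lemma estimate_mult_Nil:
  assumes "estimate u \<phi> K [] r" "estimate v \<phi> K [] r'"
  shows "estimate (\<lambda>\<phi> x. u \<phi> x * v \<phi> x) \<phi> K [] (r + r')"
proof -
  obtain C \<eta> where C: "C > 0" "\<eta> > 0"
    "\<And>\<epsilon> x. 0 < \<epsilon> \<Longrightarrow> \<epsilon> < \<eta> \<Longrightarrow> x \<in> K \<Longrightarrow> norm (u (rescale \<epsilon> \<phi>) x) \<le> C * \<epsilon> powr r"
    using assms(1) unfolding estimate_def by auto
  obtain D \<theta> where D: "D > 0" "\<theta> > 0"
    "\<And>\<epsilon> x. 0 < \<epsilon> \<Longrightarrow> \<epsilon> < \<theta> \<Longrightarrow> x \<in> K \<Longrightarrow> norm (v (rescale \<epsilon> \<phi>) x) \<le> D * \<epsilon> powr r'"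
    using assms(2) unfolding estimate_def by auto
  have "norm (u (rescale \<epsilon> \<phi>) x * v (rescale \<epsilon> \<phi>) x) \<le> (C * D) * \<epsilon> powr (r + r')"
    if "0 < \<epsilon>" "\<epsilon> < min \<eta> \<theta>" "x \<in> K" for \<epsilon> x
  proof -
    have "norm (u (rescale \<epsilon> \<phi>) x * v (rescale \<epsilon> \<phi>) x) \<le> (C * \<epsilon> powr r) * (D * \<epsilon> powr r')"
      unfolding norm_mult using C D that by (intro mult_mono) auto
    then show ?thesis by (simp add: powr_add mult_ac)
  qed
  then show ?thesis
    unfolding estimate_def using C D
    by (intro exI[of _ "C * D"] conjI exI[of _ "min \<eta> \<theta>"]) auto
qed

lemma estimate_cong:
  assumes "K \<subseteq> orthant" "\<phi> \<in> mollifier 1"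
    "\<And>\<phi> x. \<phi> \<in> mollifier 1 \<Longrightarrow> x \<in> orthant \<Longrightarrow> u \<phi> x = v \<phi> x"
  shows "estimate u \<phi> K ds r \<longleftrightarrow> estimate v \<phi> K ds r"
proof -
  have "partials orthant ds (u (rescale \<epsilon> \<phi>)) x = partials orthant ds (v (rescale \<epsilon> \<phi>)) x"
    if "0 < \<epsilon>" "x \<in> K" for \<epsilon> x
    using that assms by (intro partials_cong) (auto simp: mollifier_rescale)
  then show ?thesis unfolding estimate_def
    by (metis (no_types, lifting))
qed

lemma smooth_net_lincomb:
  "smooth_net u \<Longrightarrow> smooth_net v \<Longrightarrow> smooth_net (\<lambda>\<phi> x. u \<phi> x + c * v \<phi> x)"
  by (simp add: smooth_net_def smooth_on_lincomb)

lemma smooth_net_mult: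
  "smooth_net u \<Longrightarrow> smooth_net v \<Longrightarrow> smooth_net (\<lambda>\<phi> x. u \<phi> x * v \<phi> x)"
  by (simp add: smooth_net_def smooth_on_mult)

lemma smooth_net_partial:
  "smooth_net u \<Longrightarrow> b \<in> Basis \<Longrightarrow> smooth_net (\<lambda>\<phi>. partial orthant b (u \<phi>))"
  by (simp add: smooth_net_def smooth_on_partial)

lemma estimate_partial:
  "estimate (\<lambda>\<phi>. partial orthant b (u \<phi>)) \<phi> K ds r \<longleftrightarrow> estimate u \<phi> K (b # ds) r"
  by (simp add: estimate_def)

text \<open>The two growth conditions in a common form, with exponents \<open>- N\<close> and \<open>q - N\<close>.\<close>

definition net_bound ::
  "(nat \<Rightarrow> nat \<Rightarrow> real) \<Rightarrow> 'a::euclidean_space net \<Rightarrow> 'a set \<Rightarrow> 'a list \<Rightarrow> bool" where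
  "net_bound e u K ds \<longleftrightarrow> (\<exists>N\<ge>1. \<forall>q\<ge>N. \<forall>\<phi>\<in>mollifier q. estimate u \<phi> K ds (e q N))"

abbreviation "mod_exponent \<equiv> \<lambda>q N. - real N"
abbreviation "null_exponent \<equiv> \<lambda>q N. real q - real N"

lemma moderate_iff:
  "moderate u \<longleftrightarrow> smooth_net u \<and>
     (\<forall>K ds. compact K \<longrightarrow> K \<subseteq> orthant \<longrightarrow> set ds \<subseteq> Basis \<longrightarrow> net_bound mod_exponent u K ds)"
proof -
  have "(\<exists>N. \<forall>\<phi>\<in>mollifier N. estimate u \<phi> K ds (- real N)) \<longleftrightarrow> net_bound mod_exponent u K ds" for K ds
  proof
    assume "\<exists>N. \<forall>\<phi>\<in>mollifier N. estimate u \<phi> K ds (- real N)"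
    then obtain N where N: "\<And>\<phi>. \<phi> \<in> mollifier N \<Longrightarrow> estimate u \<phi> K ds (- real N)" by blast
    have "estimate u \<phi> K ds (- real (N + 1))" if "q \<ge> N + 1" "\<phi> \<in> mollifier q" for q \<phi>
      by (rule estimate_weaken[OF N]) (use that mollifier_mono[of N q] in auto)
    then show "net_bound mod_exponent u K ds"
      unfolding net_bound_def by (intro exI[of _ "N + 1"]) auto
  qed (auto simp: net_bound_def)
  then show ?thesis unfolding moderate_def by auto
qed

lemma null_net_iff:
  "null_net u \<longleftrightarrow> smooth_net u \<and>
     (\<forall>K ds. compact K \<longrightarrow> K \<subseteq> orthant \<longrightarrow> set ds \<subseteq> Basis \<longrightarrow> net_bound null_exponent u K ds)"
proof -
  have "(\<exists>N. \<forall>q\<ge>N. \<forall>\<phi>\<in>mollifier q. estimate u \<phi> K ds (real q - real N)) \<longleftrightarrow>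
      net_bound null_exponent u K ds" for K ds
  proof
    assume "\<exists>N. \<forall>q\<ge>N. \<forall>\<phi>\<in>mollifier q. estimate u \<phi> K ds (real q - real N)"
    then obtain N where N: "\<And>q \<phi>. q \<ge> N \<Longrightarrow> \<phi> \<in> mollifier q \<Longrightarrow> estimate u \<phi> K ds (real q - real N)"
      by blast
    have "estimate u \<phi> K ds (real q - real (N + 1))" if "q \<ge> N + 1" "\<phi> \<in> mollifier q" for q \<phi>
      by (rule estimate_weaken[OF N[of q]]) (use that in auto)
    then show "net_bound null_exponent u K ds"
      unfolding net_bound_def by (intro exI[of _ "N + 1"]) auto
  qed (auto simp: net_bound_def)
  then show ?thesis unfolding null_net_def by auto
qed

lemma net_bound_lincomb:
  assumes "smooth_net u" "smooth_net v" "K \<subseteq> orthant" "set ds \<subseteq> Basis"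
    and "net_bound e u K ds" "net_bound e v K ds"
    and e: "\<And>q N M. N \<le> M \<Longrightarrow> e q M \<le> e q N"
  shows "net_bound e (\<lambda>\<phi> x. u \<phi> x + c * v \<phi> x) K ds"
proof -
  obtain N M where NM: "N \<ge> 1" "M \<ge> 1"
    "\<And>q \<phi>. q \<ge> N \<Longrightarrow> \<phi> \<in> mollifier q \<Longrightarrow> estimate u \<phi> K ds (e q N)"
    "\<And>q \<phi>. q \<ge> M \<Longrightarrow> \<phi> \<in> mollifier q \<Longrightarrow> estimate v \<phi> K ds (e q M)"
    using assms(5,6) unfolding net_bound_def by blast
  have "estimate (\<lambda>\<phi> x. u \<phi> x + c * v \<phi> x) \<phi> K ds (e q (max N M))"
    if q: "q \<ge> max N M" "\<phi> \<in> mollifier q" for q \<phi>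
  proof (rule estimate_lincomb[OF assms(1,2) _ assms(3,4)])
    show "\<phi> \<in> mollifier 1" using q NM(1) by (intro mollifier_mono[of 1 q]) auto
    show "estimate u \<phi> K ds (e q (max N M))"
      by (rule estimate_weaken[OF NM(3)[of q]]) (use q e in auto)
    show "estimate v \<phi> K ds (e q (max N M))"
      by (rule estimate_weaken[OF NM(4)[of q]]) (use q e in auto)
  qed
  then show ?thesis
    unfolding net_bound_def using NM(1) by (intro exI[of _ "max N M"]) auto
qed

lemma net_bound_cong:
  assumes "K \<subseteq> orthant" "\<And>\<phi> x. \<phi> \<in> mollifier 1 \<Longrightarrow> x \<in> orthant \<Longrightarrow> u \<phi> x = v \<phi> x"
  shows "net_bound e u K ds \<longleftrightarrow> net_bound e v K ds"
proof -
  have "estimate u \<phi> K ds r \<longleftrightarrow> estimate v \<phi> K ds r" if "\<phi> \<in> mollifier q" "q \<ge> 1" for q \<phi> r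
    using that assms mollifier_mono[of 1 q] by (intro estimate_cong) auto
  then show ?thesis unfolding net_bound_def by (meson order_trans)
qed

lemma net_bound_partial:
  "net_bound e (\<lambda>\<phi>. partial orthant b (u \<phi>)) K ds \<longleftrightarrow> net_bound e u K (b # ds)"
  by (simp add: net_bound_def estimate_partial)

lemma net_bound_mult:
  fixes u v :: "'a::euclidean_space net"
  assumes "smooth_net u" "smooth_net v" "K \<subseteq> orthant" "set ds \<subseteq> Basis"
    and "\<And>ds. set ds \<subseteq> Basis \<Longrightarrow> net_bound mod_exponent u K ds"
    and "\<And>ds. set ds \<subseteq> Basis \<Longrightarrow> net_bound e v K ds"
    and e: "\<And>q N M. N \<le> M \<Longrightarrow> e q M \<le> e q N" "\<And>q N M. e q (N + M) = - real N + e q M"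
  shows "net_bound e (\<lambda>\<phi> x. u \<phi> x * v \<phi> x) K ds"
  using assms(1,2,4-6)
proof (induction ds arbitrary: u v)
  case Nil
  obtain N M where NM: "N \<ge> 1" "M \<ge> 1"
    "\<And>q \<phi>. q \<ge> N \<Longrightarrow> \<phi> \<in> mollifier q \<Longrightarrow> estimate u \<phi> K [] (- real N)"
    "\<And>q \<phi>. q \<ge> M \<Longrightarrow> \<phi> \<in> mollifier q \<Longrightarrow> estimate v \<phi> K [] (e q M)"
    using Nil.prems(4)[of "[]"] Nil.prems(5)[of "[]"] unfolding net_bound_def by auto
  have "estimate (\<lambda>\<phi> x. u \<phi> x * v \<phi> x) \<phi> K [] (e q (N + M))"
    if "q \<ge> N + M" "\<phi> \<in> mollifier q" for q \<phi>
    unfolding e(2) by (intro estimate_mult_Nil NM(3)[of q] NM(4)[of q]) (use that in auto)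
  then show ?case
    unfolding net_bound_def using NM(1) by (intro exI[of _ "N + M"]) auto
next
  case (Cons b ds)
  then have b: "b \<in> Basis" "set ds \<subseteq> Basis" by auto
  let ?du = "\<lambda>\<phi>. partial orthant b (u \<phi>)" and ?dv = "\<lambda>\<phi>. partial orthant b (v \<phi>)"
  have 1: "net_bound e (\<lambda>\<phi> x. u \<phi> x * ?dv \<phi> x) K ds"
    using Cons.prems b by (intro Cons.IH smooth_net_partial) (auto simp: net_bound_partial)
  have 2: "net_bound e (\<lambda>\<phi> x. ?du \<phi> x * v \<phi> x) K ds"
    using Cons.prems b by (intro Cons.IH smooth_net_partial) (auto simp: net_bound_partial)
  have "net_bound e (\<lambda>\<phi> x. u \<phi> x * ?dv \<phi> x + 1 * (?du \<phi> x * v \<phi> x)) K ds"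
    using 1 2 Cons.prems b assms(3)
    by (intro net_bound_lincomb smooth_net_mult smooth_net_partial e(1)) auto
  also have "net_bound e (\<lambda>\<phi> x. u \<phi> x * ?dv \<phi> x + 1 * (?du \<phi> x * v \<phi> x)) K ds \<longleftrightarrow>
      net_bound e (\<lambda>\<phi>. partial orthant b (\<lambda>x. u \<phi> x * v \<phi> x)) K ds"
    using Cons.prems b assms(3)
    by (intro net_bound_cong) (auto simp: partial_mult smooth_net_def)
  finally show ?case by (simp add: net_bound_partial)
qed

lemma moderate_lincomb:
  "moderate u \<Longrightarrow> moderate v \<Longrightarrow> moderate (\<lambda>\<phi> x. u \<phi> x + c * v \<phi> x)"
  unfolding moderate_iff by (auto intro!: net_bound_lincomb smooth_net_lincomb)

lemma null_net_lincomb: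
  "null_net u \<Longrightarrow> null_net v \<Longrightarrow> null_net (\<lambda>\<phi> x. u \<phi> x + c * v \<phi> x)"
  unfolding null_net_iff by (auto intro!: net_bound_lincomb smooth_net_lincomb)

lemma moderate_mult:
  "moderate u \<Longrightarrow> moderate v \<Longrightarrow> moderate (\<lambda>\<phi> x. u \<phi> x * v \<phi> x)"
  unfolding moderate_iff by (auto intro!: net_bound_mult smooth_net_mult)

lemma null_net_mult:
  "moderate u \<Longrightarrow> null_net v \<Longrightarrow> null_net (\<lambda>\<phi> x. u \<phi> x * v \<phi> x)"
  unfolding moderate_iff null_net_iff by (auto intro!: net_bound_mult smooth_net_mult)

lemma moderate_partial: "moderate u \<Longrightarrow> b \<in> Basis \<Longrightarrow> moderate (\<lambda>\<phi>. partial orthant b (u \<phi>))"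
  unfolding moderate_iff by (auto intro!: smooth_net_partial simp: net_bound_partial)

lemma null_net_partial: "null_net u \<Longrightarrow> b \<in> Basis \<Longrightarrow> null_net (\<lambda>\<phi>. partial orthant b (u \<phi>))"
  unfolding null_net_iff by (auto intro!: smooth_net_partial simp: net_bound_partial)

lemma partials_zero:
  "set ds \<subseteq> Basis \<Longrightarrow> x \<in> orthant \<Longrightarrow> partials orthant ds (\<lambda>x::'a::euclidean_space. 0) x = 0"
  using partials_lincomb[of "\<lambda>x::'a. 0" "\<lambda>x. 0" ds x "-1"] smooth_on_const[where 'a='a] by simp

lemma null_net_zero: "null_net (\<lambda>\<phi> x::'a::euclidean_space. 0)"
proof -
  have "estimate (\<lambda>\<phi> x. 0) \<phi> K ds r" if "K \<subseteq> orthant" "set ds \<subseteq> Basis"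
    for \<phi> :: "'a \<Rightarrow> complex" and K ds r
  proof -
    have "norm (partials orthant ds (\<lambda>x. 0) x) \<le> 1 * \<epsilon> powr r" if "x \<in> K" for \<epsilon> x
      using partials_zero[of ds x] that \<open>K \<subseteq> orthant\<close> \<open>set ds \<subseteq> Basis\<close> by auto
    then show ?thesis
      unfolding estimate_def using zero_less_one by blast
  qed
  then show ?thesis
    unfolding null_net_def smooth_net_def using smooth_on_const by blast
qed

lemma null_net_imp_moderate: "null_net u \<Longrightarrow> moderate u"
proof -
  have "net_bound mod_exponent u K ds" if null: "net_bound null_exponent u K ds" for K ds
  proof -
    obtain N where N: "N \<ge> 1"
      "\<And>q \<phi>. q \<ge> N \<Longrightarrow> \<phi> \<in> mollifier q \<Longrightarrow> estimate u \<phi> K ds (real q - real N)"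
      using null unfolding net_bound_def by blast
    have "estimate u \<phi> K ds (- real N)" if "q \<ge> N" "\<phi> \<in> mollifier q" for q \<phi>
      by (rule estimate_weaken[OF N(2)[OF that]]) simp
    then show ?thesis unfolding net_bound_def using N(1) by blast
  qed
  then show "null_net u \<Longrightarrow> moderate u"
    unfolding null_net_iff moderate_iff by simp
qed

lemma moderate_zero: "moderate (\<lambda>\<phi> x. 0)"
  by (rule null_net_imp_moderate[OF null_net_zero])

lemma null_net_cong:
  assumes "\<And>\<phi> x. \<phi> \<in> mollifier 1 \<Longrightarrow> x \<in> orthant \<Longrightarrow> u \<phi> x = v \<phi> x"
  shows "null_net u \<longleftrightarrow> null_net v"
proof -
  have "smooth_on orthant (u \<phi>) \<longleftrightarrow> smooth_on orthant (v \<phi>)" if "\<phi> \<in> mollifier 1" for \<phi>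
    using assms[OF that] by (rule smooth_on_cong)
  moreover have "net_bound e u K ds \<longleftrightarrow> net_bound e v K ds" if "K \<subseteq> orthant" for e K ds
    using that assms by (rule net_bound_cong)
  ultimately show ?thesis
    unfolding null_net_iff smooth_net_def by auto
qed

lemma colombeau_rel_refl: "moderate u \<Longrightarrow> colombeau_rel u u"
  by (simp add: colombeau_rel_def null_net_zero)

lemma colombeau_rel_lincomb:
  assumes "colombeau_rel u u'" "colombeau_rel v v'"
  shows "colombeau_rel (\<lambda>\<phi> x. u \<phi> x + c * v \<phi> x) (\<lambda>\<phi> x. u' \<phi> x + c * v' \<phi> x)"
proof -
  have "null_net (\<lambda>\<phi> x. (u \<phi> x - u' \<phi> x) + c * (v \<phi> x - v' \<phi> x))"
    using assms by (intro null_net_lincomb) (auto simp: colombeau_rel_def)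
  then show ?thesis
    using assms by (auto simp: colombeau_rel_def moderate_lincomb algebra_simps)
qed

lemma colombeau_rel_mult:
  assumes "colombeau_rel u u'" "colombeau_rel v v'"
  shows "colombeau_rel (\<lambda>\<phi> x. u \<phi> x * v \<phi> x) (\<lambda>\<phi> x. u' \<phi> x * v' \<phi> x)"
proof -
  have "null_net (\<lambda>\<phi> x. (u \<phi> x * (v \<phi> x - v' \<phi> x)) + 1 * (v' \<phi> x * (u \<phi> x - u' \<phi> x)))"
    using assms by (intro null_net_lincomb null_net_mult) (auto simp: colombeau_rel_def)
  then show ?thesis
    using assms by (auto simp: colombeau_rel_def moderate_mult algebra_simps)
qed

lemma colombeau_rel_partial:
  assumes "colombeau_rel u v" "b \<in> Basis"
  shows "colombeau_rel (\<lambda>\<phi>. partial orthant b (u \<phi>)) (\<lambda>\<phi>. partial orthant b (v \<phi>))"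
proof -
  have "null_net (\<lambda>\<phi>. partial orthant b (\<lambda>x. u \<phi> x - v \<phi> x))"
    using assms by (intro null_net_partial) (auto simp: colombeau_rel_def)
  moreover have "partial orthant b (\<lambda>x. u \<phi> x - v \<phi> x) x = partial orthant b (u \<phi>) x - partial orthant b (v \<phi>) x"
    if "\<phi> \<in> mollifier 1" "x \<in> orthant" for \<phi> x
    using partial_lincomb[of "u \<phi>" "v \<phi>" b x "-1"] assms that
    by (simp add: colombeau_rel_def moderate_def smooth_net_def)
  ultimately have "null_net (\<lambda>\<phi> x. partial orthant b (u \<phi>) x - partial orthant b (v \<phi>) x)"
    by (subst (asm) null_net_cong) auto
  then show ?thesis
    using assms by (simp add: colombeau_rel_def moderate_partial)
qed


section \<open>The Colombeau algebra\<close>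

quotient_type (overloaded) 'a colombeau = "('a::euclidean_space \<Rightarrow> complex) \<Rightarrow> 'a \<Rightarrow> complex" / partial: colombeau_rel
proof (rule part_equivpI)
  show "\<exists>u :: 'a net. colombeau_rel u u"
    using colombeau_rel_refl[OF moderate_zero] by blast
  show "symp (colombeau_rel :: 'a net \<Rightarrow> _)"
  proof (rule sympI)
    fix u v :: "'a net"
    assume "colombeau_rel u v"
    then show "colombeau_rel v u"
      using null_net_lincomb[OF null_net_zero, of "\<lambda>\<phi> x. u \<phi> x - v \<phi> x" "-1"]
      by (simp add: colombeau_rel_def)
  qed
  show "transp (colombeau_rel :: 'a net \<Rightarrow> _)"
  proof (rule transpI)
    fix u v w :: "'a net"
    assume "colombeau_rel u v" "colombeau_rel v w"
    then show "colombeau_rel u w"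
      using null_net_lincomb[of "\<lambda>\<phi> x. u \<phi> x - v \<phi> x" "\<lambda>\<phi> x. v \<phi> x - w \<phi> x" 1]
      by (simp add: colombeau_rel_def)
  qed
qed

instantiation colombeau :: (euclidean_space) comm_ring
begin

lift_definition zero_colombeau :: "'a colombeau" is "\<lambda>\<phi> x. 0"
  by (rule colombeau_rel_refl[OF moderate_zero])

lift_definition plus_colombeau :: "'a colombeau \<Rightarrow> 'a colombeau \<Rightarrow> 'a colombeau"
  is "\<lambda>u v \<phi> x. u \<phi> x + v \<phi> x"
  using colombeau_rel_lincomb[where c = 1] by simp

lift_definition minus_colombeau :: "'a colombeau \<Rightarrow> 'a colombeau \<Rightarrow> 'a colombeau"
  is "\<lambda>u v \<phi> x. u \<phi> x - v \<phi> x"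
  using colombeau_rel_lincomb[where c = "-1"] by simp

lift_definition uminus_colombeau :: "'a colombeau \<Rightarrow> 'a colombeau"
  is "\<lambda>u \<phi> x. - u \<phi> x"
  using colombeau_rel_lincomb[OF colombeau_rel_refl[OF moderate_zero], where c = "-1"] by simp

lift_definition times_colombeau :: "'a colombeau \<Rightarrow> 'a colombeau \<Rightarrow> 'a colombeau"
  is "\<lambda>u v \<phi> x. u \<phi> x * v \<phi> x"
  by (rule colombeau_rel_mult)

instance
proof
  fix a b c :: "'a colombeau"
  note [simp] = colombeau_rel_def
  note I = colombeau_rel_refl moderate_mult moderate_lincomb[where c = 1, simplified]
    moderate_lincomb[where c = "-1", simplified]
    moderate_lincomb[OF moderate_zero, where c = "-1", simplified] moderate_zero
  show "a * b * c = a * (b * c)"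
    by transfer (simp add: mult.assoc null_net_zero I)
  show "a * b = b * a"
    by transfer (simp add: mult.commute null_net_zero I)
  show "a + b + c = a + (b + c)"
    by transfer (simp add: add.assoc null_net_zero I)
  show "a + b = b + a"
    by transfer (simp add: add.commute null_net_zero I)
  show "0 + a = a"
    by transfer (simp add: null_net_zero I)
  show "- a + a = 0"
    by transfer (simp add: null_net_zero I)
  show "a - b = a + - b"
    by transfer (simp add: null_net_zero I)
  show "(a + b) * c = a * c + b * c"
    by transfer (simp add: distrib_right null_net_zero I)
qed

end

lift_definition deriv1 :: "real colombeau \<Rightarrow> real colombeau"
  is "\<lambda>u \<phi>. partial orthant 1 (u \<phi>)"
  by (rule colombeau_rel_partial) auto

lift_definition deriv_x :: "(real \<times> real) colombeau \<Rightarrow> (real \<times> real) colombeau"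
  is "\<lambda>u \<phi>. partial orthant (1, 0) (u \<phi>)"
  by (rule colombeau_rel_partial) (auto simp: Basis_prod_def)

lift_definition deriv_t :: "(real \<times> real) colombeau \<Rightarrow> (real \<times> real) colombeau"
  is "\<lambda>u \<phi>. partial orthant (0, 1) (u \<phi>)"
  by (rule colombeau_rel_partial) (auto simp: Basis_prod_def)


subsection \<open>Restriction to the axes and extension in the time variable\<close>

lemma orthant_real: "x \<in> orthant \<longleftrightarrow> 0 \<le> x" for x :: real
  by (simp add: orthant_def)

lemma orthant_prod: "p \<in> orthant \<longleftrightarrow> 0 \<le> fst p \<and> 0 \<le> snd p" for p :: "real \<times> real"
  by (auto simp: orthant_def Basis_prod_def inner_prod_def)

lemma has_vd_embed:
  fixes j :: "real \<Rightarrow> real \<times> real"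
  assumes "linear j" "\<And>x. j x \<in> orthant \<longleftrightarrow> x \<in> orthant" "j 1 \<in> Basis"
    and "smooth_on orthant f" "x \<in> orthant"
  shows "((\<lambda>s. f (j (x + s *\<^sub>R 1))) has_vector_derivative partial orthant (j 1) f (j x))
           (at 0 within axis_line orthant 1 x)"
proof -
  have j: "j (x + s *\<^sub>R 1) = j x + s *\<^sub>R j 1" for s
    by (simp only: linear_add[OF assms(1)] linear_scale[OF assms(1)])
  have "axis_line orthant 1 x = axis_line orthant (j 1) (j x)"
    unfolding axis_line_def j[symmetric] assms(2) ..
  then show ?thesis
    unfolding j using smooth_on_has_vd[OF assms(4,3), of "j x"] assms(2,5) by simp
qed

lemma smooth_on_embed:
  fixes j :: "real \<Rightarrow> real \<times> real"
  assumes j: "linear j" "\<And>x. j x \<in> orthant \<longleftrightarrow> x \<in> orthant" "j 1 \<in> Basis"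
    and "smooth_on orthant f"
  shows "smooth_on orthant (\<lambda>x. f (j x))"
proof (rule smooth_on_orthantI[where P = "\<lambda>h. \<exists>f. smooth_on orthant f \<and> h = (\<lambda>x. f (j x))"])
  fix h :: "real \<Rightarrow> complex"
  assume "\<exists>f. smooth_on orthant f \<and> h = (\<lambda>x. f (j x))"
  then obtain f where f: "smooth_on orthant f" and h: "h = (\<lambda>x. f (j x))" by blast
  have "continuous_on orthant j"
    using j(1) by (intro linear_continuous_on) (simp add: linear_conv_bounded_linear)
  then show "continuous_on orthant h"
    unfolding h using smooth_on_continuous[OF f] j(2)
    by (intro continuous_on_compose2[of orthant f _ j] image_subsetI) simp_all
  fix b :: real assume "b \<in> Basis"
  then have b: "b = 1" by simp
  show "\<exists>g. (\<exists>f. smooth_on orthant f \<and> g = (\<lambda>x. f (j x))) \<and> (\<forall>x\<in>orthant.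
      ((\<lambda>s. h (x + s *\<^sub>R b)) has_vector_derivative g x) (at 0 within axis_line orthant b x))"
  proof (intro exI conjI ballI)
    show "smooth_on orthant (partial orthant (j 1) f)"
      using f j(3) by (rule smooth_on_partial)
    show "((\<lambda>s. h (x + s *\<^sub>R b)) has_vector_derivative partial orthant (j 1) f (j x))
        (at 0 within axis_line orthant b x)" if "x \<in> orthant" for x
      unfolding h b by (rule has_vd_embed[OF j f that])
  qed simp
next
  show "\<exists>g. smooth_on orthant g \<and> (\<lambda>x. f (j x)) = (\<lambda>x. g (j x))"
    by (intro exI[of _ f] conjI assms(4) refl)
qed

lemma partials_embed:
  fixes j :: "real \<Rightarrow> real \<times> real"
  assumes j: "linear j" "\<And>x. j x \<in> orthant \<longleftrightarrow> x \<in> orthant" "j 1 \<in> Basis"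
    and "smooth_on orthant f" "set ds \<subseteq> Basis" "x \<in> orthant"
  shows "partials orthant ds (\<lambda>x. f (j x)) x = partials orthant (map j ds) f (j x)"
  using assms(4,5)
proof (induction ds arbitrary: f)
  case (Cons b ds)
  then have b: "b = 1" by simp
  have "partials orthant (b # ds) (\<lambda>x. f (j x)) x =
      partials orthant ds (\<lambda>x. partial orthant (j 1) f (j x)) x"
    unfolding partials.simps b
    by (intro partials_cong assms(6) partial_orthantI has_vd_embed j Cons.prems) auto
  also have "\<dots> = partials orthant (map j ds) (partial orthant (j 1) f) (j x)"
    using Cons j(3) by (simp add: smooth_on_partial)
  finally show ?case by (simp add: b)
qed simp

lemma mollifier_tensor_power: "\<rho> \<in> mollifier q \<Longrightarrow> tensor_power \<rho> \<in> mollifier q"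
  for \<rho> :: "real \<Rightarrow> complex"
  by (auto simp: mollifier_def)

lemma net_bound_embed:
  fixes j :: "real \<Rightarrow> real \<times> real"
  assumes j: "linear j" "\<And>x. j x \<in> orthant \<longleftrightarrow> x \<in> orthant" "j 1 \<in> Basis"
    and "smooth_net u" "K \<subseteq> orthant" "set ds \<subseteq> Basis" "net_bound e u (j ` K) (map j ds)"
  shows "net_bound e (\<lambda>\<rho> x. u (tensor_power \<rho>) (j x)) K ds"
proof -
  obtain N where N: "N \<ge> 1"
    "\<And>q \<phi>. q \<ge> N \<Longrightarrow> \<phi> \<in> mollifier q \<Longrightarrow> estimate u \<phi> (j ` K) (map j ds) (e q N)"
    using assms(7) unfolding net_bound_def by blast
  have "estimate (\<lambda>\<rho> x. u (tensor_power \<rho>) (j x)) \<rho> K ds (e q N)"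
    if q: "q \<ge> N" "\<rho> \<in> mollifier q" for q \<rho>
  proof -
    have \<rho>: "tensor_power \<rho> \<in> mollifier 1"
      using q N(1) mollifier_mono[of 1 q] mollifier_tensor_power by auto
    have *: "partials orthant ds (\<lambda>x. u (tensor_power (rescale \<epsilon> \<rho>)) (j x)) x =
        partials orthant (map j ds) (u (rescale \<epsilon> (tensor_power \<rho>))) (j x)"
      if "0 < \<epsilon>" "x \<in> K" for \<epsilon> x
      unfolding rescale_tensor_power[symmetric]
      using that assms(5,6) by (intro partials_embed j smooth_net_rescale[OF assms(4) \<rho>]) auto
    have "estimate u (tensor_power \<rho>) (j ` K) (map j ds) (e q N)"
      using q by (intro N(2) mollifier_tensor_power)
    then show ?thesis
      unfolding estimate_def by (force simp: *)
  qed
  then show ?thesis unfolding net_bound_def using N(1) by blast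
qed

lemma colombeau_rel_embed:
  fixes j :: "real \<Rightarrow> real \<times> real"
  assumes j: "linear j" "\<And>x. j x \<in> orthant \<longleftrightarrow> x \<in> orthant" "j 1 \<in> Basis"
    and "colombeau_rel u v"
  shows "colombeau_rel (\<lambda>\<rho> x. u (tensor_power \<rho>) (j x)) (\<lambda>\<rho> x. v (tensor_power \<rho>) (j x))"
proof -
  have K: "compact (j ` K)" "j ` K \<subseteq> orthant" if "compact K" "K \<subseteq> orthant" for K
  proof -
    show "compact (j ` K)"
      using j(1) that(1)
      by (intro compact_continuous_image linear_continuous_on) (simp_all add: linear_conv_bounded_linear)
    show "j ` K \<subseteq> orthant" using j(2) that(2) by auto
  qed
  have ds: "set (map j ds) \<subseteq> Basis" if "set ds \<subseteq> Basis" for ds :: "real list"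
    using that j(3) by auto
  have smooth: "smooth_net (\<lambda>\<rho> x. w (tensor_power \<rho>) (j x))" if "smooth_net w" for w
    using that smooth_on_embed[OF j] mollifier_tensor_power unfolding smooth_net_def by blast
  have mod: "moderate (\<lambda>\<rho> x. w (tensor_power \<rho>) (j x))" if "moderate w" for w
  proof -
    have w: "smooth_net w" and b: "\<And>K ds. compact K \<Longrightarrow> K \<subseteq> orthant \<Longrightarrow> set ds \<subseteq> Basis \<Longrightarrow>
        net_bound mod_exponent w K ds"
      using that unfolding moderate_iff by simp_all
    show ?thesis
      unfolding moderate_iff using smooth[OF w] net_bound_embed[OF j w _ _ b[OF K ds]] by simp
  qed
  have "null_net (\<lambda>\<rho> x. w (tensor_power \<rho>) (j x))" if "null_net w" for w
  proof -
    have w: "smooth_net w" and b: "\<And>K ds. compact K \<Longrightarrow> K \<subseteq> orthant \<Longrightarrow> set ds \<subseteq> Basis \<Longrightarrow>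
        net_bound null_exponent w K ds"
      using that unfolding null_net_iff by simp_all
    show ?thesis
      unfolding null_net_iff using smooth[OF w] net_bound_embed[OF j w _ _ b[OF K ds]] by simp
  qed
  note null = this
  have "null_net (\<lambda>\<rho> x. u (tensor_power \<rho>) (j x) - v (tensor_power \<rho>) (j x))"
    by (rule null[where w = "\<lambda>\<phi> x. u \<phi> x - v \<phi> x"]) (use assms(4) in \<open>simp add: colombeau_rel_def\<close>)
  then show ?thesis
    using assms(4) mod by (simp add: colombeau_rel_def)
qed

lift_definition restrict_t0 :: "(real \<times> real) colombeau \<Rightarrow> real colombeau"
  is "\<lambda>u \<rho> x. u (tensor_power \<rho>) (x, 0)"
  by (rule colombeau_rel_embed) (auto simp: linear_iff orthant_prod orthant_real Basis_prod_def)

lift_definition restrict_x0 :: "(real \<times> real) colombeau \<Rightarrow> real colombeau"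
  is "\<lambda>u \<rho> t. u (tensor_power \<rho>) (0, t)"
  by (rule colombeau_rel_embed) (auto simp: linear_iff orthant_prod orthant_real Basis_prod_def)

lemma fst_orthant: "p \<in> orthant \<Longrightarrow> fst p \<in> orthant" for p :: "real \<times> real"
  by (simp add: orthant_prod orthant_real)

lemma has_vd_fst:
  fixes f :: "real \<Rightarrow> complex" and p :: "real \<times> real"
  assumes "smooth_on orthant f" "p \<in> orthant"
  shows "((\<lambda>s. f (fst (p + s *\<^sub>R (1, 0)))) has_vector_derivative partial orthant 1 f (fst p))
           (at 0 within axis_line orthant (1, 0) p)"
    and "((\<lambda>s. f (fst (p + s *\<^sub>R (0, 1)))) has_vector_derivative 0)
           (at 0 within axis_line orthant (0, 1) p)"
proof -
  have "axis_line orthant (1, 0) p = axis_line orthant 1 (fst p)"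
    using assms(2) by (auto simp: axis_line_def orthant_prod orthant_real)
  then show "((\<lambda>s. f (fst (p + s *\<^sub>R (1, 0)))) has_vector_derivative partial orthant 1 f (fst p))
           (at 0 within axis_line orthant (1, 0) p)"
    using smooth_on_has_vd[OF assms(1), of 1 "fst p"] fst_orthant[OF assms(2)] by simp
qed (simp add: has_vector_derivative_const)

lemma Basis_real_real: "b \<in> Basis \<longleftrightarrow> b = (1, 0) \<or> b = (0, 1)" for b :: "real \<times> real"
  by (auto simp: Basis_prod_def)

lemma smooth_on_fst:
  fixes f :: "real \<Rightarrow> complex"
  assumes "smooth_on orthant f"
  shows "smooth_on orthant (\<lambda>p::real \<times> real. f (fst p))"
proof (rule smooth_on_orthantI[where P = "\<lambda>h. \<exists>f. smooth_on orthant f \<and> h = (\<lambda>p. f (fst p))"])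
  fix h :: "real \<times> real \<Rightarrow> complex"
  assume "\<exists>f. smooth_on orthant f \<and> h = (\<lambda>p. f (fst p))"
  then obtain f where f: "smooth_on orthant f" and h: "h = (\<lambda>p. f (fst p))" by blast
  show "continuous_on orthant h"
    unfolding h
    by (intro continuous_on_compose2[OF smooth_on_continuous[OF f]] continuous_on_fst continuous_on_id
        image_subsetI fst_orthant)
  fix b :: "real \<times> real" assume "b \<in> Basis"
  then consider "b = (1, 0)" | "b = (0, 1)" by (auto simp: Basis_real_real)
  then show "\<exists>g. (\<exists>f. smooth_on orthant f \<and> g = (\<lambda>p. f (fst p))) \<and> (\<forall>x\<in>orthant.
      ((\<lambda>s. h (x + s *\<^sub>R b)) has_vector_derivative g x) (at 0 within axis_line orthant b x))"
  proof cases
    case 1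
    have "smooth_on orthant (partial orthant 1 f)" using f by (rule smooth_on_partial) simp
    then show ?thesis
      unfolding h 1
      by (intro exI[of _ "\<lambda>p. partial orthant 1 f (fst p)"] exI[of _ "partial orthant 1 f"]
          conjI ballI refl has_vd_fst(1)[OF f])
  next
    case 2
    show ?thesis
      unfolding h 2
      by (intro exI[of _ "\<lambda>p. 0"] exI[of _ "\<lambda>x. 0"]
          conjI ballI refl has_vd_fst(2)[OF f] smooth_on_const)
  qed
next
  show "\<exists>g. smooth_on orthant g \<and> (\<lambda>p::real \<times> real. f (fst p)) = (\<lambda>p. g (fst p))"
    by (intro exI[of _ f] conjI assms refl)
qed

lemma partials_fst:
  fixes f :: "real \<Rightarrow> complex"
  assumes "smooth_on orthant f" "set ds \<subseteq> Basis" "p \<in> orthant"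
  shows "partials orthant ds (\<lambda>p::real \<times> real. f (fst p)) p =
    (if (0, 1) \<in> set ds then 0 else partials orthant (map fst ds) f (fst p))"
  using assms(1,2)
proof (induction ds arbitrary: f)
  case (Cons b ds)
  then consider "b = (1, 0)" | "b = (0, 1)" by (auto simp: Basis_real_real)
  then show ?case
  proof cases
    case 1
    have "partials orthant (b # ds) (\<lambda>p. f (fst p)) p =
        partials orthant ds (\<lambda>p. partial orthant 1 f (fst p)) p"
      unfolding partials.simps 1
      by (intro partials_cong assms(3) partial_orthantI has_vd_fst Cons.prems) (auto simp: Basis_real_real)
    also have "\<dots> = (if (0, 1) \<in> set ds then 0
        else partials orthant (map fst ds) (partial orthant 1 f) (fst p))"
      using Cons.prems by (intro Cons.IH smooth_on_partial) auto
    finally show ?thesis by (simp add: 1)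
  next
    case 2
    have "partials orthant (b # ds) (\<lambda>p. f (fst p)) p = partials orthant ds (\<lambda>p. 0) p"
      unfolding partials.simps 2
      by (intro partials_cong assms(3) partial_orthantI has_vd_fst(2)[OF Cons.prems(1)]) (auto simp: Basis_real_real)
    then show ?thesis
      using Cons.prems assms(3) by (simp add: 2 partials_zero)
  qed
qed simp

lemma net_bound_fst:
  fixes u :: "real net" and K :: "(real \<times> real) set"
  assumes "smooth_net u" "K \<subseteq> orthant" "set ds \<subseteq> Basis" "net_bound e u (fst ` K) (map fst ds)"
  shows "net_bound e (\<lambda>\<phi> p. u (tensor_base \<phi>) (fst p)) K ds"
proof -
  obtain N where N: "N \<ge> 1"
    "\<And>q \<phi>. q \<ge> N \<Longrightarrow> \<phi> \<in> mollifier q \<Longrightarrow> estimate u \<phi> (fst ` K) (map fst ds) (e q N)"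
    using assms(4) unfolding net_bound_def by blast
  have "estimate (\<lambda>\<phi> p. u (tensor_base \<phi>) (fst p)) \<phi> K ds (e q N)"
    if q: "q \<ge> N" and \<phi>: "\<phi> \<in> mollifier q" for q \<phi>
  proof -
    obtain \<rho> where \<rho>: "\<rho> \<in> mollifier1 q" "\<phi> = tensor_power \<rho>"
      using \<phi> by (auto simp: mollifier_def)
    have \<rho>1: "\<rho> \<in> mollifier1 1" using \<rho>(1) q N(1) by (intro mollifier1_mono[of 1 q]) auto
    have base: "tensor_base (rescale \<epsilon> \<phi>) = rescale \<epsilon> \<rho>" if "0 < \<epsilon>" for \<epsilon>
      unfolding \<rho>(2) rescale_tensor_power
      using that \<rho>1 by (intro tensor_base_tensor_power mollifier1_rescale)
    have *: "norm (partials orthant ds (\<lambda>p. u (tensor_base (rescale \<epsilon> \<phi>)) (fst p)) p) \<le>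
        norm (partials orthant (map fst ds) (u (rescale \<epsilon> \<rho>)) (fst p))"
      if "0 < \<epsilon>" "p \<in> K" for \<epsilon> p
    proof -
      have "smooth_on orthant (u (rescale \<epsilon> \<rho>))"
        using \<rho>1 that by (intro smooth_net_rescale[OF assms(1)]) (auto simp: mollifier_real)
      moreover have "p \<in> orthant" using that(2) assms(2) by blast
      ultimately show ?thesis
        unfolding base[OF that(1)] by (simp only: partials_fst[OF _ assms(3)]) simp
    qed
    have est: "estimate u \<rho> (fst ` K) (map fst ds) (e q N)"
      using q \<rho>(1) by (intro N(2)) (auto simp: mollifier_real)
    show ?thesis
    proof -
      obtain C \<eta> where C: "C > 0" "\<eta> > 0"
        "\<forall>\<epsilon>. 0 < \<epsilon> \<and> \<epsilon> < \<eta> \<longrightarrow> (\<forall>x\<in>fst ` K.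
           norm (partials orthant (map fst ds) (u (rescale \<epsilon> \<rho>)) x) \<le> C * \<epsilon> powr e q N)"
        using est unfolding estimate_def by (elim exE conjE) (rule that)
      have bd: "norm (partials orthant ds (\<lambda>p. u (tensor_base (rescale \<epsilon> \<phi>)) (fst p)) p) \<le> C * \<epsilon> powr e q N"
        if "0 < \<epsilon> \<and> \<epsilon> < \<eta>" "p \<in> K" for \<epsilon> p
        using order_trans[OF *[of \<epsilon> p] C(3)[rule_format, of \<epsilon> "fst p"]] that by simp
      show ?thesis
        unfolding estimate_def
        by (rule exI[of _ C], rule conjI[OF C(1)], rule exI[of _ \<eta>]) (auto intro: C(2) bd)
    qed
  qed
  then show ?thesis unfolding net_bound_def using N(1) by blast
qed

text \<open>
  If \<open>(0, 1)\<close> occurs in \<open>ds\<close>, then \<open>map fst ds\<close> contains \<open>0\<close>, which is not a basis vector;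
  the derivative vanishes in that case.
\<close>

lemma net_bound_fst':
  fixes u :: "real net" and K :: "(real \<times> real) set"
  assumes "smooth_net u" "K \<subseteq> orthant" "set ds \<subseteq> Basis"
    and "\<And>ds. set ds \<subseteq> Basis \<Longrightarrow> net_bound e u (fst ` K) ds"
  shows "net_bound e (\<lambda>\<phi> p. u (tensor_base \<phi>) (fst p)) K ds"
proof (cases "(0, 1) \<in> set ds")
  case False
  then have "set (map fst ds) \<subseteq> Basis"
    using assms(3) by (force simp: Basis_real_real)
  then show ?thesis using assms by (intro net_bound_fst) auto
next
  case True
  have "estimate (\<lambda>\<phi> p. u (tensor_base \<phi>) (fst p)) \<phi> K ds (e q 1)"
    if q: "q \<ge> 1" and \<phi>: "\<phi> \<in> mollifier q" for q \<phi>
  proof -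
    obtain \<rho> where \<rho>: "\<rho> \<in> mollifier1 q" "\<phi> = tensor_power \<rho>"
      using \<phi> by (auto simp: mollifier_def)
    have \<rho>1: "\<rho> \<in> mollifier1 1" using \<rho>(1) q by (intro mollifier1_mono[of 1 q]) auto
    have "partials orthant ds (\<lambda>p. u (tensor_base (rescale \<epsilon> \<phi>)) (fst p)) p = 0"
      if "0 < \<epsilon>" "p \<in> K" for \<epsilon> p
    proof -
      have "tensor_base (rescale \<epsilon> \<phi>) = rescale \<epsilon> \<rho>"
        unfolding \<rho>(2) rescale_tensor_power
        using that \<rho>1 by (intro tensor_base_tensor_power mollifier1_rescale)
      moreover have "smooth_on orthant (u (rescale \<epsilon> \<rho>))"
        using \<rho>1 that by (intro smooth_net_rescale[OF assms(1)]) (auto simp: mollifier_real)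
      moreover have "p \<in> orthant" using that(2) assms(2) by blast
      ultimately show ?thesis
        using True by (simp only: partials_fst[OF _ assms(3)]) simp
    qed
    then have bd: "norm (partials orthant ds (\<lambda>p. u (tensor_base (rescale \<epsilon> \<phi>)) (fst p)) p) \<le> 1 * \<epsilon> powr e q 1"
      if "0 < \<epsilon> \<and> \<epsilon> < 1" "p \<in> K" for \<epsilon> p
      using that by simp
    show ?thesis
      unfolding estimate_def
      by (rule exI[of _ 1], rule conjI[OF zero_less_one], rule exI[of _ 1])
        (use bd in simp)
  qed
  then show ?thesis unfolding net_bound_def using order_refl by blast
qed

lemma colombeau_rel_fst:
  fixes u v :: "real net"
  assumes "colombeau_rel u v"
  shows "colombeau_rel (\<lambda>\<phi> p::real \<times> real. u (tensor_base \<phi>) (fst p)) (\<lambda>\<phi> p. v (tensor_base \<phi>) (fst p))"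
proof -
  have K: "compact (fst ` K)" "fst ` K \<subseteq> orthant"
    if "compact K" "K \<subseteq> orthant" for K :: "(real \<times> real) set"
    using that fst_orthant by (auto intro!: compact_continuous_image continuous_on_fst continuous_on_id)
  have smooth: "smooth_net (\<lambda>\<phi> p::real \<times> real. w (tensor_base \<phi>) (fst p))" if "smooth_net w" for w
    unfolding smooth_net_def
  proof
    fix \<phi> :: "real \<times> real \<Rightarrow> complex"
    assume "\<phi> \<in> mollifier 1"
    then obtain \<rho> where \<rho>: "\<rho> \<in> mollifier1 1" "\<phi> = tensor_power \<rho>"
      by (auto simp: mollifier_def)
    then have "smooth_on orthant (w \<rho>)"
      using that unfolding smooth_net_def mollifier_real by blast
    then show "smooth_on orthant (\<lambda>p::real \<times> real. w (tensor_base \<phi>) (fst p))"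
      unfolding \<rho>(2) tensor_base_tensor_power[OF \<rho>(1)] by (rule smooth_on_fst)
  qed
  have mod: "moderate (\<lambda>\<phi> p::real \<times> real. w (tensor_base \<phi>) (fst p))" if "moderate w" for w
  proof -
    have w: "smooth_net w" and b: "\<And>K ds. compact K \<Longrightarrow> K \<subseteq> orthant \<Longrightarrow> set ds \<subseteq> Basis \<Longrightarrow>
        net_bound mod_exponent w K ds"
      using that unfolding moderate_iff by simp_all
    show ?thesis
      unfolding moderate_iff using smooth[OF w] net_bound_fst'[OF w _ _ b[OF K]] by simp
  qed
  have "null_net (\<lambda>\<phi> p::real \<times> real. w (tensor_base \<phi>) (fst p))" if "null_net w" for w
  proof -
    have w: "smooth_net w" and b: "\<And>K ds. compact K \<Longrightarrow> K \<subseteq> orthant \<Longrightarrow> set ds \<subseteq> Basis \<Longrightarrow>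
        net_bound null_exponent w K ds"
      using that unfolding null_net_iff by simp_all
    show ?thesis
      unfolding null_net_iff using smooth[OF w] net_bound_fst'[OF w _ _ b[OF K]] by simp
  qed
  note null = this
  have "null_net (\<lambda>\<phi> p::real \<times> real. u (tensor_base \<phi>) (fst p) - v (tensor_base \<phi>) (fst p))"
    by (rule null[where w = "\<lambda>\<phi> x. u \<phi> x - v \<phi> x"]) (use assms in \<open>simp add: colombeau_rel_def\<close>)
  then show ?thesis
    using assms mod by (simp add: colombeau_rel_def)
qed

text \<open>A generalized function of \<open>x\<close> viewed as one of \<open>(x, t)\<close>.\<close>

lift_definition of_space :: "real colombeau \<Rightarrow> (real \<times> real) colombeau"
  is "\<lambda>u \<phi> p. u (tensor_base \<phi>) (fst p)"
  by (rule colombeau_rel_fst)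


section \<open>Growth conditions and association\<close>

definition represents :: "'a::euclidean_space net \<Rightarrow> 'a colombeau \<Rightarrow> bool" where
  "represents u U \<longleftrightarrow> moderate u \<and> abs_colombeau u = U"

definition globally_bounded :: "'a::euclidean_space colombeau \<Rightarrow> bool" where
  "globally_bounded U \<longleftrightarrow>
     (\<exists>u. represents u U \<and>
       (\<exists>N. \<forall>\<phi>\<in>mollifier N. \<exists>c>0. \<exists>\<eta>>0. \<forall>\<epsilon>. 0 < \<epsilon> \<and> \<epsilon> < \<eta> \<longrightarrow>
          (\<forall>y\<in>orthant. norm (u (rescale \<epsilon> \<phi>) y) \<le> c)))"

definition locally_log_growth :: "'a::euclidean_space colombeau \<Rightarrow> bool" where
  "locally_log_growth U \<longleftrightarrow>
     (\<exists>u. represents u U \<and>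
       (\<forall>K. compact K \<and> K \<subseteq> orthant \<longrightarrow>
         (\<exists>N. \<forall>\<phi>\<in>mollifier N. \<exists>c>0. \<exists>\<eta>>0. \<forall>\<epsilon>. 0 < \<epsilon> \<and> \<epsilon> < \<eta> \<longrightarrow>
            (\<forall>y\<in>K. norm (u (rescale \<epsilon> \<phi>) y) \<le> real N * ln (c / \<epsilon>)))))"

definition vanishes_near_0 :: "real colombeau \<Rightarrow> bool" where
  "vanishes_near_0 U \<longleftrightarrow>
     (\<exists>u. represents u U \<and>
       (\<forall>\<phi>\<in>mollifier 1. \<exists>\<delta>>0. \<forall>\<epsilon>\<in>{0<..<1}. \<forall>x\<in>{0..<\<delta>}. u (rescale \<epsilon> \<phi>) x = 0))"

text \<open>
  Integrals are taken with respect to \<^const>\<open>lebesgue\<close> (the completion of \<^const>\<open>lborel\<close>), since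
  an almost everywhere continuous function need not be Borel measurable.
\<close>

definition locally_integrable :: "('a::euclidean_space \<Rightarrow> real) \<Rightarrow> bool" where
  "locally_integrable w \<longleftrightarrow> (\<forall>K. compact K \<and> K \<subseteq> orthant \<longrightarrow> set_integrable lebesgue K w)"

definition associated :: "'a::euclidean_space colombeau \<Rightarrow> ('a \<Rightarrow> real) \<Rightarrow> bool" where
  "associated U w \<longleftrightarrow> locally_integrable w \<and>
     (\<exists>u. represents u U \<and>
       (\<forall>\<psi>\<in>test_functions orthant. \<exists>N. \<forall>\<phi>\<in>mollifier N.
          ((\<lambda>\<epsilon>. LINT y:orthant|lebesgue. u (rescale \<epsilon> \<phi>) y * \<psi> y) \<longlongrightarrow>
             (LINT y:orthant|lebesgue. complex_of_real (w y) * \<psi> y)) (at_right 0)))"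


section \<open>The initial-boundary value problem\<close>

text \<open>
  The transport equations are equalities in the algebra on the closed quadrant, i.e. the estimates
  for the null representatives hold on compact sets touching the axes. Equality on compact subsets
  of the open quadrant alone would admit boundary layers, and uniqueness would fail.
\<close>

definition solves_problem ::
  "real colombeau \<Rightarrow> real colombeau \<Rightarrow> real colombeau \<Rightarrow>
   (real \<times> real) colombeau \<Rightarrow> (real \<times> real) colombeau \<Rightarrow> bool" where
  "solves_problem C U0 V0 U V \<longleftrightarrow>
     deriv_t U + of_space C * deriv_x U = 0 \<and>
     deriv_t V - of_space C * deriv_x V = 0 \<and>
     restrict_t0 U = U0 \<and>
     restrict_t0 V = V0 \<and>
     restrict_x0 U = restrict_x0 V"

definition travel_time :: "(real \<Rightarrow> real) \<Rightarrow> real \<Rightarrow> real" where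
  "travel_time c x = integral {0..x} (\<lambda>s. 1 / c s)"

text \<open>
  The point at time \<open>\<tau>\<close> of the connected characteristic through \<open>(x, t)\<close>, of speed \<open>c\<close> and
  \<open>-c\<close> respectively.
\<close>

definition characteristic1 :: "(real \<Rightarrow> real) \<Rightarrow> real \<Rightarrow> real \<Rightarrow> real \<Rightarrow> real" where
  "characteristic1 c x t \<tau> = inv_into {0..} (travel_time c) (travel_time c x - (t - \<tau>))"

definition characteristic2 :: "(real \<Rightarrow> real) \<Rightarrow> real \<Rightarrow> real \<Rightarrow> real \<Rightarrow> real" where
  "characteristic2 c x t \<tau> = inv_into {0..} (travel_time c) (travel_time c x + (t - \<tau>))"

definition classical_v :: "(real \<Rightarrow> real) \<Rightarrow> (real \<Rightarrow> real) \<Rightarrow> real \<times> real \<Rightarrow> real" where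
  "classical_v c v0 = (\<lambda>(x, t). v0 (characteristic2 c x t 0))"

text \<open>On the null set \<open>t = travel_time c x\<close> the first branch is used.\<close>

definition classical_u ::
  "(real \<Rightarrow> real) \<Rightarrow> (real \<Rightarrow> real) \<Rightarrow> (real \<Rightarrow> real) \<Rightarrow> real \<times> real \<Rightarrow> real" where
  "classical_u c u0 v0 = (\<lambda>(x, t).
     if t \<le> travel_time c x then u0 (characteristic1 c x t 0)
     else classical_v c v0 (0, t - travel_time c x))"

end

theory Submission
  imports Defs
begin

text \<open>
  The transition layer of the regularised speed is chosen so that the travel time \<open>Y\<close> is explicit:
  \<open>Y' = 1 / C\<close> is a logistic step and \<open>Y\<close> a combination of softplus functions. The solutions are
  then \<open>U = F (Y x - t)\<close> and \<open>V = F (- Y x - t)\<close> for one smooth profile \<open>F\<close> on the line, and no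
  inverse function is needed. The profile is the mollification of the classical data written as a
  function of the signed travel time; since these data vanish near \<open>0\<close>, so does \<open>F\<close>. As
  \<open>Y\<close> converges to the classical travel time and \<open>F\<close> converges at continuity points,
  association follows from dominated convergence.

  For uniqueness, a solution modulo null nets is integrated along the characteristics, parametrised
  by \<open>x\<close>, which gives the null estimate of order \<open>0\<close>. The system is invariant under
  \<open>\<partial>\<^sub>t\<close>, and the equation expresses \<open>\<partial>\<^sub>x\<close> by \<open>\<partial>\<^sub>t\<close>, so the
  estimates of all orders follow by induction.
\<close>

text \<open>A net sees only \<open>rescale \<epsilon> \<phi>\<close> and never \<epsilon> itself, so
  every scale has to be read off the mollifier. \<open>support_radius\<close> does this: it is
  multiplied by \<epsilon> under rescaling. It fixes both the logarithmic steepness of the speed and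
  the cut-off that keeps the mollified data zero near 0.

  It is the slowness 1 / C, not C, that is interpolated, because the slowness is what has to be
  integrated. A single profile serves both waves because Y 0 = 0: at x = 0 both are F (- t), so the
  boundary condition holds exactly for every mollifier and no compatibility condition is left at the
  corner. The transport equations hold exactly as well; nontrivial null nets enter only in the
  uniqueness proof.

  The obstacle is that smoothness and moderateness concern derivatives of all orders, up to the
  boundary. Formulas of all orders are avoided by placing each net in an indexed family whose
  members differentiate to a moderate coefficient times another member; bounds of order 0 for the
  members are then enough.\<close>

section \<open>Smoothness and moderateness of families closed under differentiation\<close>

text \<open>In an induction on the order of differentiation the second factor is controlled only up
  to order \<open>n\<close>. The Leibniz rule for \<open>ds\<close> differentiates it at most
  \<open>length ds\<close> times, so this suffices. The two conditions on \<open>e\<close> admit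
  both the moderate and the null exponent.\<close>

lemma net_bound_mult_upto:
  fixes u v :: "'a::euclidean_space net"
  assumes "smooth_net u" "smooth_net v" "K \<subseteq> orthant" "set ds \<subseteq> Basis" "length ds \<le> n"
    and "\<And>ds. set ds \<subseteq> Basis \<Longrightarrow> net_bound mod_exponent u K ds"
    and "\<And>ds. set ds \<subseteq> Basis \<Longrightarrow> length ds \<le> n \<Longrightarrow> net_bound e v K ds"
    and e: "\<And>q N M. N \<le> M \<Longrightarrow> e q M \<le> e q N" "\<And>q N M. e q (N + M) = - real N + e q M"
  shows "net_bound e (\<lambda>\<phi> x. u \<phi> x * v \<phi> x) K ds"
  using assms(1,2,4-7)
proof (induction ds arbitrary: u v n)
  case Nil
  obtain N M where NM: "N \<ge> 1" "M \<ge> 1"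
    "\<And>q \<phi>. q \<ge> N \<Longrightarrow> \<phi> \<in> mollifier q \<Longrightarrow> estimate u \<phi> K [] (- real N)"
    "\<And>q \<phi>. q \<ge> M \<Longrightarrow> \<phi> \<in> mollifier q \<Longrightarrow> estimate v \<phi> K [] (e q M)"
    using Nil.prems(5)[of "[]"] Nil.prems(6)[of "[]"] unfolding net_bound_def by auto
  have "estimate (\<lambda>\<phi> x. u \<phi> x * v \<phi> x) \<phi> K [] (e q (N + M))"
    if "q \<ge> N + M" "\<phi> \<in> mollifier q" for q \<phi>
    unfolding e(2) by (intro estimate_mult_Nil NM(3)[of q] NM(4)[of q]) (use that in auto)
  then show ?case
    unfolding net_bound_def using NM(1) by (intro exI[of _ "N + M"]) auto
next
  case (Cons b ds)
  then have b: "b \<in> Basis" "set ds \<subseteq> Basis" by auto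
  obtain m where m: "n = Suc m" "length ds \<le> m" using Cons.prems(4) by (cases n) auto
  let ?du = "\<lambda>\<phi>. partial orthant b (u \<phi>)" and ?dv = "\<lambda>\<phi>. partial orthant b (v \<phi>)"
  have 1: "net_bound e (\<lambda>\<phi> x. u \<phi> x * ?dv \<phi> x) K ds"
    using Cons.prems b m by (intro Cons.IH[of _ _ m] smooth_net_partial) (auto simp: net_bound_partial)
  have 2: "net_bound e (\<lambda>\<phi> x. ?du \<phi> x * v \<phi> x) K ds"
    using Cons.prems b m by (intro Cons.IH[of _ _ m] smooth_net_partial) (auto simp: net_bound_partial)
  have "net_bound e (\<lambda>\<phi> x. u \<phi> x * ?dv \<phi> x + 1 * (?du \<phi> x * v \<phi> x)) K ds"
    using 1 2 Cons.prems b assms(3)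
    by (intro net_bound_lincomb smooth_net_mult smooth_net_partial e(1)) auto
  also have "net_bound e (\<lambda>\<phi> x. u \<phi> x * ?dv \<phi> x + 1 * (?du \<phi> x * v \<phi> x)) K ds \<longleftrightarrow>
      net_bound e (\<lambda>\<phi>. partial orthant b (\<lambda>x. u \<phi> x * v \<phi> x)) K ds"
    using Cons.prems b assms(3)
    by (intro net_bound_cong) (auto simp: partial_mult smooth_net_def)
  finally show ?case by (simp add: net_bound_partial)
qed

text \<open>Members of the family alone are not an invariant, because the product rule also hits the
  coefficients. Finite sums of smooth multiples of members are mapped to such sums by every partial
  derivative, so they are the invariant for \<open>smooth_on_orthantI\<close>.\<close>

lemma smooth_on_chain:
  fixes f :: "'i \<Rightarrow> 'a::euclidean_space \<Rightarrow> complex"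
  assumes cont: "\<And>i. continuous_on orthant (f i)"
    and deriv: "\<And>i b x. b \<in> Basis \<Longrightarrow> x \<in> orthant \<Longrightarrow>
      ((\<lambda>s. f i (x + s *\<^sub>R b)) has_vector_derivative d i b x * f (j i) x) (at 0 within axis_line orthant b x)"
    and d: "\<And>i b. b \<in> Basis \<Longrightarrow> smooth_on orthant (d i b)"
  shows "smooth_on orthant (f i)"
proof -
  let ?s = "smooth_on (orthant :: 'a set)"
  let ?P = "\<lambda>h. \<exists>L. (\<forall>(g, i)\<in>set L. ?s g) \<and> h = (\<lambda>x. \<Sum>(g, i)\<leftarrow>L. g x * f i x)"
  have c: "continuous_on orthant (\<lambda>x. \<Sum>(g, i)\<leftarrow>L. g x * f i x)"
    if "\<forall>(g, i)\<in>set L. ?s g" for L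
    using that by (induction L) (auto intro!: continuous_on_add continuous_on_mult cont dest: smooth_on_continuous)
  have dv: "\<exists>M. (\<forall>(g, i)\<in>set M. ?s g) \<and> (\<forall>x\<in>orthant.
      ((\<lambda>s. \<Sum>(g, i)\<leftarrow>L. g (x + s *\<^sub>R b) * f i (x + s *\<^sub>R b)) has_vector_derivative
        (\<Sum>(g, i)\<leftarrow>M. g x * f i x)) (at 0 within axis_line orthant b x))"
    if "\<forall>(g, i)\<in>set L. ?s g" "b \<in> Basis" for L b
    using that(1)
  proof (induction L)
    case Nil
    show ?case by (rule exI[of _ "[]"]) auto
  next
    case (Cons p L)
    obtain g i where p: "p = (g, i)" by (cases p)
    obtain M where M: "\<forall>(g, i)\<in>set M. ?s g" "\<forall>x\<in>orthant.
      ((\<lambda>s. \<Sum>(g, i)\<leftarrow>L. g (x + s *\<^sub>R b) * f i (x + s *\<^sub>R b)) has_vector_derivative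
        (\<Sum>(g, i)\<leftarrow>M. g x * f i x)) (at 0 within axis_line orthant b x)"
      using Cons by auto
    have g: "?s g" using Cons.prems p by auto
    have "((\<lambda>s. g (x + s *\<^sub>R b) * f i (x + s *\<^sub>R b)) has_vector_derivative
        (g x * d i b x) * f (j i) x + partial orthant b g x * f i x) (at 0 within axis_line orthant b x)"
      if "x \<in> orthant" for x
      using has_vector_derivative_mult[OF smooth_on_has_vd[OF g \<open>b \<in> Basis\<close> that]
          deriv[OF \<open>b \<in> Basis\<close> that]] by (simp add: mult.assoc)
    then show ?case
      using M g p \<open>b \<in> Basis\<close> d
      by (intro exI[of _ "(\<lambda>x. g x * d i b x, j i) # (partial orthant b g, i) # M"])
        (auto simp: add.assoc[symmetric] intro!: smooth_on_partial smooth_on_mult has_vector_derivative_add)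
  qed
  show ?thesis
  proof (rule smooth_on_orthantI[where P = ?P])
    show "?P (f i)"
      by (intro exI[of _ "[(\<lambda>x. 1, i)]"]) (auto simp: smooth_on_const)
    show "continuous_on orthant h" if "?P h" for h
      using that c by blast
    show "\<exists>h'. ?P h' \<and> (\<forall>x\<in>orthant. ((\<lambda>s. h (x + s *\<^sub>R b)) has_vector_derivative h' x)
            (at 0 within axis_line orthant b x))" if hb: "?P h" "b \<in> Basis" for h b
    proof -
      obtain L where L: "\<forall>(g, i)\<in>set L. ?s g" "h = (\<lambda>x. \<Sum>(g, i)\<leftarrow>L. g x * f i x)"
        using hb(1) by blast
      show ?thesis
        using dv[OF L(1) hb(2)] unfolding L(2) by blast
    qed
  qed
qed

text \<open>Differentiating a member exchanges one order for a moderate coefficient and another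
  member. Induction on the order, for all indices at once because \<open>j\<close> changes the
  member, leaves only bounds of order 0 to verify.\<close>

lemma moderate_chain:
  fixes w :: "'i \<Rightarrow> 'a::euclidean_space net"
  assumes cont: "\<And>i \<phi>. \<phi> \<in> mollifier 1 \<Longrightarrow> continuous_on orthant (w i \<phi>)"
    and deriv: "\<And>i b \<phi> x. b \<in> Basis \<Longrightarrow> \<phi> \<in> mollifier 1 \<Longrightarrow> x \<in> orthant \<Longrightarrow>
      ((\<lambda>s. w i \<phi> (x + s *\<^sub>R b)) has_vector_derivative d i b \<phi> x * w (j i) \<phi> x)
        (at 0 within axis_line orthant b x)"
    and d: "\<And>i b. b \<in> Basis \<Longrightarrow> moderate (d i b)"
    and bound: "\<And>i K. compact K \<Longrightarrow> K \<subseteq> orthant \<Longrightarrow> net_bound mod_exponent (w i) K []"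
  shows "moderate (w i)"
proof -
  have sd: "smooth_net (d i b)" if "b \<in> Basis" for i b
    using d[OF that] by (simp add: moderate_def)
  have s: "smooth_net (w i)" for i
    unfolding smooth_net_def
  proof
    fix \<phi> :: "'a \<Rightarrow> complex" assume "\<phi> \<in> mollifier 1"
    then show "smooth_on orthant (w i \<phi>)"
      using sd by (intro smooth_on_chain[where d = "\<lambda>i b. d i b \<phi>" and f = "\<lambda>i. w i \<phi>" and j = j] cont deriv)
        (auto simp: smooth_net_def)
  qed
  have "net_bound mod_exponent (w i) K ds"
    if K: "compact K" "K \<subseteq> orthant" and "set ds \<subseteq> Basis" "length ds \<le> n" for n K ds i
    using that(3,4)
  proof (induction n arbitrary: ds i)
    case 0
    then show ?case using bound[OF K] by simp
  next
    case (Suc n)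
    show ?case
    proof (cases ds)
      case Nil
      then show ?thesis using bound[OF K] by simp
    next
      case (Cons b ds')
      then have b: "b \<in> Basis" "set ds' \<subseteq> Basis" "length ds' \<le> n" using Suc.prems by auto
      have "net_bound mod_exponent (\<lambda>\<phi> x. d i b \<phi> x * w (j i) \<phi> x) K ds'"
        using d[OF b(1)] K b Suc.IH
        by (intro net_bound_mult_upto[where n = n] sd s) (auto simp: moderate_iff)
      also have "net_bound mod_exponent (\<lambda>\<phi> x. d i b \<phi> x * w (j i) \<phi> x) K ds' \<longleftrightarrow>
          net_bound mod_exponent (\<lambda>\<phi>. partial orthant b (w i \<phi>)) K ds'"
        using K b by (intro net_bound_cong sym[OF partial_orthantI] deriv) auto
      finally show ?thesis by (simp add: Cons net_bound_partial)
    qed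
  qed
  then show ?thesis unfolding moderate_iff using s by blast
qed

lemma net_bound_Nil_I:
  assumes "\<And>\<phi>. \<phi> \<in> mollifier 1 \<Longrightarrow> \<exists>B>0. \<exists>\<eta>>0. \<forall>\<epsilon>. 0 < \<epsilon> \<and> \<epsilon> < \<eta> \<longrightarrow>
    (\<forall>x\<in>K. norm (u (rescale \<epsilon> \<phi>) x) \<le> B * \<epsilon> powr - real N)"
  shows "net_bound mod_exponent u K []"
  unfolding net_bound_def
\<comment> \<open>\<open>net_bound\<close> asks for an index of at least 1, which places
  \<open>mollifier q\<close> inside \<open>mollifier 1\<close>; the possibly weaker exponent costs
  nothing for small \<epsilon>.\<close>
proof (intro exI[of _ "max 1 N"] conjI allI impI ballI)
  fix q :: nat and \<phi> :: "'a \<Rightarrow> complex" assume "max 1 N \<le> q" "\<phi> \<in> mollifier q"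
  then have "\<phi> \<in> mollifier 1" by (intro mollifier_mono[of 1 q]) auto
  then have "estimate u \<phi> K [] (- real N)"
    using assms by (simp add: estimate_def)
  then show "estimate u \<phi> K [] (- real (max 1 N))"
    by (rule estimate_weaken) simp
qed simp

lemma moderate_const_net:
  assumes "\<And>\<phi>. \<phi> \<in> mollifier 1 \<Longrightarrow> \<exists>B>0. \<exists>\<eta>>0. \<forall>\<epsilon>. 0 < \<epsilon> \<and> \<epsilon> < \<eta> \<longrightarrow>
    norm (k (rescale \<epsilon> \<phi>)) \<le> B * \<epsilon> powr - real N"
  shows "moderate (\<lambda>\<phi> x::'a::euclidean_space. k \<phi>)"
proof -
  \<comment> \<open>A family with a single member, with vanishing coefficients.\<close>
  have "moderate ((\<lambda>_::unit. \<lambda>\<phi> x::'a. k \<phi>) ())"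
  proof (rule moderate_chain[where d = "\<lambda>i b \<phi> x. 0" and j = id])
    show "net_bound mod_exponent (\<lambda>\<phi> x. k \<phi>) K []" for K :: "'a set"
      using assms by (intro net_bound_Nil_I[of _ _ N]) meson
  qed (auto simp: moderate_zero has_vector_derivative_const)
  then show ?thesis by simp
qed

lemma moderate_const: "moderate (\<lambda>\<phi> x::'a::euclidean_space. c)"
proof (rule moderate_const_net[where N = 0])
  show "\<exists>B>0. \<exists>\<eta>>0. \<forall>\<epsilon>. 0 < \<epsilon> \<and> \<epsilon> < \<eta> \<longrightarrow> norm c \<le> B * \<epsilon> powr - real 0"
    by (rule exI[of _ "1 + norm c"]) (auto intro: exI[of _ 1] simp: add_pos_nonneg)
qed

lemma moderate_of_space:
  fixes u :: "real net"
  assumes "moderate u"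
  shows "moderate (\<lambda>\<phi> p::real \<times> real. u (tensor_base \<phi>) (fst p))"
  using colombeau_rel_fst[OF colombeau_rel_refl[OF assms]] by (simp add: colombeau_rel_def)

lemma moderate_restrict_t0:
  fixes u :: "(real \<times> real) net"
  assumes "moderate u"
  shows "moderate (\<lambda>\<rho> x::real. u (tensor_power \<rho>) (x, 0))"
  using colombeau_rel_embed[OF _ _ _ colombeau_rel_refl[OF assms], of "\<lambda>x. (x, 0)"]
  by (simp add: colombeau_rel_def linear_iff orthant_prod orthant_real Basis_prod_def)

text \<open>A formula differentiable on the whole space needs no separate treatment of the boundary:
  its derivative along a line may be restricted to any set \<open>A\<close>.\<close>

lemma has_vd_axis:
  fixes f :: "'a::euclidean_space \<Rightarrow> complex"
  assumes "(f has_derivative f') (at x)" "f' b = d"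
  shows "((\<lambda>s. f (x + s *\<^sub>R b)) has_vector_derivative d) (at 0 within A)"
proof -
  have "((\<lambda>s. x + s *\<^sub>R b) has_derivative (\<lambda>s. s *\<^sub>R b)) (at 0)"
    by (auto intro!: derivative_eq_intros)
  then have "(f \<circ> (\<lambda>s. x + s *\<^sub>R b) has_derivative f' \<circ> (\<lambda>s. s *\<^sub>R b)) (at 0)"
    by (intro diff_chain_at) (use assms in auto)
  moreover have "f' \<circ> (\<lambda>s. s *\<^sub>R b) = (\<lambda>s. s *\<^sub>R d)"
    using has_derivative_linear[OF assms(1)] assms(2) by (auto simp: linear_scale)
  ultimately show ?thesis
    by (auto simp: has_vector_derivative_def o_def intro: has_derivative_at_withinI)
qed

section \<open>Mollification\<close>

definition support_radius :: "(real \<Rightarrow> complex) \<Rightarrow> real" where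
  "support_radius \<rho> = Sup {\<bar>x\<bar> | x. \<rho> x \<noteq> 0}"

lemma test_function_bounded_support:
  assumes "\<rho> \<in> test_functions (UNIV :: real set)"
  obtains R where "0 < R" "\<And>x. R < \<bar>x\<bar> \<Longrightarrow> \<rho> x = 0"
proof -
  obtain K where K: "compact K" "\<And>x. x \<notin> K \<Longrightarrow> \<rho> x = 0"
    using assms by (auto simp: test_functions_def)
  obtain R where "0 < R" "\<And>x. x \<in> K \<Longrightarrow> norm x \<le> R"
    using compact_imp_bounded[OF K(1)] by (auto simp: bounded_pos)
  then show ?thesis using K(2) by (intro that[of R]) force+
qed

lemma bdd_above_support:
  assumes "\<rho> \<in> test_functions (UNIV :: real set)"
  shows "bdd_above {\<bar>x\<bar> | x. \<rho> x \<noteq> 0}"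
proof -
  obtain R where "0 < R" "\<And>x. R < \<bar>x\<bar> \<Longrightarrow> \<rho> x = 0"
    using assms by (rule test_function_bounded_support) blast
  then show ?thesis by (intro bdd_aboveI[of _ R]) force
qed

lemma le_support_radius:
  assumes "\<rho> \<in> test_functions UNIV" "\<rho> x \<noteq> 0"
  shows "\<bar>x\<bar> \<le> support_radius \<rho>"
  unfolding support_radius_def using assms(2) by (intro cSup_upper bdd_above_support assms(1)) auto

text \<open>A function vanishing off the point 0 has integral 0, so integral 1 forces a nonzero
  value elsewhere.\<close>

lemma support_radius_pos:
  assumes "\<rho> \<in> mollifier1 q"
  shows "0 < support_radius \<rho>"
proof -
  have "\<exists>x. x \<noteq> 0 \<and> \<rho> x \<noteq> 0"
  proof (rule ccontr)
    assume "\<not> ?thesis"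
    then have z: "\<And>x. x \<noteq> 0 \<Longrightarrow> \<rho> x = 0" by blast
    have "AE x in lborel. \<rho> x = 0"
      using AE_lborel_singleton[of "0::real"] by eventually_elim (rule z)
    then have "(LINT x|lborel. \<rho> x) = 0" by (rule integral_eq_zero_AE)
    then show False using assms by (simp add: mollifier1_def)
  qed
  then obtain x where "x \<noteq> 0" "\<rho> x \<noteq> 0" by blast
  then show ?thesis using le_support_radius[of \<rho> x] assms by (simp add: mollifier1_def)
qed

text \<open>One inequality is proved for all mollifiers and scales and used twice, for \<epsilon>
  and for 1 / \<epsilon>, which undoes the rescaling.\<close>

lemma support_radius_rescale:
  assumes "\<rho> \<in> mollifier1 q" "0 < \<epsilon>"
  shows "support_radius (rescale \<epsilon> \<rho>) = \<epsilon> * support_radius \<rho>"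
proof -
  have le: "support_radius (rescale \<epsilon> \<rho>) \<le> \<epsilon> * support_radius \<rho>"
    if \<rho>: "\<rho> \<in> mollifier1 q" and "0 < \<epsilon>" for \<rho> \<epsilon>
    unfolding support_radius_def[of "rescale \<epsilon> \<rho>"]
  proof (rule cSup_least)
    have "(LINT x|lborel. rescale \<epsilon> \<rho> x) = 1"
      using mollifier1_rescale[OF that] by (simp add: mollifier1_def)
    moreover have "(LINT x|lborel. rescale \<epsilon> \<rho> x) = 0" if "rescale \<epsilon> \<rho> = (\<lambda>x. 0)"
      unfolding that by simp
    ultimately have "rescale \<epsilon> \<rho> \<noteq> (\<lambda>x. 0)" by auto
    then have "\<exists>x. rescale \<epsilon> \<rho> x \<noteq> 0" by (simp add: fun_eq_iff)
    then show "{\<bar>x\<bar> | x. rescale \<epsilon> \<rho> x \<noteq> 0} \<noteq> {}" by auto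
    fix y assume "y \<in> {\<bar>x\<bar> | x. rescale \<epsilon> \<rho> x \<noteq> 0}"
    then obtain x where x: "y = \<bar>x\<bar>" "rescale \<epsilon> \<rho> x \<noteq> 0" by blast
    then have "\<bar>x /\<^sub>R \<epsilon>\<bar> \<le> support_radius \<rho>"
      using \<rho> by (intro le_support_radius) (auto simp: rescale_def mollifier1_def)
    then show "y \<le> \<epsilon> * support_radius \<rho>"
      using x(1) \<open>0 < \<epsilon>\<close> by (simp add: abs_mult field_simps)
  qed
  have "rescale (1 / \<epsilon>) (rescale \<epsilon> \<rho>) = \<rho>"
    using assms(2) by (intro ext) (simp add: rescale_def flip: mult.assoc)
  then have "support_radius \<rho> \<le> 1 / \<epsilon> * support_radius (rescale \<epsilon> \<rho>)"
    using le[OF mollifier1_rescale[OF assms], of "1 / \<epsilon>"] assms(2) by simp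
  then show ?thesis
    using le[OF assms] assms(2) by (simp add: field_simps)
qed

lemma rescale_rescale:
  fixes \<rho> :: "real \<Rightarrow> complex"
  shows "rescale s (rescale \<epsilon> \<rho>) = rescale (s * \<epsilon>) \<rho>"
  by (auto simp: rescale_def mult_ac)

lemma test_functions_partial:
  assumes "g \<in> test_functions (UNIV :: real set)"
  shows "partial UNIV 1 g \<in> test_functions UNIV"
proof -
  obtain K where K: "compact K" "\<And>x. x \<notin> K \<Longrightarrow> g x = 0"
    using assms by (auto simp: test_functions_def)
  have "partial UNIV 1 g x = 0" if "x \<notin> K" for x
  proof (rule partial_UNIV)
    have "((\<lambda>_. 0) has_vector_derivative 0) (at x)" by simp
    then show "(g has_vector_derivative 0) (at x)"
      by (rule has_vector_derivative_transform_within_open[where S = "- K"])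
        (use K that compact_imp_closed in auto)
  qed
  then show ?thesis
    using assms K(1) smooth_on_partial[of UNIV g 1]
    by (auto simp: test_functions_def)
qed

lemma test_functions_has_vd:
  "g \<in> test_functions (UNIV :: real set) \<Longrightarrow> (g has_vector_derivative partial UNIV 1 g x) (at x)"
  by (simp add: test_functions_def smooth_on_UNIV_has_vd)

lemma test_functions_continuous:
  "g \<in> test_functions S \<Longrightarrow> continuous_on S g"
  by (simp add: test_functions_def smooth_on_continuous)

lemma test_functions_bounded:
  assumes "g \<in> test_functions S"
  obtains B where "0 < B" "\<And>x. x \<in> S \<Longrightarrow> norm (g x) \<le> B"
proof -
  obtain K where K: "compact K" "K \<subseteq> S" "\<And>x. x \<in> S \<Longrightarrow> x \<notin> K \<Longrightarrow> g x = 0"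
    using assms by (auto simp: test_functions_def)
  have "compact (g ` K)"
    using K by (intro compact_continuous_image continuous_on_subset[OF test_functions_continuous[OF assms]])
  then obtain B where B: "0 < B" "\<forall>y\<in>g ` K. norm y \<le> B"
    using compact_imp_bounded bounded_pos by blast
  show ?thesis
  proof (rule that[OF B(1)])
    show "norm (g x) \<le> B" if "x \<in> S" for x
      using B K(3)[OF that] by (cases "x \<in> K") auto
  qed
qed

lemma test_functions_partial_funpow:
  "g \<in> test_functions (UNIV :: real set) \<Longrightarrow> (partial UNIV 1 ^^ k) g \<in> test_functions UNIV"
  by (induction k) (auto intro: test_functions_partial)

text \<open>Each derivative of the kernel costs a factor \<open>1 / s\<close>, whereas rescaling
  preserves the L1 norm; this is the source of the growth of order \<open>k\<close> in 1 /
  \<epsilon>.\<close>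

lemma partial_funpow_rescale:
  assumes "g \<in> test_functions (UNIV :: real set)" "0 < s"
  shows "(partial UNIV 1 ^^ k) (rescale s g) =
    (\<lambda>x. of_real ((1 / s) ^ k) * rescale s ((partial UNIV 1 ^^ k) g) x)"
proof (induction k)
  case (Suc k)
  let ?g = "(partial UNIV 1 ^^ k) g"
  have "partial UNIV 1 (\<lambda>x. of_real ((1 / s) ^ k) * rescale s ?g x) x =
      of_real ((1 / s) ^ Suc k) * rescale s (partial UNIV 1 ?g) x" for x
  proof (rule partial_UNIV)
    have "(?g \<circ> (\<lambda>x. x / s) has_vector_derivative (1 / s) *\<^sub>R partial UNIV 1 ?g (x / s)) (at x)"
      using assms by (intro vector_diff_chain_at test_functions_has_vd test_functions_partial_funpow)
        (auto intro!: derivative_eq_intros)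
    from has_vector_derivative_mult_right[OF this, of "of_real ((1 / s) ^ k) / of_real s"]
    show "((\<lambda>x. of_real ((1 / s) ^ k) * rescale s ?g x) has_vector_derivative
        of_real ((1 / s) ^ Suc k) * rescale s (partial UNIV 1 ?g) x) (at x)"
      using assms(2) by (simp add: rescale_def o_def divide_inverse scaleR_conv_of_real mult_ac)
  qed
  then show ?case using Suc by auto
qed (use assms in simp)

lemma integrable_test_function:
  assumes "g \<in> test_functions (UNIV :: real set)"
  shows "integrable lborel g"
proof -
  obtain K where K: "compact K" "\<And>x. x \<notin> K \<Longrightarrow> g x = 0"
    using assms by (auto simp: test_functions_def)
  have "integrable lborel (\<lambda>x. indicator K x *\<^sub>R g x)"
    using K(1) test_functions_continuous[OF assms]
    by (intro borel_integrable_compact) (auto intro: continuous_on_subset)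
  also have "(\<lambda>x. indicator K x *\<^sub>R g x) = g"
    using K(2) by (auto simp: indicator_def)
  finally show ?thesis .
qed

text \<open>Mollifiers are normalised with respect to \<open>lborel\<close>, but the data are only
  Lebesgue measurable, so convolutions are integrals over \<open>lebesgue\<close>. This is the
  bridge between the two.\<close>

lemma lebesgue_integral_reflect:
  fixes g :: "real \<Rightarrow> 'b::{banach, second_countable_topology}"
  assumes "integrable lborel g"
  shows "integrable lebesgue (\<lambda>w. g (z - w))" "(LINT w|lebesgue. g (z - w)) = (LINT w|lborel. g w)"
proof -
  have i: "integrable lborel (\<lambda>w. g (z + (-1) * w))"
    by (rule lborel_integrable_real_affine[OF assms]) simp
  moreover have "(\<lambda>w. g (z + (-1) * w)) = (\<lambda>w. g (z - w))" by simp
  ultimately have i: "integrable lborel (\<lambda>w. g (z - w))" by simp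
  then have m: "(\<lambda>w. g (z - w)) \<in> borel_measurable lborel" by auto
  show "integrable lebesgue (\<lambda>w. g (z - w))"
    using i m by (simp add: integrable_completion)
  have "(LINT w|lborel. g w) = (LINT w|lborel. g (z - w))"
    using lborel_integral_real_affine[of "-1" g z] by simp
  then show "(LINT w|lebesgue. g (z - w)) = (LINT w|lborel. g w)"
    using m by (simp add: integral_completion)
qed

lemma integral_norm_rescale:
  fixes g :: "real \<Rightarrow> complex"
  assumes "0 < s"
  shows "(LINT x|lborel. norm (rescale s g x)) = (LINT x|lborel. norm (g x))"
proof -
  have "(LINT x|lborel. norm (rescale s g x)) = s *\<^sub>R (LINT x|lborel. norm (rescale s g (0 + s * x)))"
    using lborel_integral_real_affine[of s "\<lambda>x. norm (rescale s g x)" 0] assms by simp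
  also have "\<dots> = (LINT x|lborel. norm (g x))"
    using assms by (simp add: rescale_def norm_divide flip: mult.assoc)
  finally show ?thesis .
qed

section \<open>Convolution of bounded measurable data with test functions\<close>

definition convolve :: "(real \<Rightarrow> real) \<Rightarrow> (real \<Rightarrow> complex) \<Rightarrow> real \<Rightarrow> complex" where
  "convolve f g z = (LINT w|lebesgue. of_real (f w) * g (z - w))"

lemma integrable_convolve:
  fixes g :: "real \<Rightarrow> complex"
  assumes "f \<in> borel_measurable lebesgue" "\<And>w. \<bar>f w\<bar> \<le> M" "integrable lborel g"
  shows "integrable lebesgue (\<lambda>w. of_real (f w) * g (z - w))"
proof (rule Bochner_Integration.integrable_bound)
  note i = lebesgue_integral_reflect(1)[OF assms(3), of z]
  show "integrable lebesgue (\<lambda>w. M * norm (g (z - w)))"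
    using i by (intro integrable_mult_right integrable_norm)
  show "(\<lambda>w. complex_of_real (f w) * g (z - w)) \<in> borel_measurable lebesgue"
    using i assms(1) by (intro borel_measurable_times) auto
  have "0 \<le> M" using assms(2)[of 0] by linarith
  then show "AE w in lebesgue. norm (of_real (f w) * g (z - w)) \<le> norm (M * norm (g (z - w)))"
    using assms(2) by (intro AE_I2) (auto simp: norm_mult intro!: mult_right_mono)
qed

lemma norm_convolve_le:
  assumes "f \<in> borel_measurable lebesgue" "\<And>w. \<bar>f w\<bar> \<le> M" "integrable lborel g"
  shows "norm (convolve f g z) \<le> M * (LINT w|lborel. norm (g w))"
proof -
  have n: "integrable lborel (\<lambda>w. norm (g w))" using assms(3) by (rule integrable_norm)
  have "norm (convolve f g z) \<le> (LINT w|lebesgue. norm (of_real (f w) * g (z - w)))"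
    unfolding convolve_def by (rule integral_norm_bound)
  also have "\<dots> \<le> (LINT w|lebesgue. M * norm (g (z - w)))"
    using integrable_norm[OF integrable_convolve[OF assms]] lebesgue_integral_reflect(1)[OF n] assms(2)
    by (intro integral_mono integrable_mult_right) (auto simp: norm_mult intro!: mult_right_mono)
  also have "\<dots> = M * (LINT w|lborel. norm (g w))"
    using lebesgue_integral_reflect(2)[OF n, of z] by simp
  finally show ?thesis .
qed

text \<open>As \<open>g\<close> has integral 1, the constant \<open>c\<close> is its own convolution
  with \<open>g\<close>, and the difference is the convolution of \<open>f - c\<close>. A mollifier
  need not be nonnegative, so its L1 norm remains in the bound.\<close>

lemma convolve_near_const:
  assumes "f \<in> borel_measurable lebesgue" "\<And>w. \<bar>f w\<bar> \<le> M" "integrable lborel g"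
    and "(LINT w|lborel. g w) = 1" "\<And>w. g w \<noteq> 0 \<Longrightarrow> \<bar>w\<bar> \<le> r"
    and "\<And>w. \<bar>z - w\<bar> \<le> r \<Longrightarrow> \<bar>f w - c\<bar> \<le> e"
  shows "norm (convolve f g z - of_real c) \<le> e * (LINT w|lborel. norm (g w))"
proof -
  have n: "integrable lborel (\<lambda>w. norm (g w))" using assms(3) by (rule integrable_norm)
  note i = integrable_convolve[OF assms(1-3)] and j = lebesgue_integral_reflect[OF assms(3)]
  have "convolve f g z - of_real c = (LINT w|lebesgue. of_real (f w) * g (z - w) - of_real c * g (z - w))"
    unfolding convolve_def using i j assms(4) by simp
  also have "norm \<dots> \<le> (LINT w|lebesgue. norm (of_real (f w) * g (z - w) - of_real c * g (z - w)))"
    by (rule integral_norm_bound)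
  also have "\<dots> \<le> (LINT w|lebesgue. e * norm (g (z - w)))"
  proof (intro integral_mono integrable_mult_right)
    show "integrable lebesgue (\<lambda>w. norm (of_real (f w) * g (z - w) - of_real c * g (z - w)))"
      using i j by (intro integrable_norm Bochner_Integration.integrable_diff integrable_mult_right)
    show "integrable lebesgue (\<lambda>w. norm (g (z - w)))" using lebesgue_integral_reflect(1)[OF n] .
    fix w
    have "norm (of_real (f w) * g (z - w) - of_real c * g (z - w)) = \<bar>f w - c\<bar> * norm (g (z - w))"
      unfolding left_diff_distrib[symmetric] norm_mult of_real_diff[symmetric] norm_of_real ..
    then show "norm (of_real (f w) * g (z - w) - of_real c * g (z - w)) \<le> e * norm (g (z - w))"
      using assms(5)[of "z - w"] assms(6)[of w] by (cases "g (z - w) = 0") (auto intro!: mult_right_mono)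
  qed
  also have "\<dots> = e * (LINT w|lborel. norm (g w))"
    using lebesgue_integral_reflect(2)[OF n, of z] by simp
  finally show ?thesis .
qed

text \<open>The bound is uniform in \<open>a\<close> and \<open>s\<close> because the second
  derivative is bounded everywhere. The mean value inequality is used twice: for the derivative of
  \<open>g\<close>, then for \<open>g\<close> minus its linear part.\<close>

lemma taylor_remainder_test_function:
  assumes "g \<in> test_functions (UNIV :: real set)"
  obtains B where "0 < B"
    "\<And>a s. norm (g (a + s) - g a - of_real s * partial UNIV 1 g a) \<le> B * s\<^sup>2"
proof -
  let ?g' = "partial UNIV 1 g" and ?g'' = "partial UNIV 1 (partial UNIV 1 g)"
  have g': "?g' \<in> test_functions UNIV" and g'': "?g'' \<in> test_functions UNIV"
    using assms by (simp_all add: test_functions_partial)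
  obtain B where B: "0 < B" "\<And>x. norm (?g'' x) \<le> B"
    using test_functions_bounded[OF g''] by auto
  have mv: "norm (h b - h a) \<le> C * \<bar>b - a\<bar>"
    if "\<And>x. x \<in> closed_segment a b \<Longrightarrow> (h has_vector_derivative h' x) (at x)"
      "\<And>x. x \<in> closed_segment a b \<Longrightarrow> norm (h' x) \<le> C"
    for h h' :: "real \<Rightarrow> complex" and a b C
  proof -
    have "norm (h b - h a) \<le> C * norm (b - a)"
    proof (rule differentiable_bound[where S = "closed_segment a b" and f' = "\<lambda>x s. s *\<^sub>R h' x"])
      show "(h has_derivative (\<lambda>s. s *\<^sub>R h' x)) (at x within closed_segment a b)"
        if "x \<in> closed_segment a b" for x
        using that(1) \<open>\<And>x. x \<in> closed_segment a b \<Longrightarrow> (h has_vector_derivative h' x) (at x)\<close>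
        by (auto simp: has_vector_derivative_def intro: has_derivative_at_withinI)
      show "onorm (\<lambda>s. s *\<^sub>R h' x) \<le> C" if "x \<in> closed_segment a b" for x
      proof (rule onorm_bound)
        note C = \<open>\<And>x. x \<in> closed_segment a b \<Longrightarrow> norm (h' x) \<le> C\<close>[OF that]
        then show "0 \<le> C" by (rule order_trans[OF norm_ge_zero])
        show "norm (s *\<^sub>R h' x) \<le> C * norm s" for s
          using mult_left_mono[OF C, of "\<bar>s\<bar>"] by (simp add: mult.commute)
      qed
    qed auto
    then show ?thesis by simp
  qed
  have "norm (g (a + s) - g a - of_real s * ?g' a) \<le> B * s\<^sup>2" for a s
  proof -
    have lip: "norm (?g' b - ?g' a) \<le> B * \<bar>b - a\<bar>" for b
      using g' B(2) by (intro mv[where h' = ?g''] test_functions_has_vd)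
    let ?h = "\<lambda>t. g t - of_real t * ?g' a"
    have "norm (?h (a + s) - ?h a) \<le> (B * \<bar>s\<bar>) * \<bar>(a + s) - a\<bar>"
    proof (rule mv[where h' = "\<lambda>t. ?g' t - ?g' a"])
      show "(?h has_vector_derivative ?g' t - ?g' a) (at t)" for t
        using test_functions_has_vd[OF assms, of t]
        by (auto intro!: derivative_eq_intros has_vector_derivative_real_field)
      fix t assume "t \<in> closed_segment a (a + s)"
      then have "\<bar>t - a\<bar> \<le> \<bar>s\<bar>" by (auto simp: closed_segment_eq_real_ivl split: if_splits)
      then show "norm (?g' t - ?g' a) \<le> B * \<bar>s\<bar>"
        using lip[of t] B(1) by (meson mult_left_mono order_trans less_imp_le)
    qed
    then show ?thesis by (simp add: algebra_simps power2_eq_square)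
  qed
  then show ?thesis using B(1) by (rule that[rotated])
qed

text \<open>\<open>f\<close> is only bounded and measurable, so the derivative has to fall on the
  kernel. The Taylor remainder of the kernel is uniformly of order \<open>s\<^sup>2\<close> and
  vanishes outside a fixed interval, so its integral against \<open>f\<close> is of order
  \<open>s\<^sup>2\<close> as well.\<close>

lemma convolve_has_vector_derivative:
  assumes f: "f \<in> borel_measurable lebesgue" "\<And>w. \<bar>f w\<bar> \<le> M"
    and g: "g \<in> test_functions (UNIV :: real set)"
  shows "(convolve f g has_vector_derivative convolve f (partial UNIV 1 g) z) (at z)"
proof -
  let ?g' = "partial UNIV 1 g"
  have g': "?g' \<in> test_functions UNIV" using g by (rule test_functions_partial)
  obtain B where B: "0 < B" "\<And>a s. norm (g (a + s) - g a - of_real s * ?g' a) \<le> B * s\<^sup>2"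
    using taylor_remainder_test_function[OF g] by blast
  obtain R where R: "0 < R" "\<And>x. R < \<bar>x\<bar> \<Longrightarrow> g x = 0"
    using test_function_bounded_support[OF g] by blast
  obtain R' where R': "0 < R'" "\<And>x. R' < \<bar>x\<bar> \<Longrightarrow> ?g' x = 0"
    using test_function_bounded_support[OF g'] by blast
  \<comment> \<open>The added 1 absorbs the shift by \<open>s\<close> with
    \<open>\<bar>s\<bar> \<le> 1\<close>: beyond distance \<open>Q\<close> from \<open>z\<close> all
    three kernel terms vanish.\<close>
  define Q where "Q = max R R' + 1"
  have M0: "0 \<le> M" using f(2)[of 0] by linarith
  note i = integrable_convolve[OF f integrable_test_function[OF g]]
  note i' = integrable_convolve[OF f integrable_test_function[OF g']]
  \<comment> \<open>\<open>2 * Q\<close> is the length of the interval; the summand 1 keeps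
    \<open>L\<close> positive when \<open>M = 0\<close>, since \<open>e / L\<close> serves as a
    radius below.\<close>
  define L where "L = M * B * (2 * Q) + 1"
  have Q: "0 < Q" using R(1) by (simp add: Q_def)
  have L: "0 < L" using M0 B(1) Q by (simp add: L_def add_nonneg_pos)
  have est: "norm (convolve f g (z + s) - convolve f g z - of_real s * convolve f ?g' z) \<le> L * s\<^sup>2"
    if s: "\<bar>s\<bar> \<le> 1" for s
  proof -
    let ?I = "\<lambda>w. of_real (f w) * (g (z - w + s) - g (z - w) - of_real s * ?g' (z - w))"
    have "convolve f g (z + s) - convolve f g z - of_real s * convolve f ?g' z =
       (LINT w|lebesgue. of_real (f w) * g (z + s - w) - of_real (f w) * g (z - w)
          - of_real s * (of_real (f w) * ?g' (z - w)))"
      unfolding convolve_def using i i' by simp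
    also have "\<dots> = (LINT w|lebesgue. ?I w)"
      by (rule Bochner_Integration.integral_cong) (auto simp: algebra_simps)
    finally have "norm (convolve f g (z + s) - convolve f g z - of_real s * convolve f ?g' z) =
        norm (LINT w|lebesgue. ?I w)" by (rule arg_cong)
    also have "\<dots> \<le> (LINT w|lebesgue. norm (?I w))" by (rule integral_norm_bound)
    also have "\<dots> \<le> (LINT w|lebesgue. (M * B * s\<^sup>2) * indicator {z - Q..z + Q} w)"
    proof (rule integral_mono)
      have eq: "?I w = of_real (f w) * g (z + s - w) - of_real (f w) * g (z - w)
          - of_real s * (of_real (f w) * ?g' (z - w))" for w by (simp add: algebra_simps)
      show "integrable lebesgue (\<lambda>w. norm (?I w))"
        unfolding eq using i i'
        by (intro integrable_norm Bochner_Integration.integrable_diff integrable_mult_right)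
      show "integrable lebesgue (\<lambda>w. (M * B * s\<^sup>2) * indicator {z - Q..z + Q} w)"
        by (intro integrable_mult_right integrable_real_indicator) (auto simp: emeasure_lborel_Icc_eq)
      fix w
      show "norm (?I w) \<le> (M * B * s\<^sup>2) * indicator {z - Q..z + Q} w"
      proof (cases "w \<in> {z - Q..z + Q}")
        case True
        then show ?thesis
          using mult_mono[OF f(2)[of w] B(2)[of "z - w" s] M0 norm_ge_zero] by (simp add: norm_mult mult.assoc)
      next
        case False
        then have "Q < \<bar>z - w\<bar>" by auto
        then have "g (z - w + s) = 0" "g (z - w) = 0" "?g' (z - w) = 0"
          using s by (auto simp: Q_def intro!: R(2) R'(2))
        then show ?thesis using M0 B(1) by simp
      qed
    qed
    also have "\<dots> = M * B * s\<^sup>2 * (2 * Q)"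
      using Q by simp
    also have "\<dots> \<le> L * s\<^sup>2" by (simp add: L_def algebra_simps)
    finally show ?thesis .
  qed
  show ?thesis
    unfolding has_vector_derivative_def has_derivative_at_alt
  proof (intro conjI allI impI bounded_linear_scaleR_left)
    fix e :: real assume e: "0 < e"
    show "\<exists>d>0. \<forall>y. norm (y - z) < d \<longrightarrow>
        norm (convolve f g y - convolve f g z - (y - z) *\<^sub>R convolve f ?g' z) \<le> e * norm (y - z)"
    proof (intro exI[of _ "min 1 (e / L)"] conjI allI impI)
      fix y assume y: "norm (y - z) < min 1 (e / L)"
      have "norm (convolve f g y - convolve f g z - (y - z) *\<^sub>R convolve f ?g' z) \<le> L * (y - z)\<^sup>2"
        using est[of "y - z"] y by (simp add: scaleR_conv_of_real)
      also have "\<dots> = (L * \<bar>y - z\<bar>) * \<bar>y - z\<bar>" by (simp add: power2_eq_square)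
      also have "\<dots> \<le> e * \<bar>y - z\<bar>"
        using y L by (intro mult_right_mono) (auto simp: field_simps)
      finally show "norm (convolve f g y - convolve f g z - (y - z) *\<^sub>R convolve f ?g' z) \<le> e * norm (y - z)"
        by simp
    qed (use e L in auto)
  qed
qed

text \<open>If \<open>g (z - w)\<close> is nonzero, then \<open>\<bar>w\<bar> \<le> \<bar>z -
  w\<bar> + \<bar>z\<bar> < 2 * r\<close>, where \<open>f\<close> is zero. Hence the factor 2: one
  radius for the kernel, one for the point.\<close>

lemma convolve_eq_0:
  assumes "\<And>w. g w \<noteq> 0 \<Longrightarrow> \<bar>w\<bar> \<le> r" "\<And>w. \<bar>w\<bar> < 2 * r \<Longrightarrow> f w = 0" "\<bar>z\<bar> < r"
  shows "convolve f g z = 0"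
proof -
  have "of_real (f w) * g (z - w) = 0" for w
    using assms(1)[of "z - w"] assms(2)[of w] assms(3) by (cases "g (z - w) = 0") force+
  then have "(\<lambda>w. of_real (f w) * g (z - w)) = (\<lambda>w. 0)" by (rule ext)
  then show ?thesis unfolding convolve_def by (simp only: Bochner_Integration.integral_zero)
qed

text \<open>The evaluation point moves with the parameter because the regularised travel time does.
  Half of the distance \<open>d\<close> allowed by continuity is spent on \<open>Z i\<close>, the
  other half on the support of the kernel.\<close>

lemma convolve_rescale_tendsto:
  assumes f: "f \<in> borel_measurable lebesgue" "\<And>w. \<bar>f w\<bar> \<le> M" and "isCont f a"
    and \<rho>: "\<rho> \<in> mollifier1 q"
    and s: "\<forall>\<^sub>F i in F. 0 < s i" "(s \<longlongrightarrow> 0) F" and "(Z \<longlongrightarrow> a) F"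
  shows "((\<lambda>i. convolve f (rescale (s i) \<rho>) (Z i)) \<longlongrightarrow> of_real (f a)) F"
proof (rule tendstoI)
  fix e :: real assume e: "0 < e"
  let ?n = "LINT w|lborel. norm (\<rho> w)"
  have n: "0 \<le> ?n" by simp
  \<comment> \<open>The L1 norm \<open>?n\<close> does not change under rescaling, so it can enter
    the tolerance in advance; the summand 1 makes the final inequality strict.\<close>
  define e' where "e' = e / (?n + 1)"
  have n1: "0 < ?n + 1" using n by linarith
  have e': "0 < e'" unfolding e'_def by (rule divide_pos_pos[OF e n1])
  have "e' * (?n + 1) = e" using n1 by (simp add: e'_def)
  then have e'_less: "e' * ?n < e" using e' by (simp add: distrib_left)
  obtain d where d: "0 < d" "\<And>w. \<bar>w - a\<bar> < d \<Longrightarrow> \<bar>f w - f a\<bar> < e'"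
    using assms(3) e' unfolding isCont_def LIM_eq
    by (metis abs_zero cancel_comm_monoid_add_class.diff_cancel real_norm_def)
  have R: "0 < support_radius \<rho>" using \<rho> by (rule support_radius_pos)
  have "\<forall>\<^sub>F i in F. \<bar>Z i - a\<bar> < d / 2"
    using assms(7) d(1) tendstoD[of Z a F "d / 2"] by (simp add: dist_real_def)
  moreover have "\<forall>\<^sub>F i in F. s i < d / 2 / support_radius \<rho>"
    using s(2) d(1) R by (intro order_tendstoD) auto
  ultimately show "\<forall>\<^sub>F i in F. dist (convolve f (rescale (s i) \<rho>) (Z i)) (of_real (f a)) < e"
    using s(1)
  proof eventually_elim
    case (elim i)
    have m: "rescale (s i) \<rho> \<in> mollifier1 q" using \<rho> elim(3) by (rule mollifier1_rescale)
    have "norm (convolve f (rescale (s i) \<rho>) (Z i) - of_real (f a)) \<le>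
        e' * (LINT w|lborel. norm (rescale (s i) \<rho> w))"
    proof (rule convolve_near_const[OF f, where r = "d / 2"])
      show "integrable lborel (rescale (s i) \<rho>)" "(LINT w|lborel. rescale (s i) \<rho> w) = 1"
        using m by (auto simp: mollifier1_def intro: integrable_test_function)
      show "\<bar>w\<bar> \<le> d / 2" if "rescale (s i) \<rho> w \<noteq> 0" for w
        using le_support_radius[of "rescale (s i) \<rho>" w] that m support_radius_rescale[OF \<rho> elim(3)] elim(2) R
        by (simp add: mollifier1_def field_simps)
      show "\<bar>f w - f a\<bar> \<le> e'" if "\<bar>Z i - w\<bar> \<le> d / 2" for w
        using that elim(1) by (intro less_imp_le d(2)) linarith
    qed
    then show ?case
      using e'_less integral_norm_rescale[OF elim(3), of \<rho>] by (simp add: dist_norm)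
  qed
qed

section \<open>Regularised speed and explicit solutions\<close>

lemma has_vd_of_real:
  assumes "(g has_real_derivative d) (at x)"
  shows "((\<lambda>s. complex_of_real (g (x + s *\<^sub>R 1))) has_vector_derivative of_real d) (at 0 within A)"
proof (rule has_vd_axis)
  show "((\<lambda>x. complex_of_real (g x)) has_derivative (\<lambda>s. of_real (d * s))) (at x)"
    using assms unfolding has_field_derivative_def by (rule has_derivative_of_real)
qed simp

lemma continuous_on_of_real_DERIV:
  assumes "\<And>x. (g has_real_derivative g' x) (at x)"
  shows "continuous_on S (\<lambda>x. complex_of_real (g x))"
  using assms by (intro continuous_on_of_real continuous_at_imp_continuous_on ballI DERIV_isCont)

lemma tensor_base_rescale:
  assumes "\<rho> \<in> mollifier1 1" "0 < \<epsilon>"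
  shows "tensor_base (rescale \<epsilon> (tensor_power \<rho> :: real \<times> real \<Rightarrow> complex)) = rescale \<epsilon> \<rho>"
  unfolding rescale_tensor_power using assms
  by (intro tensor_base_tensor_power mollifier1_rescale)

lemma mollifier_prodE:
  assumes "(\<phi> :: real \<times> real \<Rightarrow> complex) \<in> mollifier 1"
  obtains \<rho> where "\<rho> \<in> mollifier1 1" "\<phi> = tensor_power \<rho>" "tensor_base \<phi> = \<rho>"
  using assms tensor_base_tensor_power by (auto simp: mollifier_def)

section \<open>The logistic step, softplus and the logarithmic scale\<close>

definition logistic :: "real \<Rightarrow> real" where
  "logistic s = 1 / (1 + exp (- s))"

definition softplus :: "real \<Rightarrow> real" where
  "softplus s = ln (1 + exp s)"

lemma one_plus_exp_pos: "0 < 1 + exp (s::real)"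
  by (simp add: add_pos_pos)

lemma logistic_bounds: "0 < logistic s" "logistic s < 1"
  using one_plus_exp_pos[of "- s"] by (simp_all add: logistic_def)

lemma DERIV_logistic: "(logistic has_real_derivative logistic s * (1 - logistic s)) (at s)"
  unfolding logistic_def[abs_def] using one_plus_exp_pos[of "- s"]
  by (auto intro!: derivative_eq_intros simp: field_simps power2_eq_square)

lemma DERIV_softplus: "(softplus has_real_derivative logistic s) (at s)"
  unfolding softplus_def[abs_def] logistic_def using one_plus_exp_pos[of s] one_plus_exp_pos[of "- s"]
  by (auto intro!: derivative_eq_intros simp: field_simps simp flip: exp_add)

lemma softplus_bounds: "max s 0 \<le> softplus s" "softplus s \<le> max s 0 + ln 2"
proof -
  have "exp (max s 0) \<le> 1 + exp s" by (auto simp: max_def)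
  then show "max s 0 \<le> softplus s"
    unfolding softplus_def using one_plus_exp_pos by (simp add: ln_ge_iff)
  have "1 + exp s \<le> exp (max s 0) * 2" by (auto simp: max_def)
  then have "ln (1 + exp s) \<le> ln (exp (max s 0) * 2)"
    using one_plus_exp_pos[of s] by (subst ln_le_cancel_iff) auto
  then show "softplus s \<le> max s 0 + ln 2"
    by (simp add: softplus_def ln_mult)
qed

text \<open>
  The width of the transition layer is logarithmic in the scale of the mollifier, so that the
  derivative of the speed has logarithmic growth.
\<close>

definition steepness :: "(real \<Rightarrow> complex) \<Rightarrow> real" where
  "steepness \<rho> = ln (2 + 1 / support_radius \<rho>)"

text \<open>The summand 2 keeps the argument of the logarithm above 1 even for mollifiers of large
  support.\<close>

lemma steepness_pos: "\<rho> \<in> mollifier1 q \<Longrightarrow> 0 < steepness \<rho>"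
  using support_radius_pos[of \<rho> q] by (simp add: steepness_def ln_gt_zero add_pos_pos)

text \<open>This is the form \<open>ln (c / \<epsilon>)\<close> of the growth condition, with
  \<open>c\<close> depending only on the unscaled mollifier; \<open>\<epsilon> < 1\<close> serves to
  absorb 2 into \<open>2 / \<epsilon>\<close>.\<close>

lemma steepness_rescale_le:
  assumes "\<rho> \<in> mollifier1 q" "0 < \<epsilon>" "\<epsilon> < 1"
  shows "steepness (rescale \<epsilon> \<rho>) \<le> ln ((2 + 1 / support_radius \<rho>) / \<epsilon>)"
proof -
  have R: "0 < support_radius \<rho>" using assms(1) by (rule support_radius_pos)
  have "2 + 1 / (\<epsilon> * support_radius \<rho>) \<le> (2 + 1 / support_radius \<rho>) / \<epsilon>"
    using assms(2,3) R by (simp add: field_simps)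
  then show ?thesis
    unfolding steepness_def support_radius_rescale[OF assms(1,2)]
    using assms(2) R by (subst ln_le_cancel_iff) (auto intro!: add_pos_pos divide_pos_pos)
qed

lemma steepness_rescale_at_top:
  assumes "\<rho> \<in> mollifier1 q"
  shows "filterlim (\<lambda>\<epsilon>. steepness (rescale \<epsilon> \<rho>)) at_top (at_right 0)"
proof -
  have R: "0 < support_radius \<rho>" using assms by (rule support_radius_pos)
  have "filterlim (\<lambda>\<epsilon>. 1 / support_radius \<rho> * inverse \<epsilon>) at_top (at_right 0)"
    using R by (intro filterlim_tendsto_pos_mult_at_top[OF tendsto_const _ filterlim_inverse_at_top_right]) simp
  then have "filterlim (\<lambda>\<epsilon>. ln (2 + 1 / support_radius \<rho> * inverse \<epsilon>)) at_top (at_right 0)"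
    by (intro filterlim_compose[OF ln_at_top] filterlim_tendsto_add_at_top[OF tendsto_const])
  moreover have "\<forall>\<^sub>F \<epsilon> in at_right 0. ln (2 + 1 / support_radius \<rho> * inverse \<epsilon>) = steepness (rescale \<epsilon> \<rho>)"
    using eventually_at_right_less[of "0::real"]
    by eventually_elim (simp add: steepness_def support_radius_rescale[OF assms] field_simps)
  ultimately show ?thesis by (simp cong: filterlim_cong)
qed

lemma logistic_steep_tendsto:
  assumes "\<rho> \<in> mollifier1 q" "y \<noteq> 0"
  shows "((\<lambda>\<epsilon>. logistic (steepness (rescale \<epsilon> \<rho>) * y)) \<longlongrightarrow> (if 0 < y then 1 else 0)) (at_right 0)"
proof -
  note l = steepness_rescale_at_top[OF assms(1)]
  show ?thesis
  proof (cases "0 < y")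
    case True
    have "filterlim (\<lambda>\<epsilon>. y * steepness (rescale \<epsilon> \<rho>)) at_top (at_right 0)"
      by (rule filterlim_tendsto_pos_mult_at_top[OF tendsto_const True l])
    then have "((\<lambda>\<epsilon>. exp (- (y * steepness (rescale \<epsilon> \<rho>)))) \<longlongrightarrow> 0) (at_right 0)"
      by (intro filterlim_compose[OF exp_at_bot] filterlim_uminus_at_top[THEN iffD1]) 
    then have "((\<lambda>\<epsilon>. 1 / (1 + exp (- (y * steepness (rescale \<epsilon> \<rho>))))) \<longlongrightarrow> 1 / (1 + 0)) (at_right 0)"
      by (intro tendsto_intros) auto
    then show ?thesis using True by (simp add: logistic_def mult.commute)
  next
    case False
    then have y: "0 < - y" using assms(2) by simp
    have "filterlim (\<lambda>\<epsilon>. (- y) * steepness (rescale \<epsilon> \<rho>)) at_top (at_right 0)"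
      by (rule filterlim_tendsto_pos_mult_at_top[OF tendsto_const y l])
    then have "filterlim (\<lambda>\<epsilon>. 1 + exp ((- y) * steepness (rescale \<epsilon> \<rho>))) at_top (at_right 0)"
      by (intro filterlim_tendsto_add_at_top[OF tendsto_const] filterlim_compose[OF exp_at_top])
    then have "((\<lambda>\<epsilon>. 1 / (1 + exp ((- y) * steepness (rescale \<epsilon> \<rho>)))) \<longlongrightarrow> 0) (at_right 0)"
      by (intro real_tendsto_divide_at_top[OF tendsto_const])
    then show ?thesis using False by (simp add: logistic_def mult.commute)
  qed
qed

lemma moderate_steepness: "moderate (\<lambda>\<rho> x::real. of_real (steepness \<rho>))"
proof (rule moderate_const_net[where N = 1])
  fix \<rho> :: "real \<Rightarrow> complex" assume "\<rho> \<in> mollifier 1"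
  then have \<rho>: "\<rho> \<in> mollifier1 1" by (simp add: mollifier_real)
  have R: "0 < support_radius \<rho>" using \<rho> by (rule support_radius_pos)
  let ?B = "2 + 1 / support_radius \<rho>"
  have "norm (complex_of_real (steepness (rescale \<epsilon> \<rho>))) \<le> ?B * \<epsilon> powr - real 1"
    if "0 < \<epsilon>" "\<epsilon> < 1" for \<epsilon>
  proof -
    have "0 < ?B / \<epsilon>" using that R by (intro divide_pos_pos add_pos_pos) auto
    \<comment> \<open>A logarithm is dominated by its argument; moderateness needs no finer
      bound.\<close>
    then have "steepness (rescale \<epsilon> \<rho>) \<le> ?B / \<epsilon>"
      using steepness_rescale_le[OF \<rho> that] ln_le_minus_one[of "?B / \<epsilon>"] by linarith
    then show ?thesis
      using steepness_pos[OF mollifier1_rescale[OF \<rho> that(1)]] that by (simp add: powr_minus divide_inverse)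
  qed
  then show "\<exists>B>0. \<exists>\<eta>>0. \<forall>\<epsilon>. 0 < \<epsilon> \<and> \<epsilon> < \<eta> \<longrightarrow>
      norm (complex_of_real (steepness (rescale \<epsilon> \<rho>))) \<le> B * \<epsilon> powr - real 1"
    using R by (intro exI[of _ ?B] conjI exI[of _ 1]) (auto intro!: add_pos_pos)
qed

text \<open>\<open>[:0, 1, -1:]\<close> is the polynomial X - X^2. The logistic function solves s' =
  s - s^2, so polynomials in it are closed under differentiation up to the factor
  \<open>steepness\<close>, and they are bounded because its values lie between 0 and 1.\<close>

lemma moderate_poly_logistic:
  "moderate (\<lambda>\<rho> x. complex_of_real (poly p (logistic (steepness \<rho> * (x - a)))))"
proof (rule moderate_chain[where w = "\<lambda>p \<rho> x. complex_of_real (poly p (logistic (steepness \<rho> * (x - a))))"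
      and d = "\<lambda>p b \<rho> x. of_real (steepness \<rho>)" and j = "\<lambda>p. pderiv p * [:0, 1, -1:]"])
  have D: "((\<lambda>x. poly p (logistic (steepness \<rho> * (x - a)))) has_real_derivative
      steepness \<rho> * poly (pderiv p * [:0, 1, -1:]) (logistic (steepness \<rho> * (x - a)))) (at x)" for p \<rho> x
    by (auto intro!: derivative_eq_intros DERIV_chain2[OF poly_DERIV] DERIV_chain2[OF DERIV_logistic]
        simp: algebra_simps)
  show "continuous_on orthant (\<lambda>x. complex_of_real (poly p (logistic (steepness \<rho> * (x - a)))))" for p \<rho>
    by (rule continuous_on_of_real_DERIV[OF D])
  show "((\<lambda>s. complex_of_real (poly p (logistic (steepness \<rho> * (x + s *\<^sub>R b - a))))) has_vector_derivative
      complex_of_real (steepness \<rho>) *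
        of_real (poly (pderiv p * [:0, 1, -1:]) (logistic (steepness \<rho> * (x - a)))))
      (at 0 within axis_line orthant b x)" if "b \<in> Basis" for b x :: real and p \<rho>
    using has_vd_of_real[OF D[of p \<rho> x]] that by simp
  show "net_bound mod_exponent (\<lambda>\<rho> x. complex_of_real (poly p (logistic (steepness \<rho> * (x - a))))) K []" for p K
  proof -
    have "compact (poly p ` {0..1})" by (intro compact_continuous_image continuous_intros) auto
    then obtain B where B: "0 < B" "\<forall>y\<in>poly p ` {0..1}. norm y \<le> B"
      using compact_imp_bounded bounded_pos by blast
    then have "norm (poly p (logistic s)) \<le> B" for s
      using logistic_bounds[of s] by auto
    then show ?thesis
      using B(1) by (intro net_bound_Nil_I[where N = 0] exI[of _ B] conjI exI[of _ 1]) auto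
  qed
qed (rule moderate_steepness)

section \<open>The regularised speed and its explicit travel time\<close>

locale two_speeds =
  fixes x\<^sub>0 c\<^sub>L c\<^sub>R :: real
  assumes x0: "0 < x\<^sub>0" and cL: "0 < c\<^sub>L" and cR: "0 < c\<^sub>R"
begin

lemma speeds_neq_0 [simp]: "c\<^sub>L \<noteq> 0" "c\<^sub>R \<noteq> 0"
  using cL cR by auto

definition jump :: real where "jump = 1 / c\<^sub>R - 1 / c\<^sub>L"

definition slowness :: "(real \<Rightarrow> complex) \<Rightarrow> real \<Rightarrow> real" where
  "slowness \<rho> x = 1 / c\<^sub>L + jump * logistic (steepness \<rho> * (x - x\<^sub>0))"

text \<open>The subtracted constant normalises the travel time to vanish exactly at x = 0, so that
  both waves take the same boundary values for every mollifier.\<close>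

definition arrival :: "(real \<Rightarrow> complex) \<Rightarrow> real \<Rightarrow> real" where
  "arrival \<rho> x = x / c\<^sub>L + jump *
     (softplus (steepness \<rho> * (x - x\<^sub>0)) - softplus (- steepness \<rho> * x\<^sub>0)) / steepness \<rho>"

definition min_slow :: real where "min_slow = min (1 / c\<^sub>L) (1 / c\<^sub>R)"
definition max_slow :: real where "max_slow = max (1 / c\<^sub>L) (1 / c\<^sub>R)"

lemma min_slow_pos: "0 < min_slow" and max_slow_pos: "0 < max_slow"
  using cL cR by (auto simp: min_slow_def max_slow_def less_max_iff_disj)

text \<open>The slowness is a convex combination of the two classical slownesses, so the bounds hold
  whatever the width of the layer.\<close>

lemma slowness_bounds: "min_slow \<le> slowness \<rho> x" "slowness \<rho> x \<le> max_slow"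
proof -
  let ?s = "logistic (steepness \<rho> * (x - x\<^sub>0))"
  have s: "0 \<le> ?s" "0 \<le> 1 - ?s" using logistic_bounds[of "steepness \<rho> * (x - x\<^sub>0)"] by auto
  have e: "slowness \<rho> x = (1 - ?s) * (1 / c\<^sub>L) + ?s * (1 / c\<^sub>R)"
    by (simp add: slowness_def jump_def algebra_simps)
  have "(1 - ?s) * min_slow + ?s * min_slow \<le> slowness \<rho> x"
    unfolding e using s by (intro add_mono mult_left_mono) (auto simp: min_slow_def)
  then show "min_slow \<le> slowness \<rho> x" by (simp add: algebra_simps)
  have "slowness \<rho> x \<le> (1 - ?s) * max_slow + ?s * max_slow"
    unfolding e using s by (intro add_mono mult_left_mono) (auto simp: max_slow_def)
  then show "slowness \<rho> x \<le> max_slow" by (simp add: algebra_simps)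
qed

lemma slowness_pos: "0 < slowness \<rho> x"
  using slowness_bounds(1) min_slow_pos by (rule less_le_trans[rotated])

lemma DERIV_slowness:
  "(slowness \<rho> has_real_derivative jump *
     (steepness \<rho> * poly [:0, 1, -1:] (logistic (steepness \<rho> * (x - x\<^sub>0))))) (at x)"
  unfolding slowness_def[abs_def]
  by (auto intro!: derivative_eq_intros DERIV_chain2[OF DERIV_logistic] simp: algebra_simps)

lemma DERIV_arrival:
  assumes "\<rho> \<in> mollifier1 q"
  shows "(arrival \<rho> has_real_derivative slowness \<rho> x) (at x)"
  unfolding arrival_def[abs_def] slowness_def using steepness_pos[OF assms]
  by (auto intro!: derivative_eq_intros DERIV_chain2[OF DERIV_softplus] simp: field_simps)

lemma arrival_0 [simp]: "arrival \<rho> 0 = 0"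
  by (simp add: arrival_def)

lemma arrival_diff_bounds:
  assumes "\<rho> \<in> mollifier1 q" "a \<le> b"
  shows "min_slow * (b - a) \<le> arrival \<rho> b - arrival \<rho> a" "arrival \<rho> b - arrival \<rho> a \<le> max_slow * (b - a)"
proof -
  have "\<exists>z. arrival \<rho> b - arrival \<rho> a = (b - a) * slowness \<rho> z"
  proof (cases "a = b")
    case False
    then show ?thesis
      using MVT2[of a b "arrival \<rho>" "slowness \<rho>"] DERIV_arrival[OF assms(1)] assms(2) by auto
  qed simp
  then obtain z where "arrival \<rho> b - arrival \<rho> a = (b - a) * slowness \<rho> z" ..
  then show "min_slow * (b - a) \<le> arrival \<rho> b - arrival \<rho> a" "arrival \<rho> b - arrival \<rho> a \<le> max_slow * (b - a)"
    using mult_right_mono[OF slowness_bounds(1)[of \<rho> z], of "b - a"]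
      mult_right_mono[OF slowness_bounds(2)[of \<rho> z], of "b - a"] assms(2)
    by (simp_all add: mult.commute[of "b - a"])
qed

definition limit_arrival :: "real \<Rightarrow> real" where
  "limit_arrival x = x / c\<^sub>L + jump * max (x - x\<^sub>0) 0"

text \<open>Softplus differs from the positive part by at most \<open>ln 2\<close>, and the positive
  part is homogeneous, so division by the steepness leaves an error of at most \<open>ln 2\<close>
  over the steepness, which tends to 0. The subtracted constant disappears in the limit because
  \<open>x\<^sub>0\<close> is positive.\<close>

lemma arrival_tendsto:
  assumes "\<rho> \<in> mollifier1 q"
  shows "((\<lambda>\<epsilon>. arrival (rescale \<epsilon> \<rho>) x) \<longlongrightarrow> limit_arrival x) (at_right 0)"
proof -
  let ?l = "\<lambda>\<epsilon>. steepness (rescale \<epsilon> \<rho>)"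
  have l: "\<forall>\<^sub>F \<epsilon> in at_right 0. 0 < ?l \<epsilon>"
    using eventually_at_right_less[of "0::real"]
    by eventually_elim (use assms in \<open>auto intro: steepness_pos mollifier1_rescale\<close>)
  have sp: "((\<lambda>\<epsilon>. softplus (?l \<epsilon> * y) / ?l \<epsilon>) \<longlongrightarrow> max y 0) (at_right 0)" for y
  proof (rule tendsto_sandwich)
    show "((\<lambda>\<epsilon>. max y 0) \<longlongrightarrow> max y 0) (at_right (0::real))" by simp
    have "((\<lambda>\<epsilon>. ln 2 / ?l \<epsilon>) \<longlongrightarrow> 0) (at_right 0)"
      by (intro real_tendsto_divide_at_top[OF tendsto_const] steepness_rescale_at_top[OF assms])
    from tendsto_add[OF tendsto_const[of "max y 0"] this]
    show "((\<lambda>\<epsilon>. max y 0 + ln 2 / ?l \<epsilon>) \<longlongrightarrow> max y 0) (at_right 0)" by simp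
    have m: "max (l * y) 0 = l * max y 0" if "0 < l" for l :: real
      using that by (auto simp: max_def mult_le_0_iff zero_le_mult_iff)
    show "\<forall>\<^sub>F \<epsilon> in at_right 0. max y 0 \<le> softplus (?l \<epsilon> * y) / ?l \<epsilon>"
      using l
    proof eventually_elim
      case (elim \<epsilon>)
      then show ?case
        using softplus_bounds(1)[of "?l \<epsilon> * y"] m[OF elim] by (simp add: pos_le_divide_eq mult.commute)
    qed
    show "\<forall>\<^sub>F \<epsilon> in at_right 0. softplus (?l \<epsilon> * y) / ?l \<epsilon> \<le> max y 0 + ln 2 / ?l \<epsilon>"
      using l
    proof eventually_elim
      case (elim \<epsilon>)
      then show ?case
        using softplus_bounds(2)[of "?l \<epsilon> * y"] m[OF elim] by (simp add: pos_divide_le_eq algebra_simps)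
    qed
  qed
  have "((\<lambda>\<epsilon>. x / c\<^sub>L + jump * (softplus (?l \<epsilon> * (x - x\<^sub>0)) / ?l \<epsilon> - softplus (?l \<epsilon> * (- x\<^sub>0)) / ?l \<epsilon>))
      \<longlongrightarrow> x / c\<^sub>L + jump * (max (x - x\<^sub>0) 0 - max (- x\<^sub>0) 0)) (at_right 0)"
    by (intro tendsto_intros sp)
  moreover have "max (- x\<^sub>0) 0 = 0" using x0 by simp
  ultimately show ?thesis
    unfolding arrival_def limit_arrival_def by (simp flip: diff_divide_distrib)
qed

definition slow_net :: "real net" where
  "slow_net \<rho> x = of_real (slowness \<rho> x)"

definition speed_net :: "real net" where
  "speed_net \<rho> x = of_real (inverse (slowness \<rho> x))"

lemma slow_speed_net: "slow_net \<rho> x * speed_net \<rho> x = 1"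
  using slowness_pos[of \<rho> x] by (simp add: slow_net_def speed_net_def flip: of_real_mult)

lemma moderate_slow_net: "moderate slow_net"
proof -
  have "slow_net = (\<lambda>\<rho> x. complex_of_real (poly [:1 / c\<^sub>L, jump:] (logistic (steepness \<rho> * (x - x\<^sub>0)))))"
    by (intro ext) (simp add: slow_net_def slowness_def)
  then show ?thesis using moderate_poly_logistic by (simp only:)
qed

lemma DERIV_inverse_power:
  fixes g :: "real \<Rightarrow> real"
  assumes "(g has_real_derivative g') (at x)" "g x \<noteq> 0"
  shows "((\<lambda>x. inverse (g x) ^ k) has_real_derivative (- real k * g') * inverse (g x) ^ Suc k) (at x)"
proof (cases k)
  case (Suc n)
  have "((\<lambda>x. inverse (g x)) has_real_derivative - (inverse (g x) * g' * inverse (g x))) (at x)"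
    using assms by (rule DERIV_inverse')
  from DERIV_power[OF this, of k] show ?thesis
    unfolding Suc by (simp add: algebra_simps)
qed simp

lemma DERIV_inverse_slowness_power:
  "((\<lambda>x. inverse (slowness \<rho> x) ^ k) has_real_derivative
     (- real k * (jump * (steepness \<rho> * poly [:0, 1, -1:] (logistic (steepness \<rho> * (x - x\<^sub>0)))))) *
       inverse (slowness \<rho> x) ^ Suc k) (at x)"
  using slowness_pos[of \<rho> x] by (intro DERIV_inverse_power DERIV_slowness) simp

text \<open>The powers of the inverse slowness form a chain: the \<open>k\<close>-th differentiates
  to a moderate coefficient times the next one, and each is bounded by a power of
  \<open>1 / min_slow\<close>. The speed is the member \<open>k = 1\<close>.\<close>

lemma moderate_speed_net: "moderate speed_net"
proof -
  let ?p = "\<lambda>\<rho> x. complex_of_real (poly [:0, 1, -1:] (logistic (steepness \<rho> * (x - x\<^sub>0))))"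
  have "moderate ((\<lambda>k \<rho> x. complex_of_real (inverse (slowness \<rho> x) ^ k)) 1)"
  proof (rule moderate_chain[where j = Suc and
        d = "\<lambda>k b \<rho> x. of_real (- real k * jump) * (of_real (steepness \<rho>) * ?p \<rho> x)"])
    show "continuous_on orthant (\<lambda>x. complex_of_real (inverse (slowness \<rho> x) ^ k))" for \<rho> k
      by (rule continuous_on_of_real_DERIV[OF DERIV_inverse_slowness_power])
    show "((\<lambda>s. complex_of_real (inverse (slowness \<rho> (x + s *\<^sub>R b)) ^ k)) has_vector_derivative
        (of_real (- real k * jump) * (of_real (steepness \<rho>) * ?p \<rho> x)) *
          of_real (inverse (slowness \<rho> x) ^ Suc k)) (at 0 within axis_line orthant b x)"
      if "b \<in> Basis" for b x :: real and k \<rho>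
      using has_vd_of_real[OF DERIV_inverse_slowness_power[of \<rho> k x], of "axis_line orthant b x"] that
      unfolding of_real_mult by (simp only: mult.assoc Basis_real_def singleton_iff)
    show "moderate (\<lambda>\<rho> x. of_real (- real k * jump) * (of_real (steepness \<rho>) * ?p \<rho> x))" for k
      by (intro moderate_mult moderate_const moderate_steepness moderate_poly_logistic)
    show "net_bound mod_exponent (\<lambda>\<rho> x. complex_of_real (inverse (slowness \<rho> x) ^ k)) K []" for k K
    proof -
      have "norm (complex_of_real (inverse (slowness \<rho> x) ^ k)) \<le> (1 / min_slow) ^ k" for \<rho> x
        unfolding norm_of_real power_abs using slowness_pos[of \<rho> x] slowness_bounds(1)[of \<rho> x] min_slow_pos
        by (intro power_mono) (auto simp: field_simps)
      then show ?thesis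
        using min_slow_pos
        by (intro net_bound_Nil_I[where N = 0] exI[of _ "(1 / min_slow) ^ k"] conjI exI[of _ 1]) auto
    qed
  qed
  then show ?thesis by (simp add: speed_net_def[abs_def])
qed

end

section \<open>The mollified profile and the travelling waves\<close>

locale two_speeds_profile = two_speeds +
  fixes f :: "real \<Rightarrow> real" and M r :: real
  assumes f_measurable: "f \<in> borel_measurable lebesgue"
    and f_bound: "\<And>w. \<bar>f w\<bar> \<le> M"
    and r_pos: "0 < r"
    and f_eq_0: "\<And>w. \<bar>w\<bar> < 2 * r \<Longrightarrow> f w = 0"
begin

text \<open>
  The mollifier is shrunk to support in \<open>[-r, r]\<close>, so that the mollified profile vanishes near
  \<open>0\<close> for all \<open>\<epsilon>\<close>; for small \<open>\<epsilon>\<close> this leaves it unchanged.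
\<close>

definition shrink :: "(real \<Rightarrow> complex) \<Rightarrow> real \<Rightarrow> complex" where
  "shrink \<rho> = rescale (min 1 (r / support_radius \<rho>)) \<rho>"

text \<open>The index \<open>k\<close> counts derivatives, all carried by the kernel; it provides
  the family along which \<open>moderate_chain\<close> runs.\<close>

definition profile :: "nat \<Rightarrow> (real \<Rightarrow> complex) \<Rightarrow> real \<Rightarrow> complex" where
  "profile k \<rho> = convolve f ((partial UNIV 1 ^^ k) (shrink \<rho>))"

lemma shrink_mollifier1: "\<rho> \<in> mollifier1 q \<Longrightarrow> shrink \<rho> \<in> mollifier1 q"
  unfolding shrink_def using support_radius_pos[of \<rho> q] r_pos by (intro mollifier1_rescale) auto

lemma shrink_rescale:
  assumes "\<rho> \<in> mollifier1 q" "0 < \<epsilon>"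
  shows "shrink (rescale \<epsilon> \<rho>) = rescale (min \<epsilon> (r / support_radius \<rho>)) \<rho>"
proof -
  have "min 1 (r / (\<epsilon> * support_radius \<rho>)) * \<epsilon> = min \<epsilon> (r / support_radius \<rho>)"
    using assms(2) support_radius_pos[OF assms(1)] by (auto simp: min_def field_simps)
  then show ?thesis
    by (simp add: shrink_def rescale_rescale support_radius_rescale[OF assms])
qed

lemma shrink_test_function: "\<rho> \<in> mollifier1 q \<Longrightarrow> shrink \<rho> \<in> test_functions UNIV"
  using shrink_mollifier1[of \<rho> q] by (simp add: mollifier1_def)

lemma profile_has_vd:
  assumes "\<rho> \<in> mollifier1 q"
  shows "(profile k \<rho> has_vector_derivative profile (Suc k) \<rho> z) (at z)"
  using convolve_has_vector_derivative[OF f_measurable f_bound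
      test_functions_partial_funpow[OF shrink_test_function[OF assms]]]
  by (simp add: profile_def)

lemma norm_profile_rescale_le:
  assumes "\<rho> \<in> mollifier1 q" "0 < \<epsilon>"
  shows "norm (profile k (rescale \<epsilon> \<rho>) z) \<le>
    M * ((1 / min \<epsilon> (r / support_radius \<rho>)) ^ k * (LINT x|lborel. norm ((partial UNIV 1 ^^ k) \<rho> x)))"
proof -
  let ?s = "min \<epsilon> (r / support_radius \<rho>)" and ?g = "(partial UNIV 1 ^^ k) \<rho>"
  have s: "0 < ?s" using assms(2) r_pos support_radius_pos[OF assms(1)] by simp
  have \<rho>: "\<rho> \<in> test_functions UNIV" using assms(1) by (simp add: mollifier1_def)
  have "rescale ?s \<rho> \<in> test_functions UNIV" using \<rho> s by (rule test_functions_rescale)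
  then have "norm (profile k (rescale \<epsilon> \<rho>) z) \<le>
      M * (LINT x|lborel. norm ((partial UNIV 1 ^^ k) (rescale ?s \<rho>) x))"
    unfolding profile_def shrink_rescale[OF assms]
    by (intro norm_convolve_le f_measurable f_bound integrable_test_function test_functions_partial_funpow)
  also have "(LINT x|lborel. norm ((partial UNIV 1 ^^ k) (rescale ?s \<rho>) x)) =
      (LINT x|lborel. (1 / ?s) ^ k * norm (rescale ?s ?g x))"
    unfolding partial_funpow_rescale[OF \<rho> s] norm_mult norm_of_real using s by simp
  also have "\<dots> = (1 / ?s) ^ k * (LINT x|lborel. norm (?g x))"
    by (simp add: integral_norm_rescale[OF s])
  finally show ?thesis .
qed

text \<open>The bound is the same for all \<epsilon>, as dominated convergence requires.\<close>

lemma norm_profile_0_le: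
  "\<rho> \<in> mollifier1 q \<Longrightarrow> 0 < \<epsilon> \<Longrightarrow> norm (profile 0 (rescale \<epsilon> \<rho>) z) \<le> M * (LINT x|lborel. norm (\<rho> x))"
  using norm_profile_rescale_le[of \<rho> q \<epsilon> 0 z] by simp

lemma profile_eq_0:
  assumes "\<rho> \<in> mollifier1 q" "\<bar>z\<bar> < r"
  shows "profile 0 \<rho> z = 0"
proof -
  have R: "0 < support_radius \<rho>" using assms(1) by (rule support_radius_pos)
  have "support_radius (shrink \<rho>) = min 1 (r / support_radius \<rho>) * support_radius \<rho>"
    unfolding shrink_def using R r_pos by (intro support_radius_rescale[OF assms(1)]) auto
  also have "\<dots> \<le> r" using R by (auto simp: min_def field_simps)
  finally have "shrink \<rho> w \<noteq> 0 \<Longrightarrow> \<bar>w\<bar> \<le> r" for w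
    using le_support_radius[of "shrink \<rho>" w] shrink_test_function[OF assms(1)] by simp
  then show ?thesis
    unfolding profile_def using assms(2) f_eq_0 by (intro convolve_eq_0[where r = r]) auto
qed

lemma profile_tendsto:
  assumes "\<rho> \<in> mollifier1 q" "isCont f a" "(Z \<longlongrightarrow> a) (at_right 0)"
  shows "((\<lambda>\<epsilon>. profile 0 (rescale \<epsilon> \<rho>) (Z \<epsilon>)) \<longlongrightarrow> of_real (f a)) (at_right 0)"
proof -
  have R: "0 < r / support_radius \<rho>" using r_pos support_radius_pos[OF assms(1)] by simp
  have pos: "\<forall>\<^sub>F \<epsilon> in at_right 0. (0::real) < \<epsilon>" by (rule eventually_at_right_less)
  have "((\<lambda>\<epsilon>. min \<epsilon> (r / support_radius \<rho>)) \<longlongrightarrow> min 0 (r / support_radius \<rho>)) (at_right 0)"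
    by (intro tendsto_intros)
  then have lim: "((\<lambda>\<epsilon>. min \<epsilon> (r / support_radius \<rho>)) \<longlongrightarrow> 0) (at_right 0)"
    using R by simp
  have "\<forall>\<^sub>F \<epsilon> in at_right 0. 0 < min \<epsilon> (r / support_radius \<rho>)"
    using pos by eventually_elim (use R in simp)
  from convolve_rescale_tendsto[OF f_measurable f_bound assms(2,1) this lim assms(3)]
  have "((\<lambda>\<epsilon>. convolve f (rescale (min \<epsilon> (r / support_radius \<rho>)) \<rho>) (Z \<epsilon>)) \<longlongrightarrow> of_real (f a)) (at_right 0)" .
  moreover have "\<forall>\<^sub>F \<epsilon> in at_right 0. convolve f (rescale (min \<epsilon> (r / support_radius \<rho>)) \<rho>) (Z \<epsilon>) =
      profile 0 (rescale \<epsilon> \<rho>) (Z \<epsilon>)"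
    using pos by eventually_elim (simp add: profile_def shrink_rescale[OF assms(1)])
  ultimately show ?thesis by (rule Lim_transform_eventually)
qed

text \<open>For \<open>a = 1\<close> and \<open>a = -1\<close> the waves travelling to the right and to the left.\<close>

definition wave :: "real \<Rightarrow> nat \<Rightarrow> (real \<times> real) net" where
  "wave a k \<phi> p = profile k (tensor_base \<phi>) (a * arrival (tensor_base \<phi>) (fst p) - snd p)"

text \<open>The derivative of the phase \<open>a * arrival x - t\<close> along the basis vector
  \<open>b\<close>.\<close>

definition wave_factor :: "real \<Rightarrow> real \<times> real \<Rightarrow> (real \<times> real) net" where
  "wave_factor a b \<phi> p = (if b = (1, 0) then of_real a * slow_net (tensor_base \<phi>) (fst p) else -1)"

lemma wave_has_derivative:
  assumes "\<phi> \<in> mollifier 1"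
  shows "(wave a k \<phi> has_derivative
    (\<lambda>h. (a * (slowness (tensor_base \<phi>) (fst p) * fst h) - snd h) *\<^sub>R wave a (Suc k) \<phi> p)) (at p)"
proof -
  obtain \<rho> where \<rho>: "\<rho> \<in> mollifier1 1" "tensor_base \<phi> = \<rho>"
    using assms by (rule mollifier_prodE)
  have "(arrival \<rho> has_derivative (\<lambda>h. slowness \<rho> (fst p) * h)) (at (fst p))"
    using DERIV_arrival[OF \<rho>(1)] unfolding has_field_derivative_def .
  from has_derivative_compose[OF has_derivative_fst[OF has_derivative_ident] this]
  have "((\<lambda>p. arrival \<rho> (fst p)) has_derivative (\<lambda>h. slowness \<rho> (fst p) * fst h)) (at p)" .
  then have "((\<lambda>p. a * arrival \<rho> (fst p) - snd p) has_derivative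
      (\<lambda>h. a * (slowness \<rho> (fst p) * fst h) - snd h)) (at p)"
    by (auto intro!: derivative_eq_intros)
  from has_derivative_compose[OF this profile_has_vd[OF \<rho>(1), unfolded has_vector_derivative_def]]
  show ?thesis by (simp add: wave_def[abs_def] \<rho>(2))
qed

lemma wave_has_vd:
  assumes "\<phi> \<in> mollifier 1" "b \<in> Basis"
  shows "((\<lambda>s. wave a k \<phi> (p + s *\<^sub>R b)) has_vector_derivative wave_factor a b \<phi> p * wave a (Suc k) \<phi> p)
    (at 0 within A)"
  by (rule has_vd_axis[OF wave_has_derivative[OF assms(1)]])
    (use assms(2) in \<open>auto simp: Basis_real_real wave_factor_def slow_net_def scaleR_conv_of_real\<close>)

lemma partial_wave:
  assumes "\<phi> \<in> mollifier 1" "b \<in> Basis" "p \<in> orthant"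
  shows "partial orthant b (wave a k \<phi>) p = wave_factor a b \<phi> p * wave a (Suc k) \<phi> p"
  using assms(3,2) wave_has_vd[OF assms(1,2)] by (rule partial_orthantI)

lemma moderate_wave: "moderate (wave a k)"
proof (rule moderate_chain[where j = Suc and d = "\<lambda>k b. wave_factor a b"])
  show "continuous_on orthant (wave a k \<phi>)" if "\<phi> \<in> mollifier 1" for k \<phi>
    using has_derivative_continuous[OF wave_has_derivative[OF that]] continuous_at_imp_continuous_on by blast
  show "moderate (wave_factor a b)" for b
  proof (cases "b = (1, 0)")
    case True
    then have "wave_factor a b = (\<lambda>\<phi> p. of_real a * slow_net (tensor_base \<phi>) (fst p))"
      by (intro ext) (simp add: wave_factor_def)
    then show ?thesis
      using moderate_mult[OF moderate_const moderate_of_space[OF moderate_slow_net]] by simp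
  next
    case False
    then have "wave_factor a b = (\<lambda>\<phi> p. -1)" by (intro ext) (simp add: wave_factor_def)
    then show ?thesis using moderate_const by simp
  qed
  show "net_bound mod_exponent (wave a k) K []" for k K
  proof (rule net_bound_Nil_I[where N = k])
    fix \<phi> :: "real \<times> real \<Rightarrow> complex" assume "\<phi> \<in> mollifier 1"
    then obtain \<rho> where \<rho>: "\<rho> \<in> mollifier1 1" "\<phi> = tensor_power \<rho>"
      by (rule mollifier_prodE)
    define I where "I = (LINT x|lborel. norm ((partial UNIV 1 ^^ k) \<rho> x))"
    have I: "0 \<le> I" by (simp add: I_def)
    have M: "0 \<le> M" using f_bound[of 0] by linarith
    have R: "0 < r / support_radius \<rho>" using r_pos support_radius_pos[OF \<rho>(1)] by simp
    \<comment> \<open>For \<epsilon> below this threshold the shrinking is inactive and the kernel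
      has scale exactly \<epsilon>.\<close>
    have "norm (wave a k (rescale \<epsilon> \<phi>) p) \<le> (M * I + 1) * \<epsilon> powr - real k"
      if \<epsilon>: "0 < \<epsilon>" "\<epsilon> < r / support_radius \<rho>" for \<epsilon> p
    proof -
      have "norm (wave a k (rescale \<epsilon> \<phi>) p) \<le> M * ((1 / \<epsilon>) ^ k * I)"
        unfolding wave_def \<rho>(2) tensor_base_rescale[OF \<rho>(1) \<epsilon>(1)] I_def
        using norm_profile_rescale_le[OF \<rho>(1) \<epsilon>(1), of k] \<epsilon>(2) by (simp add: min_absorb1)
      also have "(1 / \<epsilon>) ^ k = \<epsilon> powr - real k"
        using \<epsilon>(1) by (simp add: powr_minus powr_realpow power_one_over divide_inverse power_inverse)
      also have "M * (\<epsilon> powr - real k * I) \<le> (M * I + 1) * \<epsilon> powr - real k"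
        by (simp add: algebra_simps)
      finally show ?thesis .
    qed
    then show "\<exists>B>0. \<exists>\<eta>>0. \<forall>\<epsilon>. 0 < \<epsilon> \<and> \<epsilon> < \<eta> \<longrightarrow>
        (\<forall>x\<in>K. norm (wave a k (rescale \<epsilon> \<phi>) x) \<le> B * \<epsilon> powr - real k)"
      using I M R by (intro exI[of _ "M * I + 1"] conjI exI[of _ "r / support_radius \<rho>"])
        (auto intro!: add_nonneg_pos mult_nonneg_nonneg)
  qed
qed (rule wave_has_vd)

text \<open>The slowness produced by the chain rule cancels the speed, and
  \<open>a\<^sup>2 = 1\<close> removes the two signs. The equation holds exactly, not just up to a
  null net.\<close>

lemma wave_transport:
  assumes "\<phi> \<in> mollifier 1" "p \<in> orthant" "a\<^sup>2 = 1"
  shows "partial orthant (0, 1) (wave a k \<phi>) p +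
    of_real a * (speed_net (tensor_base \<phi>) (fst p) * partial orthant (1, 0) (wave a k \<phi>) p) = 0"
proof -
  have "partial orthant (1, 0) (wave a k \<phi>) p = of_real a * slow_net (tensor_base \<phi>) (fst p) * wave a (Suc k) \<phi> p"
    "partial orthant (0, 1) (wave a k \<phi>) p = - wave a (Suc k) \<phi> p"
    using assms(1,2) by (simp_all add: partial_wave Basis_real_real wave_factor_def)
  moreover have "of_real a * (v * (of_real a * s * w)) = of_real (a\<^sup>2) * (s * v) * w" for s v w :: complex
    by (simp only: power2_eq_square of_real_mult mult_ac)
  ultimately show ?thesis
    using assms(3) by (simp only: slow_speed_net) simp
qed

end

section \<open>Calculus on the quadrant\<close>

lemma orthant_Times: "(orthant :: (real \<times> real) set) = {0..} \<times> {0..}"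
  by (auto simp: orthant_prod)

lemma smooth_on_has_vd_slice:
  fixes w :: "real \<times> real \<Rightarrow> complex"
  assumes "smooth_on orthant w" "0 \<le> x" "0 \<le> t"
  shows "((\<lambda>y. w (y, t)) has_vector_derivative partial orthant (1, 0) w (x, t)) (at x within {0..})"
    and "((\<lambda>s. w (x, s)) has_vector_derivative partial orthant (0, 1) w (x, t)) (at t within {0..})"
proof -
  have p: "(x, t) \<in> orthant" using assms by (simp add: orthant_prod)
  have *: "(g has_vector_derivative d) (at c within {0..})"
    if "((\<lambda>s. g (c + s)) has_vector_derivative d) (at 0 within {s. 0 \<le> c + s})"
    for g :: "real \<Rightarrow> complex" and c d
  proof -
    have "{s. 0 \<le> c + s} = (\<lambda>y. y - c) ` {0..}"
      by (auto intro!: image_eqI[of _ _ "c + _"])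
    then have "((\<lambda>s. g (c + s)) \<circ> (\<lambda>y. y - c) has_vector_derivative 1 *\<^sub>R d) (at c within {0..})"
      using that by (intro vector_diff_chain_within) (auto intro!: derivative_eq_intros)
    then show ?thesis by (simp add: o_def)
  qed
  show "((\<lambda>y. w (y, t)) has_vector_derivative partial orthant (1, 0) w (x, t)) (at x within {0..})"
    using smooth_on_has_vd[OF assms(1) _ p, of "(1, 0)"] assms(3)
    by (intro *) (simp add: axis_line_def orthant_prod Basis_real_real)
  show "((\<lambda>s. w (x, s)) has_vector_derivative partial orthant (0, 1) w (x, t)) (at t within {0..})"
    using smooth_on_has_vd[OF assms(1) _ p, of "(0, 1)"] assms(2)
    by (intro *) (simp add: axis_line_def orthant_prod Basis_real_real)
qed

text \<open>The end point \<open>x + 1\<close> makes the interval nondegenerate, so that one-sided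
  derivatives are unique also at 0.\<close>

lemma has_vector_derivative_unique_half_line:
  fixes g :: "real \<Rightarrow> complex"
  assumes "(g has_vector_derivative d) (at x within {0..x + 1})"
    "(g has_vector_derivative e) (at x within {0..x + 1})" "0 \<le> x"
  shows "d = e"
  using assms by (intro vector_derivative_unique_within_closed_interval[of 0 "x + 1" x g]) auto

text \<open>\<open>smooth_on\<close> speaks only of derivatives along the axes. The chain rule along
  characteristics needs the total derivative up to the boundary, which follows from the continuity
  of the t-derivative.\<close>

lemma smooth_on_has_derivative_quadrant:
  fixes w :: "real \<times> real \<Rightarrow> complex"
  assumes "smooth_on orthant w" "0 \<le> x" "0 \<le> t"
  shows "(w has_derivative (\<lambda>h. fst h *\<^sub>R partial orthant (1, 0) w (x, t) + snd h *\<^sub>R partial orthant (0, 1) w (x, t)))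
    (at (x, t) within orthant)"
proof -
  let ?d = "partial orthant (0, 1) w"
  have c: "continuous_on orthant ?d"
    using assms(1) by (intro smooth_on_continuous smooth_on_partial) (simp_all add: Basis_real_real)
  have "((\<lambda>(x, t). w (x, t)) has_derivative
      (\<lambda>(h, k). h *\<^sub>R partial orthant (1, 0) w (x, t) + blinfun_scaleR_left (?d (x, t)) k))
      (at (x, t) within {0..} \<times> {0..})"
  proof (rule has_derivative_partialsI)
    show "((\<lambda>y. w (y, t)) has_derivative (\<lambda>h. h *\<^sub>R partial orthant (1, 0) w (x, t))) (at x within {0..})"
      using smooth_on_has_vd_slice(1)[OF assms] by (simp add: has_vector_derivative_def)
    show "((\<lambda>s. w (y, s)) has_derivative blinfun_apply (blinfun_scaleR_left (?d (y, s)))) (at s within {0..})"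
      if "y \<in> {0..}" "s \<in> {0..}" for y s
      using smooth_on_has_vd_slice(2)[OF assms(1)] that by (simp add: has_vector_derivative_def)
    have "continuous_on ({0..} \<times> {0..}) (\<lambda>p. blinfun_scaleR_left (?d p))"
      using c unfolding orthant_Times
      by (intro bounded_linear.continuous_on[OF bounded_linear_blinfun_scaleR_left])
    then show "continuous (at (x, t) within {0..} \<times> {0..}) (\<lambda>(x, y). blinfun_scaleR_left (?d (x, y)))"
      using assms(2,3) by (auto simp: continuous_on_eq_continuous_within case_prod_beta')
  qed (use assms(3) in auto)
  then show ?thesis
    unfolding orthant_Times by (simp add: case_prod_beta')
qed

text \<open>The symmetry is needed on the axes too, where derivatives are one-sided. Therefore
  \<open>w (y, s) - w (y, 0)\<close> is written as the integral of the t-derivative, differentiated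
  in \<open>y\<close> under the integral sign, and the result is differentiated in
  \<open>s\<close>.\<close>

lemma partial_commute:
  fixes w :: "real \<times> real \<Rightarrow> complex"
  assumes w: "smooth_on orthant w" and "p \<in> orthant"
  shows "partial orthant (1, 0) (partial orthant (0, 1) w) p = partial orthant (0, 1) (partial orthant (1, 0) w) p"
proof -
  let ?g = "partial orthant (0, 1) w" and ?h = "partial orthant (1, 0) w"
  let ?k = "partial orthant (1, 0) ?g"
  obtain x t where p: "p = (x, t)" "0 \<le> x" "0 \<le> t"
    using assms(2) by (cases p) (simp add: orthant_prod)
  have B: "(1, 0) \<in> (Basis :: (real \<times> real) set)" "(0, 1) \<in> (Basis :: (real \<times> real) set)"
    by (simp_all add: Basis_real_real)
  have g: "smooth_on orthant ?g" and h: "smooth_on orthant ?h"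
    using w B by (simp_all add: smooth_on_partial)
  have k: "smooth_on orthant ?k" using g B by (simp add: smooth_on_partial)
  have slice: "continuous_on {0..} (\<lambda>s. v (y, s))" if "smooth_on orthant v" "0 \<le> y"
    for v :: "real \<times> real \<Rightarrow> complex" and y
    using that by (intro continuous_on_compose2[OF smooth_on_continuous[OF that(1)]])
      (auto simp: orthant_prod intro!: continuous_intros)
  have int: "((\<lambda>\<tau>. ?g (y, \<tau>)) has_integral w (y, s) - w (y, 0)) (cbox 0 s)" if "0 \<le> y" "0 \<le> s" for y s
    unfolding cbox_interval using that
    by (intro fundamental_theorem_of_calculus)
      (auto intro: has_vector_derivative_within_subset[OF smooth_on_has_vd_slice(2)[OF w]])
  have eq: "?h (x, s) = ?h (x, 0) + integral {0..s} (\<lambda>\<tau>. ?k (x, \<tau>))" if s: "0 \<le> s" for s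
  proof -
    have 1: "((\<lambda>y. integral (cbox 0 s) (\<lambda>\<tau>. ?g (y, \<tau>))) has_vector_derivative
        integral (cbox 0 s) (\<lambda>\<tau>. ?k (x, \<tau>))) (at x within {0..})"
    proof (rule leibniz_rule_vector_derivative)
      show "((\<lambda>y. ?g (y, \<tau>)) has_vector_derivative ?k (y, \<tau>)) (at y within {0..})"
        if "y \<in> {0..}" "\<tau> \<in> cbox 0 s" for y \<tau>
        using that by (intro smooth_on_has_vd_slice(1)[OF g]) auto
      show "(\<lambda>\<tau>. ?g (y, \<tau>)) integrable_on cbox 0 s" if "y \<in> {0..}" for y
        using int[of y s] that s by (auto simp: integrable_on_def)
      show "continuous_on ({0..} \<times> cbox 0 s) (\<lambda>(y, \<tau>). ?k (y, \<tau>))"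
      proof -
        have "{0::real..} \<times> cbox 0 s \<subseteq> orthant" by (auto simp: orthant_prod)
        then show ?thesis
          using continuous_on_subset[OF smooth_on_continuous[OF k]] by (simp add: case_prod_beta')
      qed
    qed (use p in auto)
    have 2: "((\<lambda>y. w (y, s) - w (y, 0)) has_vector_derivative ?h (x, s) - ?h (x, 0)) (at x within {0..})"
      using p s by (intro has_vector_derivative_diff smooth_on_has_vd_slice(1)[OF w]) auto
    have "((\<lambda>y. w (y, s) - w (y, 0)) has_vector_derivative
        integral (cbox 0 s) (\<lambda>\<tau>. ?k (x, \<tau>))) (at x within {0..})"
      by (rule has_vector_derivative_transform[OF _ _ 1])
        (use p s integral_unique[OF int] in auto)
    then have "?h (x, s) - ?h (x, 0) = integral (cbox 0 s) (\<lambda>\<tau>. ?k (x, \<tau>))"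
      using 2 p by (intro has_vector_derivative_unique_half_line[of "\<lambda>y. w (y, s) - w (y, 0)" _ x])
        (auto intro: has_vector_derivative_within_subset)
    then show ?thesis by (simp add: algebra_simps)
  qed
  have "((\<lambda>s. integral {0..s} (\<lambda>\<tau>. ?k (x, \<tau>))) has_vector_derivative ?k (x, t)) (at t within {0..t + 1})"
    using p by (intro integral_has_vector_derivative continuous_on_subset[OF slice[OF k]]) auto
  then have "((\<lambda>s. ?h (x, 0) + integral {0..s} (\<lambda>\<tau>. ?k (x, \<tau>))) has_vector_derivative 0 + ?k (x, t))
      (at t within {0..t + 1})"
    by (intro has_vector_derivative_add has_vector_derivative_const)
  then have d: "((\<lambda>s. ?h (x, 0) + integral {0..s} (\<lambda>\<tau>. ?k (x, \<tau>))) has_vector_derivative ?k (x, t))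
      (at t within {0..t + 1})" by simp
  have "((\<lambda>s. ?h (x, s)) has_vector_derivative ?k (x, t)) (at t within {0..t + 1})"
  proof (rule has_vector_derivative_transform[OF _ _ d])
    show "t \<in> {0..t + 1}" using p by simp
    show "?h (x, s) = ?h (x, 0) + integral {0..s} (\<lambda>\<tau>. ?k (x, \<tau>))" if "s \<in> {0..t + 1}" for s
      using that by (intro eq) simp
  qed
  moreover have "((\<lambda>s. ?h (x, s)) has_vector_derivative partial orthant (0, 1) ?h (x, t)) (at t within {0..t + 1})"
    by (rule has_vector_derivative_within_subset[OF smooth_on_has_vd_slice(2)[OF h]]) (use p in auto)
  ultimately show ?thesis
    unfolding p(1) using p(3) by (intro has_vector_derivative_unique_half_line[of "\<lambda>s. ?h (x, s)" _ t])
qed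

lemma mollifier_prod_power:
  assumes "(\<phi> :: real \<times> real \<Rightarrow> complex) \<in> mollifier q"
  obtains \<rho> where "\<rho> \<in> mollifier1 q" "\<phi> = tensor_power \<rho>"
  using assms by (auto simp: mollifier_def)

lemma estimate_eventually:
  "estimate u \<phi> K ds s \<longleftrightarrow> (\<exists>C>0. \<forall>\<^sub>F \<epsilon> in at_right 0. \<forall>x\<in>K.
     norm (partials orthant ds (u (rescale \<epsilon> \<phi>)) x) \<le> C * \<epsilon> powr s)"
  unfolding estimate_def eventually_at_right_field by (auto simp: greaterThan_def)

section \<open>Bounds along characteristics\<close>

context two_speeds
begin

text \<open>Because slowness times speed is 1 and \<open>a\<^sup>2 = 1\<close>, the derivative of
  \<open>w\<close> along the curve is \<open>a\<close> times the slowness times the transport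
  residual. There is no term of order 0, so integrating the residual suffices and no Gronwall
  argument enters.\<close>

lemma characteristic_bound:
  assumes w: "smooth_on orthant w" and \<rho>: "\<rho> \<in> mollifier1 q" and ab: "0 \<le> \<alpha>" "\<alpha> \<le> \<beta>"
    and pos: "\<And>\<xi>. \<xi> \<in> {\<alpha>..\<beta>} \<Longrightarrow> 0 \<le> T + a * arrival \<rho> \<xi>"
    and bd: "\<And>\<xi>. \<xi> \<in> {\<alpha>..\<beta>} \<Longrightarrow> norm (partial orthant (0, 1) w (\<xi>, T + a * arrival \<rho> \<xi>) +
      of_real a * (speed_net \<rho> \<xi> * partial orthant (1, 0) w (\<xi>, T + a * arrival \<rho> \<xi>))) \<le> B"
    and a: "a\<^sup>2 = 1"
  shows "norm (w (\<beta>, T + a * arrival \<rho> \<beta>) - w (\<alpha>, T + a * arrival \<rho> \<alpha>)) \<le> max_slow * B * (\<beta> - \<alpha>)"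
proof -
  let ?g = "\<lambda>\<xi>. (\<xi>, T + a * arrival \<rho> \<xi>)"
  let ?wx = "\<lambda>\<xi>. partial orthant (1, 0) w (?g \<xi>)" and ?wt = "\<lambda>\<xi>. partial orthant (0, 1) w (?g \<xi>)"
  have "norm (w (?g \<beta>) - w (?g \<alpha>)) \<le> max_slow * B * norm (\<beta> - \<alpha>)"
  proof (rule differentiable_bound[where S = "{\<alpha>..\<beta>}" and f = "\<lambda>\<xi>. w (?g \<xi>)" and
        f' = "\<lambda>\<xi> h. h *\<^sub>R ?wx \<xi> + (a * (slowness \<rho> \<xi> * h)) *\<^sub>R ?wt \<xi>"])
    fix \<xi> assume \<xi>: "\<xi> \<in> {\<alpha>..\<beta>}"
    have "(arrival \<rho> has_derivative (\<lambda>h. slowness \<rho> \<xi> * h)) (at \<xi> within {\<alpha>..\<beta>})"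
      using DERIV_arrival[OF \<rho>, of \<xi>] unfolding has_field_derivative_def by (rule has_derivative_at_withinI)
    then have g: "(?g has_derivative (\<lambda>h. (h, a * (slowness \<rho> \<xi> * h)))) (at \<xi> within {\<alpha>..\<beta>})"
      by (auto intro!: derivative_eq_intros)
    have "?g ` {\<alpha>..\<beta>} \<subseteq> orthant" using ab pos by (auto simp: orthant_prod)
    then have "(w has_derivative (\<lambda>h. fst h *\<^sub>R ?wx \<xi> + snd h *\<^sub>R ?wt \<xi>)) (at (?g \<xi>) within ?g ` {\<alpha>..\<beta>})"
      using smooth_on_has_derivative_quadrant[OF w, of \<xi> "T + a * arrival \<rho> \<xi>"] \<xi> ab(1) pos
      by (auto intro: has_derivative_subset)
    from has_derivative_in_compose[OF g this]
    show "((\<lambda>\<xi>. w (?g \<xi>)) has_derivative (\<lambda>h. h *\<^sub>R ?wx \<xi> + (a * (slowness \<rho> \<xi> * h)) *\<^sub>R ?wt \<xi>)) (at \<xi> within {\<alpha>..\<beta>})"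
      by simp
    have B: "0 \<le> B" by (rule order_trans[OF norm_ge_zero bd[OF \<xi>]])
    let ?n = "?wt \<xi> + of_real a * (speed_net \<rho> \<xi> * ?wx \<xi>)"
    have eq: "h *\<^sub>R ?wx \<xi> + (a * (slowness \<rho> \<xi> * h)) *\<^sub>R ?wt \<xi> = of_real (h * a * slowness \<rho> \<xi>) * ?n" for h
    proof -
      have "of_real (h * a * slowness \<rho> \<xi>) * ?n = of_real (h * a * slowness \<rho> \<xi>) * ?wt \<xi> +
          of_real h * of_real (a\<^sup>2) * (slow_net \<rho> \<xi> * speed_net \<rho> \<xi>) * ?wx \<xi>"
        by (simp add: slow_net_def power2_eq_square distrib_left mult_ac)
      then show ?thesis using a by (simp add: slow_speed_net scaleR_conv_of_real mult_ac)
    qed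
    have "\<bar>a\<bar> = 1" using a by (auto simp: power2_eq_1_iff)
    show "onorm (\<lambda>h. h *\<^sub>R ?wx \<xi> + (a * (slowness \<rho> \<xi> * h)) *\<^sub>R ?wt \<xi>) \<le> max_slow * B"
    proof (rule onorm_bound)
      fix h :: real
      have "norm (of_real (h * a * slowness \<rho> \<xi>) * ?n) = \<bar>h\<bar> * (slowness \<rho> \<xi> * norm ?n)"
        unfolding norm_mult[of "of_real (h * a * slowness \<rho> \<xi>)"] norm_of_real abs_mult using \<open>\<bar>a\<bar> = 1\<close> slowness_pos[of \<rho> \<xi>] by simp
      also have "\<dots> \<le> \<bar>h\<bar> * (max_slow * B)"
        using bd[OF \<xi>] slowness_bounds[of \<rho> \<xi>] slowness_pos[of \<rho> \<xi>] max_slow_pos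
        by (intro mult_left_mono mult_mono) auto
      finally show "norm (h *\<^sub>R ?wx \<xi> + (a * (slowness \<rho> \<xi> * h)) *\<^sub>R ?wt \<xi>) \<le> max_slow * B * norm h"
        unfolding eq by (simp add: mult.commute)
    qed (use B max_slow_pos in auto)
  qed (use ab in auto)
  then show ?thesis using ab by simp
qed

text \<open>The function \<open>v\<close> comes first: its characteristics lead back to the initial
  line, which costs the initial value and one integration. Those of \<open>u\<close> lead back to
  the initial line or to x = 0; there \<open>bdry\<close> and the bound for \<open>v\<close> are
  added to a second integration, whence \<open>2 + 2 * (max_slow * R)\<close>. The conditions on
  \<open>R\<close> keep times and positions along these curves below \<open>R\<close>.\<close>

lemma a_priori_bound:
  assumes u: "smooth_on orthant u" and v: "smooth_on orthant v" and \<rho>: "\<rho> \<in> mollifier1 q"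
    and R: "R\<^sub>0 + max_slow * R\<^sub>0 \<le> R" "R\<^sub>0 + max_slow * R\<^sub>0 \<le> min_slow * R"
    and eq_u: "\<And>x t. 0 \<le> x \<Longrightarrow> x \<le> R \<Longrightarrow> 0 \<le> t \<Longrightarrow> t \<le> R \<Longrightarrow>
      norm (partial orthant (0, 1) u (x, t) + speed_net \<rho> x * partial orthant (1, 0) u (x, t)) \<le> B"
    and eq_v: "\<And>x t. 0 \<le> x \<Longrightarrow> x \<le> R \<Longrightarrow> 0 \<le> t \<Longrightarrow> t \<le> R \<Longrightarrow>
      norm (partial orthant (0, 1) v (x, t) - speed_net \<rho> x * partial orthant (1, 0) v (x, t)) \<le> B"
    and init: "\<And>x. 0 \<le> x \<Longrightarrow> x \<le> R \<Longrightarrow> norm (u (x, 0)) \<le> B"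
      "\<And>x. 0 \<le> x \<Longrightarrow> x \<le> R \<Longrightarrow> norm (v (x, 0)) \<le> B"
    and bdry: "\<And>t. 0 \<le> t \<Longrightarrow> t \<le> R \<Longrightarrow> norm (u (0, t) - v (0, t)) \<le> B"
    and xt: "0 \<le> x" "x \<le> R\<^sub>0" "0 \<le> t" "t \<le> R\<^sub>0"
  shows "norm (v (x, t)) \<le> (1 + max_slow * R) * B" "norm (u (x, t)) \<le> (2 + 2 * (max_slow * R)) * B"
proof -
  have R0: "0 \<le> R\<^sub>0" using xt by linarith
  then have "0 \<le> max_slow * R\<^sub>0" using max_slow_pos by simp
  then have R0: "0 \<le> R\<^sub>0" "R\<^sub>0 \<le> R" using R(1) R0 by linarith+
  have B: "0 \<le> B" using init(1)[of 0] R0 norm_ge_zero[of "u (0, 0)"] by linarith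
  have cont: "continuous_on S (arrival \<rho>)" for S
    using DERIV_arrival[OF \<rho>] by (intro continuous_at_imp_continuous_on) (auto intro: DERIV_isCont)
  have mono: "arrival \<rho> a \<le> arrival \<rho> b" if "a \<le> b" for a b
    using arrival_diff_bounds(1)[OF \<rho> that] min_slow_pos that
    by (metis diff_ge_0_iff_ge less_imp_le mult_nonneg_nonneg order_trans)
  have Yub: "0 \<le> arrival \<rho> a" "arrival \<rho> a \<le> max_slow * a" if "0 \<le> a" for a
    using arrival_diff_bounds(2)[OF \<rho> that] mono[OF that] by auto
  have YR: "R\<^sub>0 + max_slow * R\<^sub>0 \<le> arrival \<rho> R"
    using arrival_diff_bounds(1)[OF \<rho>, of 0 R] R R0 by simp
  have step: "max_slow * B * (\<beta> - \<alpha>) \<le> max_slow * R * B" if "0 \<le> \<alpha>" "\<beta> \<le> R" for \<alpha> \<beta>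
    using mult_left_mono[of "\<beta> - \<alpha>" R "max_slow * B"] that B max_slow_pos by (simp add: mult_ac)
  \<comment> \<open>Stated for all points of the box, because the boundary case for \<open>u\<close>
    needs \<open>v\<close> at \<open>(0, ?T)\<close>.\<close>
  have v_bound: "norm (v (x, t)) \<le> (1 + max_slow * R) * B"
    if xt: "0 \<le> x" "x \<le> R\<^sub>0" "0 \<le> t" "t \<le> R\<^sub>0" for x t
  proof -
    let ?T = "t + arrival \<rho> x"
    have TR: "?T \<le> R\<^sub>0 + max_slow * R\<^sub>0"
      using Yub(2)[OF xt(1)] xt mult_left_mono[OF xt(2), of max_slow] max_slow_pos by linarith
    \<comment> \<open>The characteristic of \<open>v\<close> reaches time 0 at \<xi>; the second
      condition on \<open>R\<close> keeps this point in the range of the hypotheses.\<close>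
    then obtain \<xi> where \<xi>: "x \<le> \<xi>" "\<xi> \<le> R" "arrival \<rho> \<xi> = ?T"
      using IVT'[of "arrival \<rho>" x ?T R] cont xt R0 YR by auto
    have "norm (v (\<xi>, ?T + (-1) * arrival \<rho> \<xi>) - v (x, ?T + (-1) * arrival \<rho> x)) \<le> max_slow * B * (\<xi> - x)"
    proof (rule characteristic_bound[OF v \<rho> xt(1) \<xi>(1)])
      fix z assume z: "z \<in> {x..\<xi>}"
      show pos: "0 \<le> ?T + (-1) * arrival \<rho> z" using mono[of z \<xi>] z \<xi>(3) by simp
      have "?T + (-1) * arrival \<rho> z \<le> R" using mono[of x z] z xt Yub(1)[of z] TR R by simp
      then show "norm (partial orthant (0, 1) v (z, ?T + (-1) * arrival \<rho> z) +
          of_real (-1) * (speed_net \<rho> z * partial orthant (1, 0) v (z, ?T + (-1) * arrival \<rho> z))) \<le> B"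
        using eq_v[of z "?T + (-1) * arrival \<rho> z"] pos z xt \<xi>(2) by simp
    qed simp
    then have "norm (v (\<xi>, 0) - v (x, t)) \<le> max_slow * R * B"
      using step[of x \<xi>] xt \<xi> by simp
    then have "norm (v (x, t)) \<le> norm (v (\<xi>, 0)) + max_slow * R * B"
      using norm_triangle_ineq2[of "v (x, t)" "v (\<xi>, 0)"] by (simp add: norm_minus_commute)
    then show ?thesis using init(2)[of \<xi>] xt \<xi> by (simp add: algebra_simps)
  qed
  show "norm (v (x, t)) \<le> (1 + max_slow * R) * B" by (rule v_bound[OF xt])
  let ?T = "t - arrival \<rho> x"
  have u_step: "norm (u (x, t)) \<le> norm (u (\<xi>, ?T + arrival \<rho> \<xi>)) + max_slow * R * B"
    if \<xi>: "0 \<le> \<xi>" "\<xi> \<le> x" "0 \<le> ?T + arrival \<rho> \<xi>" for \<xi>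
  proof -
    have "norm (u (x, ?T + 1 * arrival \<rho> x) - u (\<xi>, ?T + 1 * arrival \<rho> \<xi>)) \<le> max_slow * B * (x - \<xi>)"
    proof (rule characteristic_bound[OF u \<rho> \<xi>(1,2)])
      fix z assume z: "z \<in> {\<xi>..x}"
      show pos: "0 \<le> ?T + 1 * arrival \<rho> z" using mono[of \<xi> z] z \<xi>(3) by simp
      have "?T + 1 * arrival \<rho> z \<le> R" using mono[of z x] z xt R0 by simp
      then show "norm (partial orthant (0, 1) u (z, ?T + 1 * arrival \<rho> z) +
          of_real 1 * (speed_net \<rho> z * partial orthant (1, 0) u (z, ?T + 1 * arrival \<rho> z))) \<le> B"
        using eq_u[of z "?T + 1 * arrival \<rho> z"] pos z xt \<xi> R0 by simp
    qed simp
    then have "norm (u (x, t) - u (\<xi>, ?T + arrival \<rho> \<xi>)) \<le> max_slow * R * B"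
      using step[of \<xi> x] xt \<xi> R0 by simp
    then show ?thesis
      using norm_triangle_ineq2[of "u (x, t)" "u (\<xi>, ?T + arrival \<rho> \<xi>)"] by simp
  qed
  have RB: "0 \<le> max_slow * R * B" using max_slow_pos R0 B by simp
  show "norm (u (x, t)) \<le> (2 + 2 * (max_slow * R)) * B"
  proof (cases "0 \<le> ?T")
    case True
    have T: "?T \<le> R\<^sub>0" using Yub(1)[OF xt(1)] xt by simp
    have "norm (u (0, ?T)) \<le> norm (u (0, ?T) - v (0, ?T)) + norm (v (0, ?T))"
      using norm_triangle_ineq[of "u (0, ?T) - v (0, ?T)" "v (0, ?T)"] by simp
    then show ?thesis
      using u_step[of 0] bdry[of ?T] v_bound[of 0 ?T] True xt R0 T by (simp add: algebra_simps)
  next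
    case False
    then obtain \<xi> where \<xi>: "0 \<le> \<xi>" "\<xi> \<le> x" "arrival \<rho> \<xi> = - ?T"
      using IVT'[of "arrival \<rho>" 0 "- ?T" x] cont xt by auto
    then show ?thesis
      using u_step[of \<xi>] init(1)[of \<xi>] xt R0 B RB by (simp add: algebra_simps)
  qed
qed

end

section \<open>Uniqueness\<close>

lemma null_net_embed:
  fixes j :: "real \<Rightarrow> real \<times> real"
  assumes "linear j" "\<And>x. j x \<in> orthant \<longleftrightarrow> x \<in> orthant" "j 1 \<in> Basis" "null_net w"
  shows "null_net (\<lambda>\<rho> x. w (tensor_power \<rho>) (j x))"
proof -
  have "colombeau_rel w (\<lambda>\<phi> x. 0)"
    using assms(4) by (simp add: colombeau_rel_def moderate_zero null_net_imp_moderate)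
  from colombeau_rel_embed[OF assms(1-3) this] show ?thesis by (simp add: colombeau_rel_def)
qed

lemma embed_x: "linear (\<lambda>x. (x, 0::real))" "\<And>x. (x, 0::real) \<in> orthant \<longleftrightarrow> x \<in> (orthant :: real set)"
    "(1, 0) \<in> (Basis :: (real \<times> real) set)"
  and embed_t: "linear (\<lambda>t. (0::real, t))" "\<And>t. (0::real, t) \<in> orthant \<longleftrightarrow> t \<in> (orthant :: real set)"
    "(0, 1) \<in> (Basis :: (real \<times> real) set)"
  by (auto simp: linear_iff orthant_prod orthant_real Basis_real_real)

text \<open>The loss \<open>M\<close> may exceed \<open>N\<close>, so that several nets can share
  one index.\<close>

lemma null_net_bound_Nil:
  assumes "null_net w" "compact K" "K \<subseteq> orthant"
  obtains N where "1 \<le> N" "\<And>q M \<phi>. N \<le> M \<Longrightarrow> M \<le> q \<Longrightarrow> \<phi> \<in> mollifier q \<Longrightarrow>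
    \<exists>C>0. \<forall>\<^sub>F \<epsilon> in at_right 0. \<forall>x\<in>K. norm (w (rescale \<epsilon> \<phi>) x) \<le> C * \<epsilon> powr (real q - real M)"
proof -
  have "net_bound null_exponent w K []" using assms by (simp add: null_net_iff)
  then obtain N where N: "N \<ge> 1"
    "\<And>q \<phi>. q \<ge> N \<Longrightarrow> \<phi> \<in> mollifier q \<Longrightarrow> estimate w \<phi> K [] (real q - real N)"
    unfolding net_bound_def by blast
  have "estimate w \<phi> K [] (real q - real M)" if "N \<le> M" "M \<le> q" "\<phi> \<in> mollifier q" for q M \<phi>
    by (rule estimate_weaken[OF N(2)[of q]]) (use that in auto)
  then show ?thesis
    using N(1) by (intro that[of N]) (simp_all add: estimate_eventually)
qed

context two_speeds
begin

definition transport :: "real \<Rightarrow> (real \<times> real) net \<Rightarrow> (real \<times> real) net" where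
  "transport a u \<phi> p = partial orthant (0, 1) (u \<phi>) p +
     of_real a * (speed_net (tensor_base \<phi>) (fst p) * partial orthant (1, 0) (u \<phi>) p)"

text \<open>The homogeneous problem for representatives, satisfied by the difference of two
  solutions. Representatives, unlike classes, can be followed along characteristics.\<close>

definition null_solution :: "(real \<times> real) net \<Rightarrow> (real \<times> real) net \<Rightarrow> bool" where
  "null_solution u v \<longleftrightarrow> moderate u \<and> moderate v \<and>
     null_net (transport 1 u) \<and> null_net (transport (-1) v) \<and>
     null_net (\<lambda>\<rho> x::real. u (tensor_power \<rho>) (x, 0)) \<and>
     null_net (\<lambda>\<rho> x::real. v (tensor_power \<rho>) (x, 0)) \<and>
     null_net (\<lambda>\<rho> t::real. u (tensor_power \<rho>) (0, t) - v (tensor_power \<rho>) (0, t))"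

lemma null_solution_net_bound_Nil:
  assumes sol: "null_solution u v" and K: "compact K" "K \<subseteq> orthant"
  shows "net_bound null_exponent u K []" "net_bound null_exponent v K []"
proof -
  obtain R\<^sub>0 where R0: "0 < R\<^sub>0" "\<And>p. p \<in> K \<Longrightarrow> norm p \<le> R\<^sub>0"
    using compact_imp_bounded[OF K(1)] by (auto simp: bounded_pos)
  have pK: "0 \<le> fst p" "fst p \<le> R\<^sub>0" "0 \<le> snd p" "snd p \<le> R\<^sub>0" if "p \<in> K" for p
    using R0(2)[OF that] norm_fst_le[of "fst p" "snd p"] norm_snd_le[of "snd p" "fst p"] K(2) that
    by (auto simp: orthant_prod)
  \<comment> \<open>The least \<open>R\<close> that meets both conditions of
    \<open>a_priori_bound\<close>, so that one square contains the domain of dependence of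
    \<open>K\<close>.\<close>
  define R where "R = max (R\<^sub>0 + max_slow * R\<^sub>0) ((R\<^sub>0 + max_slow * R\<^sub>0) / min_slow)"
  have R: "R\<^sub>0 + max_slow * R\<^sub>0 \<le> R" "R\<^sub>0 + max_slow * R\<^sub>0 \<le> min_slow * R"
  proof -
    show "R\<^sub>0 + max_slow * R\<^sub>0 \<le> R" by (simp add: R_def)
    have "min_slow * ((R\<^sub>0 + max_slow * R\<^sub>0) / min_slow) \<le> min_slow * R"
      using min_slow_pos by (intro mult_left_mono) (auto simp: R_def)
    then show "R\<^sub>0 + max_slow * R\<^sub>0 \<le> min_slow * R" using min_slow_pos by simp
  qed
  let ?Q = "{0..R} \<times> {0..R}" and ?I = "{0..R}"
  have Q: "compact ?Q" "?Q \<subseteq> orthant" "compact ?I" "?I \<subseteq> orthant"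
    by (auto simp: orthant_prod orthant_real intro: compact_Times)
  have n: "null_net (transport 1 u)" "null_net (transport (-1) v)"
    "null_net (\<lambda>\<rho> x::real. u (tensor_power \<rho>) (x, 0))" "null_net (\<lambda>\<rho> x::real. v (tensor_power \<rho>) (x, 0))"
    "null_net (\<lambda>\<rho> t::real. u (tensor_power \<rho>) (0, t) - v (tensor_power \<rho>) (0, t))"
    and smooth: "smooth_net u" "smooth_net v"
    using sol by (simp_all add: null_solution_def moderate_def)
  obtain N1 where N1: "1 \<le> N1" "\<And>q M \<phi>. N1 \<le> M \<Longrightarrow> M \<le> q \<Longrightarrow> \<phi> \<in> mollifier q \<Longrightarrow>
    \<exists>C>0. \<forall>\<^sub>F \<epsilon> in at_right 0. \<forall>x\<in>?Q. norm (transport 1 u (rescale \<epsilon> \<phi>) x) \<le> C * \<epsilon> powr (real q - real M)"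
    using null_net_bound_Nil[OF n(1) Q(1,2)] by blast
  obtain N2 where N2: "1 \<le> N2" "\<And>q M \<phi>. N2 \<le> M \<Longrightarrow> M \<le> q \<Longrightarrow> \<phi> \<in> mollifier q \<Longrightarrow>
    \<exists>C>0. \<forall>\<^sub>F \<epsilon> in at_right 0. \<forall>x\<in>?Q. norm (transport (-1) v (rescale \<epsilon> \<phi>) x) \<le> C * \<epsilon> powr (real q - real M)"
    using null_net_bound_Nil[OF n(2) Q(1,2)] by blast
  obtain N3 where N3: "1 \<le> N3" "\<And>q M \<rho>. N3 \<le> M \<Longrightarrow> M \<le> q \<Longrightarrow> \<rho> \<in> mollifier q \<Longrightarrow>
    \<exists>C>0. \<forall>\<^sub>F \<epsilon> in at_right 0. \<forall>x\<in>?I. norm (u (tensor_power (rescale \<epsilon> \<rho>)) (x, 0)) \<le> C * \<epsilon> powr (real q - real M)"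
    using null_net_bound_Nil[OF n(3) Q(3,4)] by blast
  obtain N4 where N4: "1 \<le> N4" "\<And>q M \<rho>. N4 \<le> M \<Longrightarrow> M \<le> q \<Longrightarrow> \<rho> \<in> mollifier q \<Longrightarrow>
    \<exists>C>0. \<forall>\<^sub>F \<epsilon> in at_right 0. \<forall>x\<in>?I. norm (v (tensor_power (rescale \<epsilon> \<rho>)) (x, 0)) \<le> C * \<epsilon> powr (real q - real M)"
    using null_net_bound_Nil[OF n(4) Q(3,4)] by blast
  obtain N5 where N5: "1 \<le> N5" "\<And>q M \<rho>. N5 \<le> M \<Longrightarrow> M \<le> q \<Longrightarrow> \<rho> \<in> mollifier q \<Longrightarrow>
    \<exists>C>0. \<forall>\<^sub>F \<epsilon> in at_right 0. \<forall>t\<in>?I. norm (u (tensor_power (rescale \<epsilon> \<rho>)) (0, t) -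
      v (tensor_power (rescale \<epsilon> \<rho>)) (0, t)) \<le> C * \<epsilon> powr (real q - real M)"
    using null_net_bound_Nil[OF n(5) Q(3,4)] by blast
  \<comment> \<open>The sum is at least each of the five indices, so all five nets share the
    exponent \<open>q - N\<close>.\<close>
  define N where "N = N1 + N2 + N3 + N4 + N5"
  have "estimate u \<phi> K [] (real q - real N) \<and> estimate v \<phi> K [] (real q - real N)"
    if q: "N \<le> q" and \<phi>: "\<phi> \<in> mollifier q" for q and \<phi> :: "real \<times> real \<Rightarrow> complex"
  proof -
    obtain \<rho> where \<rho>: "\<rho> \<in> mollifier1 q" "\<phi> = tensor_power \<rho>"
      using \<phi> by (rule mollifier_prod_power)
    have \<rho>1: "\<rho> \<in> mollifier1 1" "\<rho> \<in> mollifier q" and \<phi>1: "\<phi> \<in> mollifier 1"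
      using \<rho> \<phi> q N1(1) mollifier1_mono[of 1 q] mollifier_mono[of 1 q] by (auto simp: N_def mollifier_real)
    let ?s = "real q - real N"
    obtain C1 where C1: "0 < C1" "\<forall>\<^sub>F \<epsilon> in at_right 0. \<forall>x\<in>?Q. norm (transport 1 u (rescale \<epsilon> \<phi>) x) \<le> C1 * \<epsilon> powr ?s"
      using N1(2)[OF _ q \<phi>] by (auto simp: N_def)
    obtain C2 where C2: "0 < C2" "\<forall>\<^sub>F \<epsilon> in at_right 0. \<forall>x\<in>?Q. norm (transport (-1) v (rescale \<epsilon> \<phi>) x) \<le> C2 * \<epsilon> powr ?s"
      using N2(2)[OF _ q \<phi>] by (auto simp: N_def)
    obtain C3 where C3: "0 < C3" "\<forall>\<^sub>F \<epsilon> in at_right 0. \<forall>x\<in>?I. norm (u (tensor_power (rescale \<epsilon> \<rho>)) (x, 0)) \<le> C3 * \<epsilon> powr ?s"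
      using N3(2)[OF _ q \<rho>1(2)] by (auto simp: N_def)
    obtain C4 where C4: "0 < C4" "\<forall>\<^sub>F \<epsilon> in at_right 0. \<forall>x\<in>?I. norm (v (tensor_power (rescale \<epsilon> \<rho>)) (x, 0)) \<le> C4 * \<epsilon> powr ?s"
      using N4(2)[OF _ q \<rho>1(2)] by (auto simp: N_def)
    obtain C5 where C5: "0 < C5" "\<forall>\<^sub>F \<epsilon> in at_right 0. \<forall>t\<in>?I. norm (u (tensor_power (rescale \<epsilon> \<rho>)) (0, t) -
        v (tensor_power (rescale \<epsilon> \<rho>)) (0, t)) \<le> C5 * \<epsilon> powr ?s"
      using N5(2)[OF _ q \<rho>1(2)] by (auto simp: N_def)
    define C where "C = C1 + C2 + C3 + C4 + C5"
    have le: "b \<le> C * \<epsilon> powr ?s" if "b \<le> D * \<epsilon> powr ?s" "D \<in> {C1, C2, C3, C4, C5}" for b D \<epsilon>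
      using that C1(1) C2(1) C3(1) C4(1) C5(1)
      by (intro order_trans[OF that(1)] mult_right_mono) (auto simp: C_def)
    have "\<forall>\<^sub>F \<epsilon> in at_right 0. \<forall>p\<in>K. norm (v (rescale \<epsilon> \<phi>) p) \<le> (1 + max_slow * R) * (C * \<epsilon> powr ?s) \<and>
        norm (u (rescale \<epsilon> \<phi>) p) \<le> (2 + 2 * (max_slow * R)) * (C * \<epsilon> powr ?s)"
      using C1(2) C2(2) C3(2) C4(2) C5(2) eventually_at_right_less[of "0::real"]
    proof eventually_elim
      case (elim \<epsilon>)
      have sm: "smooth_on orthant (u (rescale \<epsilon> \<phi>))" "smooth_on orthant (v (rescale \<epsilon> \<phi>))"
        using smooth \<phi>1 elim(6) by (simp_all add: smooth_net_rescale)
      \<comment> \<open>The transport nets are indexed by mollifiers of the plane, the initial and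
        boundary nets by those of the line; these two identities match them.\<close>
      have tb: "tensor_base (rescale \<epsilon> \<phi>) = rescale \<epsilon> \<rho>" and tp: "tensor_power (rescale \<epsilon> \<rho>) = rescale \<epsilon> \<phi>"
        unfolding \<rho>(2) using tensor_base_rescale[OF \<rho>1(1) elim(6)] by (simp_all add: rescale_tensor_power)
      have m: "rescale \<epsilon> \<rho> \<in> mollifier1 1" using \<rho>1(1) elim(6) by (rule mollifier1_rescale)
      show ?case
      proof
        fix p assume p: "p \<in> K"
        have b: "norm (partial orthant (0, 1) (u (rescale \<epsilon> \<phi>)) (x, t) +
             speed_net (rescale \<epsilon> \<rho>) x * partial orthant (1, 0) (u (rescale \<epsilon> \<phi>)) (x, t)) \<le> C * \<epsilon> powr ?s"
          "norm (partial orthant (0, 1) (v (rescale \<epsilon> \<phi>)) (x, t) -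
             speed_net (rescale \<epsilon> \<rho>) x * partial orthant (1, 0) (v (rescale \<epsilon> \<phi>)) (x, t)) \<le> C * \<epsilon> powr ?s"
          "norm (u (rescale \<epsilon> \<phi>) (x, 0)) \<le> C * \<epsilon> powr ?s" "norm (v (rescale \<epsilon> \<phi>) (x, 0)) \<le> C * \<epsilon> powr ?s"
          "norm (u (rescale \<epsilon> \<phi>) (0, t) - v (rescale \<epsilon> \<phi>) (0, t)) \<le> C * \<epsilon> powr ?s"
          if "0 \<le> x" "x \<le> R" "0 \<le> t" "t \<le> R" for x t
        proof -
          have Qxt: "(x, t) \<in> ?Q" "x \<in> ?I" "t \<in> ?I" using that by auto
          show "norm (partial orthant (0, 1) (u (rescale \<epsilon> \<phi>)) (x, t) +
             speed_net (rescale \<epsilon> \<rho>) x * partial orthant (1, 0) (u (rescale \<epsilon> \<phi>)) (x, t)) \<le> C * \<epsilon> powr ?s"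
            using le[OF bspec[OF elim(1) Qxt(1)]] by (simp add: transport_def tb)
          show "norm (partial orthant (0, 1) (v (rescale \<epsilon> \<phi>)) (x, t) -
             speed_net (rescale \<epsilon> \<rho>) x * partial orthant (1, 0) (v (rescale \<epsilon> \<phi>)) (x, t)) \<le> C * \<epsilon> powr ?s"
            using le[OF bspec[OF elim(2) Qxt(1)]] by (simp add: transport_def tb)
          show "norm (u (rescale \<epsilon> \<phi>) (x, 0)) \<le> C * \<epsilon> powr ?s"
            using le[OF bspec[OF elim(3) Qxt(2)]] by (simp add: tp)
          show "norm (v (rescale \<epsilon> \<phi>) (x, 0)) \<le> C * \<epsilon> powr ?s"
            using le[OF bspec[OF elim(4) Qxt(2)]] by (simp add: tp)
          show "norm (u (rescale \<epsilon> \<phi>) (0, t) - v (rescale \<epsilon> \<phi>) (0, t)) \<le> C * \<epsilon> powr ?s"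
            using le[OF bspec[OF elim(5) Qxt(3)]] by (simp add: tp)
        qed
        have "0 \<le> R" using pK[OF p] R R0(1) max_slow_pos by (smt (verit) mult_nonneg_nonneg)
        then have z: "(0::real) \<le> 0" "0 \<le> R" by auto
        note ap = a_priori_bound[OF sm m R b(1) b(2) b(3)[OF _ _ z] b(4)[OF _ _ z] b(5)[OF z] pK[OF p]]
        show "norm (v (rescale \<epsilon> \<phi>) p) \<le> (1 + max_slow * R) * (C * \<epsilon> powr ?s) \<and>
          norm (u (rescale \<epsilon> \<phi>) p) \<le> (2 + 2 * (max_slow * R)) * (C * \<epsilon> powr ?s)"
          using ap by simp
      qed
    qed
    note ev = this
    have "0 \<le> R" using R R0(1) max_slow_pos by (smt (verit) mult_nonneg_nonneg)
    then have L: "0 < (1 + max_slow * R) * C" "0 < (2 + 2 * (max_slow * R)) * C"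
      using C1(1) C2(1) C3(1) C4(1) C5(1) max_slow_pos by (auto simp: C_def intro!: mult_pos_pos add_pos_nonneg)
    have "estimate u \<phi> K [] ?s"
      unfolding estimate_eventually using L(2) eventually_mono[OF ev]
      by (intro exI[of _ "(2 + 2 * (max_slow * R)) * C"]) (simp add: mult.assoc)
    moreover have "estimate v \<phi> K [] ?s"
      unfolding estimate_eventually using L(1) eventually_mono[OF ev]
      by (intro exI[of _ "(1 + max_slow * R) * C"]) (simp add: mult.assoc)
    ultimately show ?thesis ..
  qed
  moreover have "1 \<le> N" using N1(1) by (simp add: N_def)
  ultimately show "net_bound null_exponent u K []" "net_bound null_exponent v K []"
    unfolding net_bound_def by blast+
qed

lemma smooth_net_tensor_power:
  fixes u :: "(real \<times> real) net"
  assumes "moderate u" "\<rho> \<in> mollifier 1"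
  shows "smooth_on orthant (u (tensor_power \<rho>))"
proof -
  have "(tensor_power \<rho> :: real \<times> real \<Rightarrow> complex) \<in> mollifier 1"
    using assms(2) by (rule mollifier_tensor_power)
  then show ?thesis using assms(1) by (simp add: moderate_def smooth_net_def)
qed

lemma smooth_speed_fst:
  fixes \<phi> :: "real \<times> real \<Rightarrow> complex"
  assumes "\<phi> \<in> mollifier 1"
  shows "smooth_on orthant (\<lambda>p::real \<times> real. speed_net (tensor_base \<phi>) (fst p))"
  using moderate_of_space[OF moderate_speed_net] assms by (simp add: moderate_def smooth_net_def)

lemma partial_t_speed:
  fixes \<phi> :: "real \<times> real \<Rightarrow> complex"
  assumes "\<phi> \<in> mollifier 1" "p \<in> orthant"
  shows "partial orthant (0, 1) (\<lambda>p::real \<times> real. speed_net (tensor_base \<phi>) (fst p)) p = 0"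
proof -
  obtain \<rho> where "\<rho> \<in> mollifier1 1" "tensor_base \<phi> = \<rho>"
    using assms(1) by (rule mollifier_prodE)
  then have "smooth_on orthant (speed_net (tensor_base \<phi>))"
    using moderate_speed_net by (simp add: moderate_def smooth_net_def mollifier_real)
  then show ?thesis
    using assms(2) by (intro partial_orthantI has_vd_fst) (auto simp: Basis_real_real)
qed

text \<open>The speed depends on x only and mixed derivatives commute, so the t-derivative passes
  through the operator exactly.\<close>

lemma partial_t_transport:
  assumes u: "smooth_net u" and \<phi>: "\<phi> \<in> mollifier 1" and p: "p \<in> orthant"
  shows "partial orthant (0, 1) (transport a u \<phi>) p = transport a (\<lambda>\<phi>. partial orthant (0, 1) (u \<phi>)) \<phi> p"
proof -
  let ?c = "\<lambda>p::real \<times> real. speed_net (tensor_base \<phi>) (fst p)"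
  let ?ux = "partial orthant (1, 0) (u \<phi>)" and ?ut = "partial orthant (0, 1) (u \<phi>)"
  have s: "smooth_on orthant (u \<phi>)" using u \<phi> by (simp add: smooth_net_def)
  have B: "(1, 0) \<in> (Basis :: (real \<times> real) set)" "(0, 1) \<in> (Basis :: (real \<times> real) set)"
    by (simp_all add: Basis_real_real)
  have sx: "smooth_on orthant ?ux" and st: "smooth_on orthant ?ut"
    using s B by (simp_all add: smooth_on_partial)
  have eq: "transport a u \<phi> = (\<lambda>p. ?ut p + of_real a * (?c p * ?ux p))"
    by (intro ext) (simp add: transport_def)
  have "partial orthant (0, 1) (\<lambda>p. ?ut p + of_real a * (?c p * ?ux p)) p =
      partial orthant (0, 1) ?ut p + of_real a * partial orthant (0, 1) (\<lambda>p. ?c p * ?ux p) p"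
    using smooth_speed_fst[OF \<phi>] sx st B p
    by (intro partial_lincomb smooth_on_mult)
  also have "partial orthant (0, 1) (\<lambda>p. ?c p * ?ux p) p = ?c p * partial orthant (0, 1) ?ux p"
    using partial_mult[OF smooth_speed_fst[OF \<phi>] sx B(2) p] partial_t_speed[OF \<phi> p] by simp
  also have "partial orthant (0, 1) ?ux p = partial orthant (1, 0) ?ut p"
    using partial_commute[OF s p] by simp
  finally show ?thesis unfolding eq transport_def .
qed

text \<open>The t-derivative at time 0 is recovered from the equation: it is the residual minus
  \<open>a\<close> times the speed times the x-derivative of the initial value, and both terms are
  null.\<close>

lemma null_net_initial_partial_t:
  assumes u: "moderate u" and t: "null_net (transport a u)"
    and i: "null_net (\<lambda>\<rho> x::real. u (tensor_power \<rho>) (x, 0))"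
  shows "null_net (\<lambda>\<rho> x::real. partial orthant (0, 1) (u (tensor_power \<rho>)) (x, 0))"
proof -
  have "null_net (\<lambda>\<rho> x. speed_net \<rho> x * partial orthant 1 (\<lambda>x. u (tensor_power \<rho>) (x, 0)) x)"
    using null_net_mult[OF moderate_speed_net null_net_partial[OF i, of 1]] by simp
  from null_net_lincomb[OF null_net_embed[OF embed_x t] this, of "- of_real a"]
  have "null_net (\<lambda>\<rho> x::real. transport a u (tensor_power \<rho>) (x, 0) +
      - of_real a * (speed_net \<rho> x * partial orthant 1 (\<lambda>x. u (tensor_power \<rho>) (x, 0)) x))" .
  also have "?this \<longleftrightarrow> ?thesis"
  proof (rule null_net_cong)
    fix \<rho> :: "real \<Rightarrow> complex" and x :: real
    assume \<rho>: "\<rho> \<in> mollifier 1" and x: "x \<in> orthant"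
    have tb: "tensor_base (tensor_power \<rho> :: real \<times> real \<Rightarrow> complex) = \<rho>"
      using \<rho> by (intro tensor_base_tensor_power) (simp add: mollifier_real)
    have "smooth_on orthant (u (tensor_power \<rho>))" by (rule smooth_net_tensor_power[OF u \<rho>])
    then have "partial orthant 1 (\<lambda>x. u (tensor_power \<rho>) (x, 0)) x = partial orthant (1, 0) (u (tensor_power \<rho>)) (x, 0)"
      by (intro partial_orthantI[OF x] has_vd_embed[OF embed_x]) (use x in auto)
    then show "transport a u (tensor_power \<rho>) (x, 0) +
      - of_real a * (speed_net \<rho> x * partial orthant 1 (\<lambda>x. u (tensor_power \<rho>) (x, 0)) x) =
      partial orthant (0, 1) (u (tensor_power \<rho>)) (x, 0)"
      by (simp add: transport_def tb)
  qed
  finally show ?thesis .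
qed

lemma null_solution_partial_t:
  assumes "null_solution u v"
  shows "null_solution (\<lambda>\<phi>. partial orthant (0, 1) (u \<phi>)) (\<lambda>\<phi>. partial orthant (0, 1) (v \<phi>))"
proof -
  have B: "(0, 1) \<in> (Basis :: (real \<times> real) set)" by (simp add: Basis_real_real)
  have u: "moderate u" and v: "moderate v" and tu: "null_net (transport 1 u)" and tv: "null_net (transport (-1) v)"
    and iu: "null_net (\<lambda>\<rho> x::real. u (tensor_power \<rho>) (x, 0))"
    and iv: "null_net (\<lambda>\<rho> x::real. v (tensor_power \<rho>) (x, 0))"
    and b: "null_net (\<lambda>\<rho> t::real. u (tensor_power \<rho>) (0, t) - v (tensor_power \<rho>) (0, t))"
    using assms by (simp_all add: null_solution_def)
  have t: "null_net (transport a (\<lambda>\<phi>. partial orthant (0, 1) (w \<phi>)))" if "moderate w" "null_net (transport a w)" for a w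
  proof -
    have "null_net (\<lambda>\<phi>. partial orthant (0, 1) (transport a w \<phi>))"
      using that(2) B by (rule null_net_partial)
    also have "?this \<longleftrightarrow> null_net (transport a (\<lambda>\<phi>. partial orthant (0, 1) (w \<phi>)))"
      using that(1) by (intro null_net_cong partial_t_transport) (auto simp: moderate_def)
    finally show ?thesis .
  qed
  have "null_net (\<lambda>\<rho>. partial orthant 1 (\<lambda>t::real. u (tensor_power \<rho>) (0, t) - v (tensor_power \<rho>) (0, t)))"
    using b by (rule null_net_partial) simp
  also have "?this \<longleftrightarrow> null_net (\<lambda>\<rho> t::real. partial orthant (0, 1) (u (tensor_power \<rho>)) (0, t) -
      partial orthant (0, 1) (v (tensor_power \<rho>)) (0, t))"
  proof (rule null_net_cong)
    fix \<rho> :: "real \<Rightarrow> complex" and x :: real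
    assume \<rho>: "\<rho> \<in> mollifier 1" and x: "x \<in> orthant"
    have "smooth_on orthant (u (tensor_power \<rho>))" "smooth_on orthant (v (tensor_power \<rho>))"
      using u v \<rho> by (simp_all add: smooth_net_tensor_power)
    then show "partial orthant 1 (\<lambda>t. u (tensor_power \<rho>) (0, t) - v (tensor_power \<rho>) (0, t)) x =
       partial orthant (0, 1) (u (tensor_power \<rho>)) (0, x) - partial orthant (0, 1) (v (tensor_power \<rho>)) (0, x)"
      by (intro partial_orthantI[OF x] has_vector_derivative_diff has_vd_embed[OF embed_t]) (use x in auto)
  qed
  finally show ?thesis
    using u v B tu tv iu iv t null_net_initial_partial_t
    by (auto simp: null_solution_def intro: moderate_partial)
qed

text \<open>The induction ranges over all null solutions, since its hypothesis is applied to the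
  t-derivatives, which form a null solution again. An x-derivative is first exchanged for a
  t-derivative.\<close>

lemma null_solution_net_bound:
  assumes "null_solution u v" "compact K" "K \<subseteq> orthant" "set ds \<subseteq> Basis" "length ds \<le> n"
  shows "net_bound null_exponent u K ds \<and> net_bound null_exponent v K ds"
  using assms(1,4,5)
proof (induction n arbitrary: u v ds)
  case 0
  then show ?case using null_solution_net_bound_Nil[OF _ assms(2,3)] by simp
next
  case (Suc n)
  show ?case
  proof (cases ds)
    case Nil
    then show ?thesis using null_solution_net_bound_Nil[OF Suc.prems(1) assms(2,3)] by simp
  next
    case (Cons b ds')
    have ds': "set ds' \<subseteq> Basis" "length ds' \<le> n" and b: "b = (1, 0) \<or> b = (0, 1)"
      using Suc.prems Cons by (auto simp: Basis_real_real)
    note nt = null_solution_partial_t[OF Suc.prems(1)]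
    have B: "(0, 1) \<in> (Basis :: (real \<times> real) set)" "(1, 0) \<in> (Basis :: (real \<times> real) set)"
      by (simp_all add: Basis_real_real)
    show ?thesis
    proof (cases "b = (0, 1)")
      case True
      then show ?thesis
        using Suc.IH[OF nt ds'] by (simp add: Cons net_bound_partial)
    next
      case False
      let ?s = "\<lambda>\<phi> p::real \<times> real. slow_net (tensor_base \<phi>) (fst p)"
      have s: "moderate ?s" by (rule moderate_of_space[OF moderate_slow_net])
      have *: "net_bound null_exponent (\<lambda>\<phi>. partial orthant (1, 0) (w \<phi>)) K ds'"
        if w: "moderate w" "null_net (transport a w)" "a\<^sup>2 = 1"
          and IH: "\<And>ds. set ds \<subseteq> Basis \<Longrightarrow> length ds \<le> n \<Longrightarrow>
            net_bound null_exponent (\<lambda>\<phi>. partial orthant (0, 1) (w \<phi>)) K ds" for a w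
      proof -
        let ?as = "\<lambda>\<phi> p. of_real a * ?s \<phi> p"
        have as: "moderate ?as" by (rule moderate_mult[OF moderate_const s])
        then have as': "smooth_net ?as" "\<And>ds. set ds \<subseteq> Basis \<Longrightarrow> net_bound mod_exponent ?as K ds"
          using assms(2,3) by (simp_all add: moderate_iff)
        have sw: "smooth_net (\<lambda>\<phi>. partial orthant (0, 1) (w \<phi>))"
          using w(1) B by (intro smooth_net_partial) (simp_all add: moderate_def)
        have "net_bound null_exponent (\<lambda>\<phi> p. ?as \<phi> p * transport a w \<phi> p) K ds'"
          using null_net_mult[OF as w(2)] assms(2,3) ds'(1) by (simp add: null_net_iff)
        moreover have "net_bound null_exponent (\<lambda>\<phi> p. ?as \<phi> p * partial orthant (0, 1) (w \<phi>) p) K ds'"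
          by (rule net_bound_mult_upto[where n = n, OF as'(1) sw assms(3) ds' as'(2) IH]) auto
        \<comment> \<open>The residual minus the t-derivative is \<open>a\<close> times the speed
          times the x-derivative; multiplication by \<open>a\<close> times the slowness isolates the
          latter.\<close>
        ultimately have "net_bound null_exponent (\<lambda>\<phi> p. ?as \<phi> p * transport a w \<phi> p +
            (-1) * (?as \<phi> p * partial orthant (0, 1) (w \<phi>) p)) K ds'"
          using as'(1) sw w(2) assms(3) ds'
          by (intro net_bound_lincomb smooth_net_mult[OF as'(1)]) (auto simp: null_net_def)
        also have "?this \<longleftrightarrow> ?thesis"
        proof (rule net_bound_cong[OF assms(3)])
          fix \<phi> and p :: "real \<times> real"
          have "?as \<phi> p * transport a w \<phi> p + (-1) * (?as \<phi> p * partial orthant (0, 1) (w \<phi>) p) =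
            of_real (a\<^sup>2) * (?s \<phi> p * speed_net (tensor_base \<phi>) (fst p)) * partial orthant (1, 0) (w \<phi>) p"
            by (simp add: transport_def power2_eq_square distrib_left mult_ac)
          then show "?as \<phi> p * transport a w \<phi> p + (-1) * (?as \<phi> p * partial orthant (0, 1) (w \<phi>) p) =
            partial orthant (1, 0) (w \<phi>) p"
            using w(3) by (simp only: slow_speed_net) simp
        qed
        finally show ?thesis .
      qed
      show ?thesis
        using b False Suc.prems(1) Suc.IH[OF nt] *[of u 1] *[of v "-1"]
        by (simp add: Cons null_solution_def net_bound_partial)
    qed
  qed
qed

lemma null_solution_null:
  assumes "null_solution u v"
  shows "null_net u" "null_net v"
  using assms null_solution_net_bound[OF assms, OF _ _ _ order_refl]
  by (auto simp: null_net_iff null_solution_def moderate_def)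

end

section \<open>Association\<close>

text \<open>The values on the exceptional set are arbitrary; completeness of Lebesgue measure
  disposes of them.\<close>

lemma borel_measurable_AE_isCont:
  fixes f :: "'a::euclidean_space \<Rightarrow> 'b::euclidean_space"
  assumes "AE x in lebesgue. isCont f x"
  shows "f \<in> borel_measurable lebesgue"
proof -
  obtain N where N: "negligible N" "\<And>x. x \<notin> N \<Longrightarrow> isCont f x"
    using assms by (auto simp: eventually_ae_filter_negligible)
  have S: "- N \<in> sets lebesgue" using negligible_imp_sets[OF N(1)] by (rule Compl_in_sets_lebesgue[THEN iffD2])
  have "continuous_on (- N) f" using N(2) by (intro continuous_at_imp_continuous_on) auto
  then have "f \<in> borel_measurable (lebesgue_on (- N))"
    using S by (rule continuous_imp_measurable_on_sets_lebesgue)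
  then have m: "(\<lambda>x. if x \<in> - N then f x else 0) \<in> borel_measurable lebesgue"
    using S by (simp only: borel_measurable_if)
  show ?thesis
  proof (rule borel_measurable_AE[OF m])
    show "AE x in lebesgue. (if x \<in> - N then f x else 0) = f x"
      using N(1) by (auto simp: eventually_ae_filter_negligible intro!: exI[of _ N])
  qed
qed

lemma closed_orthant: "closed (orthant :: 'a::euclidean_space set)"
proof -
  have "orthant = (\<Inter>b\<in>Basis. {x::'a. 0 \<le> x \<bullet> b})" by (auto simp: orthant_def)
  also have "closed \<dots>" by (intro closed_INT ballI closed_Collect_le continuous_intros)
  finally show ?thesis .
qed

lemma borel_measurable_continuous_orthant:
  fixes f :: "'a::euclidean_space \<Rightarrow> complex"
  assumes "continuous_on orthant f"
  shows "(\<lambda>x. indicator orthant x *\<^sub>R f x) \<in> borel_measurable lebesgue"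
proof -
  have "(\<lambda>x. indicator orthant x *\<^sub>R f x) \<in> borel_measurable borel"
    using assms by (intro borel_measurable_continuous_on_indicator borel_closed[OF closed_orthant])
  then show ?thesis by (intro measurable_completion) simp
qed

lemma integrable_indicator_compact:
  "compact (K :: 'a::euclidean_space set) \<Longrightarrow> integrable lebesgue (\<lambda>x. B * indicator K x :: real)"
  using lmeasurable_compact[of K] by (intro integrable_mult_right integrable_real_indicator) (auto simp: fmeasurable_def)

text \<open>The limit \<open>w\<close> is prescribed only almost everywhere on the orthant, so
  measurability and boundedness are carried by a substitute \<open>g\<close> defined everywhere. The
  compact support of the test function and the bound uniform in \<epsilon> supply the integrable
  majorant.\<close>

lemma associatedI:
  fixes u :: "'a::euclidean_space net" and w g :: "'a \<Rightarrow> real"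
  assumes u: "moderate u"
    and g: "g \<in> borel_measurable lebesgue" "\<And>x. \<bar>g x\<bar> \<le> M"
    and w: "AE x in lebesgue. x \<in> orthant \<longrightarrow> w x = g x"
    and bound: "\<And>\<phi>. \<phi> \<in> mollifier 1 \<Longrightarrow> \<exists>B. \<forall>\<epsilon>>0. \<forall>x\<in>orthant. norm (u (rescale \<epsilon> \<phi>) x) \<le> B"
    and lim: "\<And>\<phi>. \<phi> \<in> mollifier 1 \<Longrightarrow> AE x in lebesgue. x \<in> orthant \<longrightarrow>
      ((\<lambda>\<epsilon>. u (rescale \<epsilon> \<phi>) x) \<longlongrightarrow> of_real (g x)) (at_right 0)"
  shows "associated (abs_colombeau u) w"
  unfolding associated_def
proof (intro conjI exI[of _ u] ballI exI[of _ 1])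
  show "represents u (abs_colombeau u)" using u by (simp add: represents_def)
  have M: "0 \<le> M" using g(2)[of undefined] by linarith
  show "locally_integrable w"
    unfolding locally_integrable_def set_integrable_def
  proof (intro allI impI)
    fix K :: "'a set" assume K: "compact K \<and> K \<subseteq> orthant"
    have meas: "(\<lambda>x. indicator K x *\<^sub>R g x) \<in> borel_measurable lebesgue"
      using K lmeasurable_compact[of K] g(1) by (intro borel_measurable_scaleR borel_measurable_indicator) auto
    have ae: "AE x in lebesgue. indicator K x *\<^sub>R g x = indicator K x *\<^sub>R w x"
      using w by eventually_elim (use K in \<open>auto simp: indicator_def\<close>)
    show "integrable lebesgue (\<lambda>x. indicator K x *\<^sub>R w x)"
    proof (rule Bochner_Integration.integrable_bound)
      show "integrable lebesgue (\<lambda>x. M * indicator K x :: real)"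
        using K by (intro integrable_indicator_compact) simp
      show "(\<lambda>x. indicator K x *\<^sub>R w x) \<in> borel_measurable lebesgue"
        by (rule borel_measurable_AE[OF meas ae])
      show "AE x in lebesgue. norm (indicator K x *\<^sub>R w x) \<le> norm (M * indicator K x :: real)"
        using ae
      proof eventually_elim
        case (elim x)
        then show ?case using g(2)[of x] M by (cases "x \<in> K") simp_all
      qed
    qed
  qed
  fix \<psi> \<phi> :: "'a \<Rightarrow> complex" assume \<psi>: "\<psi> \<in> test_functions orthant" and \<phi>: "\<phi> \<in> mollifier 1"
  obtain K where K: "compact K" "K \<subseteq> orthant" "\<And>x. x \<in> orthant \<Longrightarrow> x \<notin> K \<Longrightarrow> \<psi> x = 0"
    using \<psi> by (auto simp: test_functions_def)
  obtain P where P: "0 < P" "\<And>x. x \<in> orthant \<Longrightarrow> norm (\<psi> x) \<le> P"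
    using test_functions_bounded[OF \<psi>] by blast
  obtain B where B: "\<And>\<epsilon> x. 0 < \<epsilon> \<Longrightarrow> x \<in> orthant \<Longrightarrow> norm (u (rescale \<epsilon> \<phi>) x) \<le> B"
    using bound[OF \<phi>] by blast
  have cu: "continuous_on orthant (u (rescale \<epsilon> \<phi>))" if "0 < \<epsilon>" for \<epsilon>
    using u that \<phi> by (intro smooth_on_continuous smooth_net_rescale) (simp_all add: moderate_def)
  let ?s = "\<lambda>\<epsilon> y. indicator orthant y *\<^sub>R (u (rescale \<epsilon> \<phi>) y * \<psi> y)"
  let ?h = "\<lambda>v y. indicator orthant y *\<^sub>R (complex_of_real (v y) * \<psi> y)"
  have "?h g = (\<lambda>y. complex_of_real (g y) * (indicator orthant y *\<^sub>R \<psi> y))" by auto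
  moreover have "\<dots> \<in> borel_measurable lebesgue"
    using g(1) borel_measurable_continuous_orthant[OF test_functions_continuous[OF \<psi>]]
    by (intro borel_measurable_times) auto
  ultimately have mg: "?h g \<in> borel_measurable lebesgue" by simp
  have aeh: "AE y in lebesgue. ?h g y = ?h w y"
    using w by eventually_elim (auto simp: indicator_def)
  have mw: "?h w \<in> borel_measurable lebesgue" by (rule borel_measurable_AE[OF mg aeh])
  \<comment> \<open>Dominated convergence concerns sequences, so the limit at 0 is tested along
    arbitrary positive null sequences.\<close>
  have "((\<lambda>\<epsilon>. LINT y|lebesgue. ?s \<epsilon> y) \<longlongrightarrow> (LINT y|lebesgue. ?h w y)) (at_right 0)"
    unfolding tendsto_at_iff_sequentially
  proof (intro allI impI)
    fix X :: "nat \<Rightarrow> real" assume X: "\<forall>i. X i \<in> {0<..} - {0}" "X \<longlonglongrightarrow> 0"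
    have X0: "0 < X i" for i using X(1) by auto
    have Xlim: "filterlim X (at_right 0) sequentially"
      using X(2) X0 by (intro tendsto_imp_filterlim_at_right always_eventually allI)
    show "((\<lambda>\<epsilon>. LINT y|lebesgue. ?s \<epsilon> y) \<circ> X) \<longlonglongrightarrow> (LINT y|lebesgue. ?h w y)"
      unfolding o_def
    proof (rule integral_dominated_convergence[where w = "\<lambda>y. (B * P) * indicator K y"])
      show "?s (X i) \<in> borel_measurable lebesgue" for i
        using cu[OF X0] test_functions_continuous[OF \<psi>]
        by (intro borel_measurable_continuous_orthant continuous_on_mult)
      show "integrable lebesgue (\<lambda>y. (B * P) * indicator K y)"
        using K(1) by (rule integrable_indicator_compact)
      show "AE y in lebesgue. (\<lambda>i. ?s (X i) y) \<longlonglongrightarrow> ?h w y"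
        using lim[OF \<phi>] aeh
      proof eventually_elim
        case (elim y)
        have "(\<lambda>i. ?s (X i) y) \<longlonglongrightarrow> ?h g y"
        proof (cases "y \<in> orthant")
          case True
          then have "(\<lambda>i. u (rescale (X i) \<phi>) y) \<longlonglongrightarrow> of_real (g y)"
            using filterlim_compose[OF _ Xlim] elim(1) by auto
          then show ?thesis by (intro tendsto_intros)
        qed simp
        then show ?case unfolding elim(2) .
      qed
      show "AE y in lebesgue. norm (?s (X i) y) \<le> (B * P) * indicator K y" for i
      proof (rule AE_I2)
        fix y
        show "norm (?s (X i) y) \<le> (B * P) * indicator K y"
        proof (cases "y \<in> K")
          case True
          then have y: "y \<in> orthant" using K(2) by blast
          then have "norm (u (rescale (X i) \<phi>) y) * norm (\<psi> y) \<le> B * P"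
            using B[OF X0 y] P by (intro mult_mono order_trans[OF norm_ge_zero B[OF X0 y]]) auto
          then show ?thesis using True y by (simp add: norm_mult)
        next
          case False
          then show ?thesis using K(3)[of y] by (cases "y \<in> orthant") auto
        qed
      qed
    qed (rule mw)
  qed
  then show "((\<lambda>\<epsilon>. LINT y:orthant|lebesgue. u (rescale \<epsilon> \<phi>) y * \<psi> y) \<longlongrightarrow>
      (LINT y:orthant|lebesgue. complex_of_real (w y) * \<psi> y)) (at_right 0)"
    by (simp add: set_lebesgue_integral_def)
qed

lemma negligible_lipschitz_image:
  fixes h :: "real \<Rightarrow> real"
  assumes "negligible S" "\<And>x y. \<bar>h x - h y\<bar> \<le> L * \<bar>x - y\<bar>"
  shows "negligible (h ` S)"
proof (rule negligible_locally_Lipschitz_image[OF _ assms(1)])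
  show "\<exists>T B. open T \<and> x \<in> T \<and> (\<forall>y\<in>S \<inter> T. norm (h y - h x) \<le> B * norm (y - x))" for x
    using assms(2) by (intro exI[of _ UNIV] exI[of _ L]) auto
qed simp

text \<open>For fixed x the map sending t to \<open>Y x - t\<close> is an isometry, so the
  exceptional set meets every line x = const in a null set, and Fubini applies. Enclosing the
  discontinuities in a Borel null set settles measurability in the product.\<close>

lemma AE_isCont_shear:
  fixes f Y :: "real \<Rightarrow> real"
  assumes f: "AE z in lebesgue. isCont f z" and Y: "continuous_on UNIV Y"
  shows "AE p in lebesgue. isCont f (Y (fst p) - snd p)"
proof -
  have "AE z in lborel. isCont f z" using f by (simp add: AE_completion_iff)
  then obtain N where N: "{z. \<not> isCont f z} \<subseteq> N" "N \<in> null_sets lborel"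
    by (auto elim!: AE_E simp: null_sets_def)
  have [measurable]: "N \<in> sets borel" using N(2) by auto
  have [measurable]: "Y \<in> borel_measurable borel" using Y by (rule borel_measurable_continuous_onI)
  have ae: "AE z in lborel. z \<notin> N" using N(2) by (rule AE_not_in)
  have "AE t in lborel. Y x - t \<notin> N" for x
    using AE_borel_affine[of "-1" "\<lambda>z. z \<notin> N" "Y x"] ae by simp
  moreover have "{p \<in> space (lborel \<Otimes>\<^sub>M lborel). Y (fst p) - snd p \<notin> N} \<in> sets (lborel \<Otimes>\<^sub>M lborel)"
    by measurable
  ultimately have "AE p in lborel \<Otimes>\<^sub>M lborel. Y (fst p) - snd p \<notin> N"
    by (intro lborel_pair.AE_pair_measure) simp_all
  then have "AE p in lborel. Y (fst p) - snd p \<notin> N" unfolding lborel_prod .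
  then have "AE p in lborel. isCont f (Y (fst p) - snd p)"
    by eventually_elim (use N(1) in blast)
  then show ?thesis by (rule AE_completion)
qed

section \<open>The limit problem\<close>

lemma max_lipschitz: "\<bar>max a 0 - max b 0\<bar> \<le> \<bar>a - b\<bar>" for a b :: real
  by (auto simp: max_def)

context two_speeds
begin

text \<open>The inverse of \<open>limit_arrival\<close> on the whole line, again a linear function
  plus a multiple of a positive part.\<close>

definition limit_position :: "real \<Rightarrow> real" where
  "limit_position z = c\<^sub>L * z + (c\<^sub>R - c\<^sub>L) * max (z - x\<^sub>0 / c\<^sub>L) 0"

lemma limit_position_arrival [simp]: "limit_position (limit_arrival x) = x"
proof (cases "x \<le> x\<^sub>0")
  case True
  then have "limit_arrival x = x / c\<^sub>L" by (simp add: limit_arrival_def)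
  moreover have "x / c\<^sub>L \<le> x\<^sub>0 / c\<^sub>L" using True cL by (simp add: divide_right_mono)
  ultimately show ?thesis by (simp add: limit_position_def)
next
  case False
  then have e: "limit_arrival x = x\<^sub>0 / c\<^sub>L + (x - x\<^sub>0) / c\<^sub>R"
    by (simp add: limit_arrival_def jump_def algebra_simps diff_divide_distrib)
  moreover have "0 < (x - x\<^sub>0) / c\<^sub>R" using False cR by simp
  ultimately have "limit_position (limit_arrival x) =
      c\<^sub>L * (x\<^sub>0 / c\<^sub>L + (x - x\<^sub>0) / c\<^sub>R) + (c\<^sub>R - c\<^sub>L) * ((x - x\<^sub>0) / c\<^sub>R)"
    by (simp add: limit_position_def)
  also have "\<dots> = c\<^sub>L * (x\<^sub>0 / c\<^sub>L) + c\<^sub>R * ((x - x\<^sub>0) / c\<^sub>R)" by (simp only: algebra_simps)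
  finally show ?thesis by simp
qed

lemma limit_arrival_position [simp]: "limit_arrival (limit_position z) = z"
proof (cases "z \<le> x\<^sub>0 / c\<^sub>L")
  case True
  then have "limit_position z = c\<^sub>L * z" by (simp add: limit_position_def)
  moreover have "c\<^sub>L * z \<le> x\<^sub>0" using True cL by (simp add: pos_le_divide_eq mult.commute)
  ultimately show ?thesis by (simp add: limit_arrival_def)
next
  case False
  then have e: "limit_position z = x\<^sub>0 + c\<^sub>R * (z - x\<^sub>0 / c\<^sub>L)"
    by (simp add: limit_position_def algebra_simps diff_divide_distrib)
  moreover have "0 < c\<^sub>R * (z - x\<^sub>0 / c\<^sub>L)" using False cR by simp
  ultimately have "limit_arrival (limit_position z) =
      (x\<^sub>0 + c\<^sub>R * (z - x\<^sub>0 / c\<^sub>L)) / c\<^sub>L + (1 / c\<^sub>R - 1 / c\<^sub>L) * (c\<^sub>R * (z - x\<^sub>0 / c\<^sub>L))"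
    by (simp add: limit_arrival_def jump_def)
  also have "(x\<^sub>0 + c\<^sub>R * w) / c\<^sub>L + (1 / c\<^sub>R - 1 / c\<^sub>L) * (c\<^sub>R * w) = x\<^sub>0 / c\<^sub>L + w" for w
    by (simp add: algebra_simps add_divide_distrib)
  finally show ?thesis by simp
qed

text \<open>Lipschitz maps preserve null sets. Together with the corresponding bound for the
  inverse, this lets statements valid almost everywhere pass between position and travel time in
  both directions.\<close>

lemma limit_arrival_lipschitz:
  "\<bar>limit_arrival x - limit_arrival y\<bar> \<le> (1 / c\<^sub>L + \<bar>jump\<bar>) * \<bar>x - y\<bar>"
proof -
  have "limit_arrival x - limit_arrival y = (1 / c\<^sub>L) * (x - y) + jump * (max (x - x\<^sub>0) 0 - max (y - x\<^sub>0) 0)"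
    by (simp add: limit_arrival_def algebra_simps diff_divide_distrib)
  also have "\<bar>\<dots>\<bar> \<le> (1 / c\<^sub>L) * \<bar>x - y\<bar> + \<bar>jump\<bar> * \<bar>max (x - x\<^sub>0) 0 - max (y - x\<^sub>0) 0\<bar>"
    using cL by (intro order_trans[OF abs_triangle_ineq]) (simp add: abs_mult)
  also have "\<dots> \<le> (1 / c\<^sub>L) * \<bar>x - y\<bar> + \<bar>jump\<bar> * \<bar>x - y\<bar>"
    using max_lipschitz[of "x - x\<^sub>0" "y - x\<^sub>0"] by (intro add_left_mono mult_left_mono) auto
  finally show ?thesis by (simp add: distrib_right)
qed

lemma limit_position_lipschitz:
  "\<bar>limit_position x - limit_position y\<bar> \<le> (c\<^sub>L + \<bar>c\<^sub>R - c\<^sub>L\<bar>) * \<bar>x - y\<bar>"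
proof -
  have "limit_position x - limit_position y =
      c\<^sub>L * (x - y) + (c\<^sub>R - c\<^sub>L) * (max (x - x\<^sub>0 / c\<^sub>L) 0 - max (y - x\<^sub>0 / c\<^sub>L) 0)"
    by (simp add: limit_position_def right_diff_distrib)
  also have "\<bar>\<dots>\<bar> \<le> c\<^sub>L * \<bar>x - y\<bar> + \<bar>c\<^sub>R - c\<^sub>L\<bar> * \<bar>max (x - x\<^sub>0 / c\<^sub>L) 0 - max (y - x\<^sub>0 / c\<^sub>L) 0\<bar>"
    using cL by (intro order_trans[OF abs_triangle_ineq]) (simp add: abs_mult)
  also have "\<dots> \<le> c\<^sub>L * \<bar>x - y\<bar> + \<bar>c\<^sub>R - c\<^sub>L\<bar> * \<bar>x - y\<bar>"
    using max_lipschitz[of "x - x\<^sub>0 / c\<^sub>L" "y - x\<^sub>0 / c\<^sub>L"] by (intro add_left_mono mult_left_mono) auto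
  finally show ?thesis by (simp add: distrib_right)
qed

lemma limit_arrival_0 [simp]: "limit_arrival 0 = 0" and limit_position_0 [simp]: "limit_position 0 = 0"
  using x0 cL by (simp_all add: limit_arrival_def limit_position_def)

lemma continuous_limit_arrival: "continuous_on S limit_arrival"
  and continuous_limit_position: "continuous_on S limit_position"
  unfolding limit_arrival_def limit_position_def by (intro continuous_intros; simp)+

lemma limit_position_mono: "z < z' \<Longrightarrow> limit_position z < limit_position z'"
proof -
  assume z: "z < z'"
  have e: "limit_position z = c\<^sub>L * min z (x\<^sub>0 / c\<^sub>L) + c\<^sub>R * max (z - x\<^sub>0 / c\<^sub>L) 0" for z
    by (auto simp: limit_position_def max_def min_def algebra_simps)
  show ?thesis
  proof (cases "z < x\<^sub>0 / c\<^sub>L")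
    case True
    then have "c\<^sub>L * min z (x\<^sub>0 / c\<^sub>L) < c\<^sub>L * min z' (x\<^sub>0 / c\<^sub>L)" using cL z by (intro mult_strict_left_mono) auto
    moreover have "c\<^sub>R * max (z - x\<^sub>0 / c\<^sub>L) 0 \<le> c\<^sub>R * max (z' - x\<^sub>0 / c\<^sub>L) 0"
      using cR z by (intro mult_left_mono) auto
    ultimately show ?thesis unfolding e by linarith
  next
    case False
    then have "c\<^sub>R * max (z - x\<^sub>0 / c\<^sub>L) 0 < c\<^sub>R * max (z' - x\<^sub>0 / c\<^sub>L) 0"
      using cR z by (intro mult_strict_left_mono) auto
    moreover have "c\<^sub>L * min z (x\<^sub>0 / c\<^sub>L) \<le> c\<^sub>L * min z' (x\<^sub>0 / c\<^sub>L)"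
      using cL z by (intro mult_left_mono) auto
    ultimately show ?thesis unfolding e by linarith
  qed
qed

lemma limit_position_pos_iff [simp]: "0 < limit_position z \<longleftrightarrow> 0 < z"
  and limit_position_nonneg_iff [simp]: "0 \<le> limit_position z \<longleftrightarrow> 0 \<le> z"
  using limit_position_mono[of 0 z] limit_position_mono[of z 0] by (cases z "0::real" rule: linorder_cases; force)+

lemma limit_arrival_pos_iff [simp]: "0 < limit_arrival x \<longleftrightarrow> 0 < x"
  and limit_arrival_nonneg_iff [simp]: "0 \<le> limit_arrival x \<longleftrightarrow> 0 \<le> x"
  using limit_position_pos_iff[of "limit_arrival x"] limit_position_nonneg_iff[of "limit_arrival x"] by simp_all

lemma limit_position_le: "0 \<le> z \<Longrightarrow> limit_position z \<le> (c\<^sub>L + \<bar>c\<^sub>R - c\<^sub>L\<bar>) * z"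
  using limit_position_lipschitz[of z 0] by simp

end

section \<open>The classical solution as a function of travel time\<close>

locale classical_problem = two_speeds +
  fixes c u\<^sub>0 v\<^sub>0 :: "real \<Rightarrow> real"
  assumes c_left: "\<And>x. 0 < x \<Longrightarrow> x < x\<^sub>0 \<Longrightarrow> c x = c\<^sub>L"
    and c_right: "\<And>x. x\<^sub>0 < x \<Longrightarrow> c x = c\<^sub>R"
    and bounded_data: "bounded (u\<^sub>0 ` {0..})" "bounded (v\<^sub>0 ` {0..})"
    and continuous_data: "AE x in lebesgue. 0 \<le> x \<longrightarrow> continuous (at x within {0..}) u\<^sub>0"
      "AE x in lebesgue. 0 \<le> x \<longrightarrow> continuous (at x within {0..}) v\<^sub>0"
    and vanishing_data: "\<exists>\<delta>>0. \<forall>x\<in>{0..<\<delta>}. u\<^sub>0 x = 0" "\<exists>\<delta>>0. \<forall>x\<in>{0..<\<delta>}. v\<^sub>0 x = 0"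
begin

text \<open>The values of \<open>c\<close> at 0 and \<open>x\<^sub>0\<close> are unconstrained, so
  the fundamental theorem is used in the form that ignores the end points and the exceptional set
  \<open>{x\<^sub>0}\<close>.\<close>

lemma travel_time_eq:
  assumes "0 \<le> x"
  shows "travel_time c x = limit_arrival x"
proof -
  have "((\<lambda>s. 1 / c s) has_integral limit_arrival x - limit_arrival 0) {0..x}"
  proof (rule fundamental_theorem_of_calculus_interior_strong[where S = "{x\<^sub>0}"])
    fix s assume s: "s \<in> {0<..<x} - {x\<^sub>0}"
    show "(limit_arrival has_vector_derivative 1 / c s) (at s)"
    proof (cases "s < x\<^sub>0")
      case True
      have "((\<lambda>s. s / c\<^sub>L) has_vector_derivative 1 / c s) (at s)"
        using c_left[of s] s True
        by (auto simp flip: has_real_derivative_iff_has_vector_derivative intro!: derivative_eq_intros)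
      then show ?thesis
        by (rule has_vector_derivative_transform_within_open[where S = "{..<x\<^sub>0}"])
          (use True in \<open>auto simp: limit_arrival_def\<close>)
    next
      case False
      have "((\<lambda>s. s / c\<^sub>L + jump * (s - x\<^sub>0)) has_vector_derivative 1 / c s) (at s)"
        using c_right[of s] s False
        by (auto simp: jump_def simp flip: has_real_derivative_iff_has_vector_derivative intro!: derivative_eq_intros)
      then show ?thesis
        by (rule has_vector_derivative_transform_within_open[where S = "{x\<^sub>0<..}"])
          (use s False in \<open>auto simp: limit_arrival_def\<close>)
    qed
  qed (use assms continuous_limit_arrival in auto)
  then show ?thesis unfolding travel_time_def by (simp add: integral_unique)
qed

lemma inv_travel_time:
  assumes "0 \<le> z"
  shows "inv_into {0..} (travel_time c) z = limit_position z"
proof (rule inv_into_f_eq)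
  show "inj_on (travel_time c) {0..}"
    by (rule inj_on_inverseI[where g = limit_position]) (simp add: travel_time_eq)
qed (use assms in \<open>simp_all add: travel_time_eq\<close>)

text \<open>
  Both families of characteristics are unfolded to one line: the data at time \<open>0\<close> as a function of
  the signed travel time from the boundary \<open>x = 0\<close>, negative for the left-going wave.
\<close>

definition data :: "real \<Rightarrow> real" where
  "data z = (if 0 \<le> z then u\<^sub>0 (limit_position z) else v\<^sub>0 (limit_position (- z)))"

lemma data_at_0: "u\<^sub>0 0 = 0" "v\<^sub>0 0 = 0"
  using vanishing_data by force+

text \<open>At \<open>z = 0\<close> the definition takes the branch of \<open>u\<^sub>0\<close>;
  both data vanish there, so the branch is immaterial.\<close>

lemma data_minus: "0 \<le> z \<Longrightarrow> data (- z) = v\<^sub>0 (limit_position z)"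
  using data_at_0 by (cases "z = 0") (simp_all add: data_def)

lemma classical_v_eq:
  assumes "p \<in> orthant"
  shows "classical_v c v\<^sub>0 p = data (- limit_arrival (fst p) - snd p)"
proof -
  obtain x t where p: "p = (x, t)" "0 \<le> x" "0 \<le> t" using assms by (cases p) (simp add: orthant_prod)
  have n: "0 \<le> limit_arrival x + t" using p by simp
  have "classical_v c v\<^sub>0 p = v\<^sub>0 (limit_position (limit_arrival x + t))"
    using p inv_travel_time[OF n] by (simp add: classical_v_def characteristic2_def travel_time_eq)
  also have "\<dots> = data (- (limit_arrival x + t))" using data_minus[OF n] by simp
  finally show ?thesis by (simp add: p(1))
qed

text \<open>Beyond the characteristic through the corner, the boundary value of \<open>v\<close> at
  time \<open>t - limit_arrival x\<close> is \<open>data\<close> at minus that time, so one formula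
  covers both regions.\<close>

lemma classical_u_eq:
  assumes "p \<in> orthant"
  shows "classical_u c u\<^sub>0 v\<^sub>0 p = data (limit_arrival (fst p) - snd p)"
proof -
  obtain x t where p: "p = (x, t)" "0 \<le> x" "0 \<le> t" using assms by (cases p) (simp add: orthant_prod)
  show ?thesis
  proof (cases "t \<le> limit_arrival x")
    case True
    then show ?thesis
      using p inv_travel_time[of "limit_arrival x - t"]
      by (simp add: classical_u_def characteristic1_def travel_time_eq data_def)
  next
    case False
    then have "classical_u c u\<^sub>0 v\<^sub>0 p = classical_v c v\<^sub>0 (0, t - limit_arrival x)"
      using p by (simp add: classical_u_def travel_time_eq)
    also have "\<dots> = data (- limit_arrival 0 - (t - limit_arrival x))"
      using False by (subst classical_v_eq) (auto simp: orthant_prod)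
    finally show ?thesis by (simp add: p(1))
  qed
qed

lemma data_bounded: "\<exists>M. \<forall>z. \<bar>data z\<bar> \<le> M"
proof -
  obtain A B where "\<forall>x\<ge>0. \<bar>u\<^sub>0 x\<bar> \<le> A" "\<forall>x\<ge>0. \<bar>v\<^sub>0 x\<bar> \<le> B"
    using bounded_data by (auto simp: bounded_iff)
  then have "\<bar>data z\<bar> \<le> max A B" for z
    by (auto simp: data_def max.coboundedI1 max.coboundedI2)
  then show ?thesis by blast
qed

lemma data_vanishes: "\<exists>r>0. \<forall>z. \<bar>z\<bar> < 2 * r \<longrightarrow> data z = 0"
proof -
  obtain d e where d: "0 < d" "\<And>x. 0 \<le> x \<Longrightarrow> x < d \<Longrightarrow> u\<^sub>0 x = 0"
    and e: "0 < e" "\<And>x. 0 \<le> x \<Longrightarrow> x < e \<Longrightarrow> v\<^sub>0 x = 0"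
    using vanishing_data by auto
  define L where "L = c\<^sub>L + \<bar>c\<^sub>R - c\<^sub>L\<bar>"
  \<comment> \<open>\<open>L\<close> is a Lipschitz constant of \<open>limit_position\<close>, so
    signed travel times below \<open>2 * r\<close> in modulus correspond to positions below
    \<open>min d e\<close>.\<close>
  define r where "r = min d e / (2 * L)"
  have L: "0 < L" using cL by (simp add: L_def)
  have "data z = 0" if "\<bar>z\<bar> < 2 * r" for z
  proof -
    have small: "limit_position y < min d e" if "0 \<le> y" "y < 2 * r" for y
    proof -
      have "limit_position y \<le> L * y" unfolding L_def using that(1) by (rule limit_position_le)
      also have "\<dots> < L * (2 * r)" using that(2) L by (rule mult_strict_left_mono)
      also have "\<dots> = min d e" unfolding r_def using L by simp
      finally show ?thesis .
    qed
    show ?thesis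
      using small[of z] small[of "- z"] that d(2) e(2) by (auto simp: data_def)
  qed
  moreover have "0 < r" using d(1) e(1) L by (simp add: r_def)
  ultimately show ?thesis by blast
qed

text \<open>Off 0, continuity within \<open>{0..}\<close> is two-sided continuity. The exceptional
  positions are carried to signed travel times by Lipschitz maps and stay negligible; the point 0,
  where the branches meet, is added to them.\<close>

lemma AE_isCont_data: "AE z in lebesgue. isCont data z"
proof -
  obtain N where N: "negligible N" "\<And>x. x \<notin> N \<Longrightarrow> 0 \<le> x \<Longrightarrow> continuous (at x within {0..}) u\<^sub>0"
    using continuous_data(1) by (auto simp: eventually_ae_filter_negligible)
  obtain N' where N': "negligible N'" "\<And>x. x \<notin> N' \<Longrightarrow> 0 \<le> x \<Longrightarrow> continuous (at x within {0..}) v\<^sub>0"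
    using continuous_data(2) by (auto simp: eventually_ae_filter_negligible)
  have interior: "isCont g x" if "continuous (at x within {0..}) g" "0 < x" for g :: "real \<Rightarrow> real" and x
  proof -
    have "at x within {0..} = at x" using that(2) by (intro at_within_interior) simp
    then show ?thesis using that(1) by simp
  qed
  have pos: "isCont (\<lambda>z. limit_position z) z" for z
    using continuous_limit_position[of UNIV] by (simp add: continuous_on_eq_continuous_at)
  let ?Z = "limit_arrival ` N \<union> (\<lambda>x. - limit_arrival x) ` N' \<union> {0}"
  have "negligible (limit_arrival ` N)"
    by (rule negligible_lipschitz_image[OF N(1) limit_arrival_lipschitz])
  moreover have "negligible ((\<lambda>x. - limit_arrival x) ` N')"
  proof (rule negligible_lipschitz_image[OF N'(1)])
    show "\<bar>- limit_arrival x - - limit_arrival y\<bar> \<le> (1 / c\<^sub>L + \<bar>jump\<bar>) * \<bar>x - y\<bar>" for x y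
      using limit_arrival_lipschitz[of y x] by (simp only: minus_diff_minus abs_minus_cancel abs_minus_commute[of y] minus_diff_eq)
  qed
  ultimately have "negligible ?Z" by simp
  moreover have "isCont data z" if "z \<notin> ?Z" for z
  proof (cases "0 < z")
    case True
    have "limit_position z \<notin> N" using that by (auto intro: image_eqI[of _ _ "limit_position z"])
    then have "isCont u\<^sub>0 (limit_position z)" using N(2) True by (intro interior) auto
    with pos have "isCont (\<lambda>z. u\<^sub>0 (limit_position z)) z" by (rule isCont_o2)
    moreover have "\<forall>\<^sub>F y in nhds z. data y = u\<^sub>0 (limit_position y)"
      unfolding eventually_nhds using True by (intro exI[of _ "{0<..}"]) (auto simp: data_def)
    ultimately show ?thesis by (simp only: isCont_cong)
  next
    case False
    then have z: "z < 0" using that by auto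
    have "limit_position (- z) \<notin> N'" using that by (auto intro: image_eqI[of _ _ "limit_position (- z)"])
    then have "isCont v\<^sub>0 (limit_position (- z))" using N'(2) z by (intro interior) auto
    moreover have "isCont (\<lambda>z. limit_position (- z)) z"
      by (rule isCont_o2[OF _ pos]) simp
    ultimately have "isCont (\<lambda>z. v\<^sub>0 (limit_position (- z))) z"
      by (rule isCont_o2[of z "\<lambda>z. limit_position (- z)" v\<^sub>0, rotated])
    moreover have "\<forall>\<^sub>F y in nhds z. data y = v\<^sub>0 (limit_position (- y))"
      unfolding eventually_nhds using z by (intro exI[of _ "{..<0}"]) (auto simp: data_def)
    ultimately show ?thesis by (simp only: isCont_cong)
  qed
  ultimately show ?thesis
    unfolding eventually_ae_filter_negligible by blast
qed

end

section \<open>Existence, uniqueness and the limit\<close>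

lemma abs_colombeau_eq_iff:
  assumes "moderate u" "moderate v"
  shows "abs_colombeau u = abs_colombeau v \<longleftrightarrow> null_net (\<lambda>\<phi> x. u \<phi> x - v \<phi> x)"
  using Quotient_rel[OF Quotient_colombeau, of u v] assms
  by (simp add: colombeau_rel_refl) (simp add: colombeau_rel_def)

lemma abs_colombeau_eq_0_iff:
  assumes "moderate u"
  shows "abs_colombeau u = 0 \<longleftrightarrow> null_net u"
  using abs_colombeau_eq_iff[OF assms moderate_zero] by (simp add: zero_colombeau_def)

lemma abs_colombeau_cases:
  fixes U :: "'a::euclidean_space colombeau"
  obtains u where "moderate u" "U = abs_colombeau u"
proof
  show "U = abs_colombeau (rep_colombeau U)"
    using Quotient_abs_rep[OF Quotient_colombeau, of U] by simp
  show "moderate (rep_colombeau U)"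
    using Quotient_rep_reflp[OF Quotient_colombeau, of U] by (simp add: colombeau_rel_def)
qed

lemma restrict_abs:
  assumes "moderate u"
  shows "restrict_t0 (abs_colombeau u) = abs_colombeau (\<lambda>\<rho> x. u (tensor_power \<rho>) (x, 0))"
    "restrict_x0 (abs_colombeau u) = abs_colombeau (\<lambda>\<rho> t. u (tensor_power \<rho>) (0, t))"
  using assms by (simp_all add: restrict_t0.abs_eq restrict_x0.abs_eq colombeau_rel_refl)

lemma moderate_restrict_x0:
  fixes u :: "(real \<times> real) net"
  assumes "moderate u"
  shows "moderate (\<lambda>\<rho> t::real. u (tensor_power \<rho>) (0, t))"
  using colombeau_rel_embed[OF embed_t colombeau_rel_refl[OF assms]] by (simp add: colombeau_rel_def)

lemma null_net_diff: "null_net u \<Longrightarrow> null_net v \<Longrightarrow> null_net (\<lambda>\<phi> x. u \<phi> x - v \<phi> x)"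
  using null_net_lincomb[of u v "-1"] by simp

section \<open>Uniqueness in the quotient algebra and growth of the speed\<close>

context two_speeds
begin

definition speed :: "real colombeau" where
  "speed = abs_colombeau speed_net"

lemma moderate_transport: "moderate u \<Longrightarrow> moderate (transport a u)"
proof -
  assume u: "moderate u"
  have "moderate (\<lambda>\<phi> p. partial orthant (0, 1) (u \<phi>) p +
      of_real a * (speed_net (tensor_base \<phi>) (fst p) * partial orthant (1, 0) (u \<phi>) p))"
    by (intro moderate_lincomb moderate_mult moderate_partial u moderate_of_space moderate_speed_net)
      (simp_all add: Basis_real_real)
  then show ?thesis by (simp add: transport_def[abs_def])
qed

lemma deriv_speed_eq_0_iff:
  assumes u: "moderate u"
  shows "deriv_t (abs_colombeau u) + of_space speed * deriv_x (abs_colombeau u) = 0 \<longleftrightarrow> null_net (transport 1 u)"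
    and "deriv_t (abs_colombeau u) - of_space speed * deriv_x (abs_colombeau u) = 0 \<longleftrightarrow> null_net (transport (-1) u)"
proof -
  note R = colombeau_rel_refl
  have ut: "moderate (\<lambda>\<phi>. partial orthant (0, 1) (u \<phi>))" and ux: "moderate (\<lambda>\<phi>. partial orthant (1, 0) (u \<phi>))"
    using u by (simp_all add: moderate_partial Basis_real_real)
  have s: "moderate (\<lambda>\<phi> p::real \<times> real. speed_net (tensor_base \<phi>) (fst p))"
    by (rule moderate_of_space[OF moderate_speed_net])
  have prod: "of_space speed * deriv_x (abs_colombeau u) =
      abs_colombeau (\<lambda>\<phi> p. speed_net (tensor_base \<phi>) (fst p) * partial orthant (1, 0) (u \<phi>) p)"
    unfolding speed_def by (simp add: of_space.abs_eq R moderate_speed_net deriv_x.abs_eq u times_colombeau.abs_eq s ux)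
  have "deriv_t (abs_colombeau u) + of_space speed * deriv_x (abs_colombeau u) = abs_colombeau (transport 1 u)"
    unfolding prod
    by (simp add: deriv_t.abs_eq R u plus_colombeau.abs_eq ut moderate_mult s ux transport_def[abs_def])
  then show "deriv_t (abs_colombeau u) + of_space speed * deriv_x (abs_colombeau u) = 0 \<longleftrightarrow> null_net (transport 1 u)"
    by (simp add: abs_colombeau_eq_0_iff moderate_transport u)
  have "deriv_t (abs_colombeau u) - of_space speed * deriv_x (abs_colombeau u) = abs_colombeau (transport (-1) u)"
    unfolding prod
    by (simp add: deriv_t.abs_eq R u minus_colombeau.abs_eq ut moderate_mult s ux transport_def[abs_def])
  then show "deriv_t (abs_colombeau u) - of_space speed * deriv_x (abs_colombeau u) = 0 \<longleftrightarrow> null_net (transport (-1) u)"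
    by (simp add: abs_colombeau_eq_0_iff moderate_transport u)
qed

lemma transport_diff:
  assumes "moderate u" "moderate w" "\<phi> \<in> mollifier 1" "p \<in> orthant"
  shows "transport a (\<lambda>\<phi> p. u \<phi> p - w \<phi> p) \<phi> p = transport a u \<phi> p - transport a w \<phi> p"
proof -
  have s: "smooth_on orthant (u \<phi>)" "smooth_on orthant (w \<phi>)"
    using assms(1-3) by (simp_all add: moderate_def smooth_net_def)
  have "partial orthant b (\<lambda>p. u \<phi> p - w \<phi> p) p = partial orthant b (u \<phi>) p - partial orthant b (w \<phi>) p"
    if "b \<in> Basis" for b
    using partial_lincomb[OF s that assms(4), of "-1"] by simp
  from this[of "(1, 0)"] this[of "(0, 1)"] show ?thesis
    by (simp add: transport_def Basis_real_real right_diff_distrib)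
qed

lemma solution_unique:
  assumes "solves_problem speed U\<^sub>0 V\<^sub>0 U V" "solves_problem speed U\<^sub>0 V\<^sub>0 U' V'"
  shows "U' = U" "V' = V"
proof -
  obtain u v u' v' where m: "moderate u" "moderate v" "moderate u'" "moderate v'"
    and abs: "U = abs_colombeau u" "V = abs_colombeau v" "U' = abs_colombeau u'" "V' = abs_colombeau v'"
    by (metis abs_colombeau_cases)
  note [simp] = m deriv_speed_eq_0_iff moderate_restrict_t0 moderate_restrict_x0 restrict_abs abs_colombeau_eq_iff
  have s: "null_net (transport 1 u)" "null_net (transport (-1) v)" "null_net (transport 1 u')" "null_net (transport (-1) v')"
    and b: "null_net (\<lambda>\<rho> t. u (tensor_power \<rho>) (0, t) - v (tensor_power \<rho>) (0, t))"
      "null_net (\<lambda>\<rho> t. u' (tensor_power \<rho>) (0, t) - v' (tensor_power \<rho>) (0, t))"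
    using assms by (simp_all add: solves_problem_def abs del: right_minus_eq)
  have "restrict_t0 U' = restrict_t0 U" "restrict_t0 V' = restrict_t0 V"
    using assms by (simp_all add: solves_problem_def)
  then have i: "null_net (\<lambda>\<rho> x. u' (tensor_power \<rho>) (x, 0) - u (tensor_power \<rho>) (x, 0))"
    "null_net (\<lambda>\<rho> x. v' (tensor_power \<rho>) (x, 0) - v (tensor_power \<rho>) (x, 0))"
    by (simp_all add: abs)
  have t: "null_net (transport a (\<lambda>\<phi> p. w' \<phi> p - w \<phi> p))"
    if "moderate w'" "moderate w" "null_net (transport a w')" "null_net (transport a w)" for a w w'
  proof -
    have "null_net (\<lambda>\<phi> p. transport a w' \<phi> p - transport a w \<phi> p)" using that(3,4) by (rule null_net_diff)
    then show ?thesis using that(1,2) by (subst null_net_cong) (rule transport_diff, auto)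
  qed
  have md: "moderate (\<lambda>\<phi> p. w' \<phi> p - w \<phi> p)" if "moderate w'" "moderate w" for w w' :: "(real \<times> real) net"
    using moderate_lincomb[OF that, of "-1"] by simp
  have "null_net (\<lambda>\<rho> x. (u' (tensor_power \<rho>) (0, x) - u (tensor_power \<rho>) (0, x)) -
      (v' (tensor_power \<rho>) (0, x) - v (tensor_power \<rho>) (0, x)))"
    using null_net_diff[OF b(2,1)] by (simp add: algebra_simps)
  then have "null_solution (\<lambda>\<phi> p. u' \<phi> p - u \<phi> p) (\<lambda>\<phi> p. v' \<phi> p - v \<phi> p)"
    unfolding null_solution_def using t s i md by simp
  from null_solution_null[OF this] show "U' = U" "V' = V" by (simp_all add: abs)
qed

lemma norm_speed_net_le: "norm (speed_net \<rho> x) \<le> 1 / min_slow"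
  unfolding speed_net_def norm_of_real using slowness_bounds(1)[of \<rho> x] slowness_pos[of \<rho> x] min_slow_pos
  by (simp add: field_simps)

lemma globally_bounded_speed: "globally_bounded speed"
  unfolding globally_bounded_def represents_def speed_def
  using moderate_speed_net norm_speed_net_le min_slow_pos
  by (intro exI[of _ speed_net] conjI exI[of _ 0] ballI exI[of _ "1 / min_slow"] exI[of _ 1]) auto

text \<open>Differentiating the step brings out exactly one factor \<open>steepness\<close>; all
  other factors are bounded independently of the mollifier.\<close>

lemma norm_partial_speed_net_le:
  assumes \<rho>: "\<rho> \<in> mollifier1 q" and x: "x \<in> orthant"
  shows "norm (partial orthant 1 (speed_net \<rho>) x) \<le> \<bar>jump\<bar> * (1 / min_slow)\<^sup>2 * steepness \<rho>"
proof -
  let ?s = "logistic (steepness \<rho> * (x - x\<^sub>0))"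
  let ?d = "- 1 * (jump * (steepness \<rho> * poly [:0, 1, - 1:] ?s)) * inverse (slowness \<rho> x) ^ 2"
  have "((\<lambda>x. inverse (slowness \<rho> x)) has_real_derivative ?d) (at x)"
    using DERIV_inverse_slowness_power[of \<rho> 1 x] by (simp add: numeral_2_eq_2)
  from has_vd_of_real[OF this]
  have "partial orthant 1 (speed_net \<rho>) x = of_real ?d"
    unfolding speed_net_def[abs_def] using x by (intro partial_orthantI) auto
  also have "norm \<dots> = \<bar>jump\<bar> * (steepness \<rho> * \<bar>?s * (1 - ?s)\<bar>) * \<bar>inverse (slowness \<rho> x)\<bar> ^ 2"
  proof -
    have "poly [:0, 1, - 1:] ?s = ?s * (1 - ?s)" by (simp add: algebra_simps)
    then show ?thesis
      unfolding norm_of_real using steepness_pos[OF \<rho>] by (simp only: abs_mult power_abs) simp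
  qed
  also have "\<dots> \<le> \<bar>jump\<bar> * (steepness \<rho> * 1) * (1 / min_slow) ^ 2"
  proof (intro mult_mono power_mono mult_nonneg_nonneg)
    have "?s * (1 - ?s) \<le> 1 * 1" using logistic_bounds[of "steepness \<rho> * (x - x\<^sub>0)"] by (intro mult_mono) auto
    then show "\<bar>?s * (1 - ?s)\<bar> \<le> 1"
      using logistic_bounds[of "steepness \<rho> * (x - x\<^sub>0)"] by (simp add: abs_mult)
    show "\<bar>inverse (slowness \<rho> x)\<bar> \<le> 1 / min_slow"
      using norm_speed_net_le[of \<rho> x] unfolding speed_net_def norm_of_real .
  qed (use steepness_pos[OF \<rho>] min_slow_pos in auto)
  finally show ?thesis by (simp add: mult_ac)
qed

lemma locally_log_growth_speed: "locally_log_growth (deriv1 speed)"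
  unfolding locally_log_growth_def
proof (intro exI[of _ "\<lambda>\<rho>. partial orthant 1 (speed_net \<rho>)"] conjI allI impI)
  show "represents (\<lambda>\<rho>. partial orthant 1 (speed_net \<rho>)) (deriv1 speed)"
    unfolding represents_def speed_def
    using moderate_speed_net by (simp add: deriv1.abs_eq colombeau_rel_refl moderate_partial)
  fix K :: "real set" assume K: "compact K \<and> K \<subseteq> orthant"
  define A where "A = \<bar>jump\<bar> * (1 / min_slow)\<^sup>2"
  have A: "0 \<le> A" by (simp add: A_def)
  \<comment> \<open>\<open>N\<close> is both the index of the mollifiers and the factor of the
    logarithm, so it has to dominate \<open>A\<close>.\<close>
  obtain N :: nat where N: "max 1 A \<le> real N" using real_arch_simple by blast
  show "\<exists>N. \<forall>\<phi>\<in>mollifier N. \<exists>c>0. \<exists>\<eta>>0. \<forall>\<epsilon>. 0 < \<epsilon> \<and> \<epsilon> < \<eta> \<longrightarrow>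
      (\<forall>y\<in>K. norm (partial orthant 1 (speed_net (rescale \<epsilon> \<phi>)) y) \<le> real N * ln (c / \<epsilon>))"
  proof (intro exI[of _ N] ballI)
    fix \<rho> :: "real \<Rightarrow> complex" assume "\<rho> \<in> mollifier N"
    then have \<rho>: "\<rho> \<in> mollifier1 N" by (simp add: mollifier_real)
    define d where "d = 2 + 1 / support_radius \<rho>"
    have d: "0 < d" using support_radius_pos[OF \<rho>] by (simp add: d_def add_pos_pos)
    have "norm (partial orthant 1 (speed_net (rescale \<epsilon> \<rho>)) y) \<le> real N * ln (d / \<epsilon>)"
      if "0 < \<epsilon>" "\<epsilon> < 1" "y \<in> K" for \<epsilon> y
    proof -
      have m: "rescale \<epsilon> \<rho> \<in> mollifier1 N" using \<rho> that(1) by (rule mollifier1_rescale)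
      have "norm (partial orthant 1 (speed_net (rescale \<epsilon> \<rho>)) y) \<le> A * steepness (rescale \<epsilon> \<rho>)"
        unfolding A_def using K that(3) by (intro norm_partial_speed_net_le[OF m]) auto
      also have "\<dots> \<le> real N * ln (d / \<epsilon>)"
        using N A steepness_pos[OF m] steepness_rescale_le[OF \<rho> that(1,2)]
        by (intro mult_mono) (auto simp: d_def)
      finally show ?thesis .
    qed
    then show "\<exists>c>0. \<exists>\<eta>>0. \<forall>\<epsilon>. 0 < \<epsilon> \<and> \<epsilon> < \<eta> \<longrightarrow>
        (\<forall>y\<in>K. norm (partial orthant 1 (speed_net (rescale \<epsilon> \<rho>)) y) \<le> real N * ln (c / \<epsilon>))"
      using d by (intro exI[of _ d] conjI exI[of _ 1]) auto
  qed
qed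

lemma speed_net_tendsto:
  assumes "\<rho> \<in> mollifier1 q" "x \<noteq> x\<^sub>0"
  shows "((\<lambda>\<epsilon>. speed_net (rescale \<epsilon> \<rho>) x) \<longlongrightarrow> of_real (if x < x\<^sub>0 then c\<^sub>L else c\<^sub>R)) (at_right 0)"
proof -
  let ?l = "if 0 < x - x\<^sub>0 then 1 else 0 :: real"
  have "((\<lambda>\<epsilon>. slowness (rescale \<epsilon> \<rho>) x) \<longlongrightarrow> 1 / c\<^sub>L + jump * ?l) (at_right 0)"
    unfolding slowness_def using assms(2) by (intro tendsto_intros logistic_steep_tendsto[OF assms(1)]) simp
  moreover have "1 / c\<^sub>L + jump * ?l = (if x < x\<^sub>0 then 1 / c\<^sub>L else 1 / c\<^sub>R)"
    using assms(2) by (simp add: jump_def)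
  moreover have "(if x < x\<^sub>0 then 1 / c\<^sub>L else 1 / c\<^sub>R) \<noteq> 0" by simp
  ultimately have "((\<lambda>\<epsilon>. inverse (slowness (rescale \<epsilon> \<rho>) x)) \<longlongrightarrow>
      inverse (if x < x\<^sub>0 then 1 / c\<^sub>L else 1 / c\<^sub>R)) (at_right 0)"
    by (intro tendsto_inverse) simp_all
  moreover have "inverse (if x < x\<^sub>0 then 1 / c\<^sub>L else 1 / c\<^sub>R) = (if x < x\<^sub>0 then c\<^sub>L else c\<^sub>R)"
    by simp
  ultimately show ?thesis unfolding speed_net_def by (intro tendsto_of_real) simp
qed

text \<open>Since \<open>a * a = 1\<close>, the preimage of a null set under
  \<open>a * limit_arrival x\<close> is its image under the Lipschitz map
  \<open>limit_position (a * z)\<close>.\<close>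

lemma AE_limit_arrival:
  assumes "AE z in lebesgue. P z" "a\<^sup>2 = (1::real)"
  shows "AE x in lebesgue. P (a * limit_arrival x)"
proof -
  obtain N where N: "negligible N" "{z. \<not> P z} \<subseteq> N"
    using assms(1) by (auto simp: eventually_ae_filter_negligible)
  have a: "\<bar>a\<bar> = 1" "a * a = 1" using assms(2) by (auto simp: power2_eq_1_iff)
  have "negligible ((\<lambda>z. limit_position (a * z)) ` N)"
  proof (rule negligible_lipschitz_image[OF N(1)])
    show "\<bar>limit_position (a * x) - limit_position (a * y)\<bar> \<le> (c\<^sub>L + \<bar>c\<^sub>R - c\<^sub>L\<bar>) * \<bar>x - y\<bar>" for x y
      using limit_position_lipschitz[of "a * x" "a * y"] a(1) by (simp add: abs_mult flip: right_diff_distrib)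
  qed
  moreover have "{x. \<not> P (a * limit_arrival x)} \<subseteq> (\<lambda>z. limit_position (a * z)) ` N"
  proof
    fix x assume "x \<in> {x. \<not> P (a * limit_arrival x)}"
    then have "a * limit_arrival x \<in> N" using N(2) by blast
    moreover have "x = limit_position (a * (a * limit_arrival x))" by (simp add: a(2) flip: mult.assoc)
    ultimately show "x \<in> (\<lambda>z. limit_position (a * z)) ` N" by blast
  qed
  ultimately show ?thesis unfolding eventually_ae_filter_negligible by blast
qed

end

section \<open>The waves as generalized solutions\<close>

context two_speeds_profile
begin

text \<open>The generalized initial data are defined as the restrictions of the waves, so the
  initial conditions need no proof.\<close>

lemma wave_solves:
  "solves_problem speed (restrict_t0 (abs_colombeau (wave 1 0))) (restrict_t0 (abs_colombeau (wave (-1) 0)))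
     (abs_colombeau (wave 1 0)) (abs_colombeau (wave (-1) 0))"
proof -
  have t: "null_net (transport a (wave a 0))" if "a\<^sup>2 = 1" for a
  proof -
    have "null_net (transport a (wave a 0)) \<longleftrightarrow> null_net (\<lambda>\<phi> p::real \<times> real. 0)"
      using that unfolding transport_def by (intro null_net_cong wave_transport)
    then show ?thesis using null_net_zero by simp
  qed
  have "wave 1 0 (tensor_power \<rho>) (0, t) = wave (-1) 0 (tensor_power \<rho>) (0, t)" for \<rho> t
    by (simp add: wave_def)
  then show ?thesis
    using t[of 1] t[of "-1"]
    by (simp add: solves_problem_def deriv_speed_eq_0_iff moderate_wave restrict_abs(2) del: right_minus_eq)
qed

lemma norm_wave_le:
  assumes "\<phi> \<in> mollifier 1"
  shows "\<exists>B. \<forall>\<epsilon>>0. \<forall>p. norm (wave a 0 (rescale \<epsilon> \<phi>) p) \<le> B"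
proof -
  obtain \<rho> where \<rho>: "\<rho> \<in> mollifier1 1" "\<phi> = tensor_power \<rho>" using assms by (rule mollifier_prodE)
  then show ?thesis
    using norm_profile_0_le[OF \<rho>(1)]
    by (intro exI[of _ "M * (LINT x|lborel. norm (\<rho> x))"]) (auto simp: wave_def tensor_base_rescale)
qed

lemma wave_tendsto:
  assumes "\<phi> \<in> mollifier 1" "isCont f (a * limit_arrival (fst p) - snd p)"
  shows "((\<lambda>\<epsilon>. wave a 0 (rescale \<epsilon> \<phi>) p) \<longlongrightarrow> of_real (f (a * limit_arrival (fst p) - snd p))) (at_right 0)"
proof -
  obtain \<rho> where \<rho>: "\<rho> \<in> mollifier1 1" "\<phi> = tensor_power \<rho>" using assms(1) by (rule mollifier_prodE)
  have "((\<lambda>\<epsilon>. profile 0 (rescale \<epsilon> \<rho>) (a * arrival (rescale \<epsilon> \<rho>) (fst p) - snd p)) \<longlongrightarrow>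
      of_real (f (a * limit_arrival (fst p) - snd p))) (at_right 0)"
    using assms(2) by (intro profile_tendsto[OF \<rho>(1)] tendsto_intros arrival_tendsto[OF \<rho>(1)])
  moreover have "\<forall>\<^sub>F \<epsilon> in at_right 0. profile 0 (rescale \<epsilon> \<rho>) (a * arrival (rescale \<epsilon> \<rho>) (fst p) - snd p) =
      wave a 0 (rescale \<epsilon> \<phi>) p"
    using eventually_at_right_less[of "0::real"]
    by eventually_elim (simp add: wave_def \<rho>(2) tensor_base_rescale[OF \<rho>(1)])
  ultimately show ?thesis by (rule Lim_transform_eventually)
qed

lemma wave_associated:
  assumes f: "AE z in lebesgue. isCont f z"
    and w: "\<And>p. p \<in> orthant \<Longrightarrow> w p = f (a * limit_arrival (fst p) - snd p)"
  shows "associated (abs_colombeau (wave a 0)) w"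
proof (rule associatedI[where g = "\<lambda>p. f (a * limit_arrival (fst p) - snd p)" and M = M])
  have ae: "AE p in lebesgue. isCont f (a * limit_arrival (fst p) - snd p)"
    using f continuous_limit_arrival by (intro AE_isCont_shear continuous_on_mult_left)
  have "isCont (\<lambda>p::real \<times> real. a * limit_arrival (fst p) - snd p) p" for p
    using continuous_limit_arrival[of UNIV]
    by (intro continuous_intros isCont_o2[of _ fst]) (auto simp: continuous_on_eq_continuous_at)
  then have "AE p in lebesgue. isCont (\<lambda>p. f (a * limit_arrival (fst p) - snd p)) p"
    using ae by (auto elim!: eventually_mono intro: isCont_o2)
  then show "(\<lambda>p. f (a * limit_arrival (fst p) - snd p)) \<in> borel_measurable lebesgue"
    by (rule borel_measurable_AE_isCont)
  show "\<exists>B. \<forall>\<epsilon>>0. \<forall>p\<in>orthant. norm (wave a 0 (rescale \<epsilon> \<phi>) p) \<le> B" if "\<phi> \<in> mollifier 1" for \<phi>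
    using norm_wave_le[OF that] by blast
  show "AE p in lebesgue. p \<in> orthant \<longrightarrow> ((\<lambda>\<epsilon>. wave a 0 (rescale \<epsilon> \<phi>) p) \<longlongrightarrow>
      of_real (f (a * limit_arrival (fst p) - snd p))) (at_right 0)" if "\<phi> \<in> mollifier 1" for \<phi>
    using ae by eventually_elim (use wave_tendsto[OF that] in blast)
qed (use w moderate_wave f_bound in auto)

text \<open>This does not follow from association on the quadrant, where the line t = 0 is a null
  set; convergence almost everywhere is established on the line itself.\<close>

lemma initial_associated:
  assumes f: "AE z in lebesgue. isCont f z" and a: "a\<^sup>2 = 1"
    and w: "\<And>x. x \<in> orthant \<Longrightarrow> w x = f (a * limit_arrival x)"
  shows "associated (restrict_t0 (abs_colombeau (wave a 0))) w"
  unfolding restrict_abs(1)[OF moderate_wave]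
proof (rule associatedI[where g = "\<lambda>x. f (a * limit_arrival x)" and M = M])
  have ae: "AE x in lebesgue. isCont f (a * limit_arrival x)" by (rule AE_limit_arrival[OF f a])
  have "isCont (\<lambda>x. a * limit_arrival x) x" for x
    using continuous_limit_arrival[of UNIV]
    by (intro continuous_intros) (auto simp: continuous_on_eq_continuous_at)
  then have "AE x in lebesgue. isCont (\<lambda>x. f (a * limit_arrival x)) x"
    using ae by (auto elim!: eventually_mono intro: isCont_o2)
  then show "(\<lambda>x. f (a * limit_arrival x)) \<in> borel_measurable lebesgue"
    by (rule borel_measurable_AE_isCont)
  show "moderate (\<lambda>\<rho> x::real. wave a 0 (tensor_power \<rho>) (x, 0))"
    by (rule moderate_restrict_t0[OF moderate_wave])
  fix \<rho> :: "real \<Rightarrow> complex" assume \<rho>: "\<rho> \<in> mollifier 1"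
  note \<phi> = mollifier_tensor_power[OF \<rho>, where 'a = "real \<times> real"]
  show "\<exists>B. \<forall>\<epsilon>>0. \<forall>x\<in>orthant. norm (wave a 0 (tensor_power (rescale \<epsilon> \<rho>)) (x, 0)) \<le> B"
    using norm_wave_le[OF \<phi>] unfolding rescale_tensor_power by blast
  show "AE x in lebesgue. x \<in> orthant \<longrightarrow> ((\<lambda>\<epsilon>. wave a 0 (tensor_power (rescale \<epsilon> \<rho>)) (x, 0)) \<longlongrightarrow>
      of_real (f (a * limit_arrival x))) (at_right 0)"
    using ae by eventually_elim (use wave_tendsto[OF \<phi>, of a "(_, 0)"] in \<open>simp add: rescale_tensor_power\<close>)
qed (use w f_bound in auto)

text \<open>For \<open>x < r / max_slow\<close> every regularised travel time is below
  \<open>r\<close>, where the profile is zero; the interval does not depend on \<epsilon>.\<close>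

lemma initial_vanishes:
  assumes "a\<^sup>2 = 1"
  shows "vanishes_near_0 (restrict_t0 (abs_colombeau (wave a 0)))"
  unfolding vanishes_near_0_def restrict_abs(1)[OF moderate_wave]
proof (intro exI[of _ "\<lambda>\<rho> x. wave a 0 (tensor_power \<rho>) (x, 0)"] conjI ballI exI[of _ "r / max_slow"])
  show "represents (\<lambda>\<rho> x. wave a 0 (tensor_power \<rho>) (x, 0)) (abs_colombeau (\<lambda>\<rho> x. wave a 0 (tensor_power \<rho>) (x, 0)))"
    using moderate_restrict_t0[OF moderate_wave] by (simp add: represents_def)
  show "0 < r / max_slow" using r_pos max_slow_pos by simp
  fix \<rho> :: "real \<Rightarrow> complex" and \<epsilon> x :: real
  assume "\<rho> \<in> mollifier 1" and \<epsilon>: "\<epsilon> \<in> {0<..<1}" and x: "x \<in> {0..<r / max_slow}"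
  then have m: "rescale \<epsilon> \<rho> \<in> mollifier1 1" by (intro mollifier1_rescale) (auto simp: mollifier_real)
  have a: "\<bar>a\<bar> = 1" using assms by (auto simp: power2_eq_1_iff)
  have "0 \<le> arrival (rescale \<epsilon> \<rho>) x"
    using arrival_diff_bounds(1)[OF m, of 0 x] x mult_nonneg_nonneg[OF less_imp_le[OF min_slow_pos], of x] by auto
  moreover have "arrival (rescale \<epsilon> \<rho>) x < r"
    using arrival_diff_bounds(2)[OF m, of 0 x] x max_slow_pos by (auto simp: pos_less_divide_eq mult.commute)
  ultimately have "\<bar>a * arrival (rescale \<epsilon> \<rho>) x\<bar> < r" using a by (simp add: abs_mult)
  then show "wave a 0 (tensor_power (rescale \<epsilon> \<rho>)) (x, 0) = 0"
    by (simp add: wave_def tensor_base_tensor_power[OF m] profile_eq_0[OF m])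
qed

end

context classical_problem
begin

lemma speed_associated: "associated speed c"
  unfolding speed_def
proof (rule associatedI[where g = "\<lambda>x. if x < x\<^sub>0 then c\<^sub>L else c\<^sub>R" and M = "max c\<^sub>L c\<^sub>R", OF moderate_speed_net])
  have "(\<lambda>x. if x < x\<^sub>0 then c\<^sub>L else c\<^sub>R) \<in> borel_measurable borel" by measurable
  then show "(\<lambda>x. if x < x\<^sub>0 then c\<^sub>L else c\<^sub>R) \<in> borel_measurable lebesgue"
    by (intro measurable_completion) simp
  \<comment> \<open>Two points are exempted: \<open>c\<close> is unconstrained at 0 and at
    \<open>x\<^sub>0\<close>, and convergence of the regularised speed is used only off
    \<open>x\<^sub>0\<close>.\<close>
  have ne: "AE x in lebesgue. x \<noteq> y" for y :: real
    by (rule AE_completion[OF AE_lborel_singleton])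
  show "AE x in lebesgue. x \<in> orthant \<longrightarrow> c x = (if x < x\<^sub>0 then c\<^sub>L else c\<^sub>R)"
    using ne[of 0] ne[of x\<^sub>0]
    by eventually_elim (auto simp: orthant_real intro: c_left c_right)
  show "\<exists>B. \<forall>\<epsilon>>0. \<forall>x\<in>orthant. norm (speed_net (rescale \<epsilon> \<phi>) x) \<le> B" for \<phi>
    using norm_speed_net_le by blast
  show "AE x in lebesgue. x \<in> orthant \<longrightarrow> ((\<lambda>\<epsilon>. speed_net (rescale \<epsilon> \<phi>) x) \<longlongrightarrow>
      of_real (if x < x\<^sub>0 then c\<^sub>L else c\<^sub>R)) (at_right 0)" if "\<phi> \<in> mollifier 1" for \<phi>
    using ne[of x\<^sub>0]
    by eventually_elim (use speed_net_tendsto[of \<phi> 1] that in \<open>auto simp: mollifier_real\<close>)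
qed (use cL cR in \<open>auto simp: max_def\<close>)

lemma regularised_solution:
  "\<exists>U\<^sub>0 V\<^sub>0 U V. associated U\<^sub>0 u\<^sub>0 \<and> associated V\<^sub>0 v\<^sub>0 \<and> vanishes_near_0 U\<^sub>0 \<and> vanishes_near_0 V\<^sub>0 \<and>
     solves_problem speed U\<^sub>0 V\<^sub>0 U V \<and>
     associated U (classical_u c u\<^sub>0 v\<^sub>0) \<and> associated V (classical_v c v\<^sub>0)"
proof -
  obtain M r where M: "\<And>z. \<bar>data z\<bar> \<le> M" and r: "0 < r" "\<And>z. \<bar>z\<bar> < 2 * r \<Longrightarrow> data z = 0"
    using data_bounded data_vanishes by blast
  \<comment> \<open>The profile is that of the unfolded \<open>data\<close>, whose half-lines carry
    \<open>u\<^sub>0\<close> and \<open>v\<^sub>0\<close>; accordingly the waves for 1 and -1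
    restrict to these data.\<close>
  interpret two_speeds_profile x\<^sub>0 c\<^sub>L c\<^sub>R data M r
    using M r borel_measurable_AE_isCont[OF AE_isCont_data] by unfold_locales
  have "associated (restrict_t0 (abs_colombeau (wave 1 0))) u\<^sub>0"
    by (rule initial_associated[OF AE_isCont_data]) (simp_all add: orthant_real data_def)
  moreover have "associated (restrict_t0 (abs_colombeau (wave (-1) 0))) v\<^sub>0"
    by (rule initial_associated[OF AE_isCont_data]) (simp_all add: orthant_real data_minus)
  moreover have "associated (abs_colombeau (wave 1 0)) (classical_u c u\<^sub>0 v\<^sub>0)"
    by (rule wave_associated[OF AE_isCont_data]) (simp add: classical_u_eq)
  moreover have "associated (abs_colombeau (wave (-1) 0)) (classical_v c v\<^sub>0)"
    by (rule wave_associated[OF AE_isCont_data]) (simp add: classical_v_eq)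
  ultimately show ?thesis
    using wave_solves initial_vanishes[of 1] initial_vanishes[of "-1"] by auto
qed

end

theorem proposition2:
  fixes x\<^sub>0 c\<^sub>L c\<^sub>R :: real and c u\<^sub>0 v\<^sub>0 :: "real \<Rightarrow> real"
  assumes "0 < x\<^sub>0" "0 < c\<^sub>L" "0 < c\<^sub>R"
    and "\<And>x. 0 < x \<Longrightarrow> x < x\<^sub>0 \<Longrightarrow> c x = c\<^sub>L"
    and "\<And>x. x\<^sub>0 < x \<Longrightarrow> c x = c\<^sub>R"
    and "bounded (u\<^sub>0 ` {0..})" "bounded (v\<^sub>0 ` {0..})"
    and "AE x in lebesgue. 0 \<le> x \<longrightarrow> continuous (at x within {0..}) u\<^sub>0"
    and "AE x in lebesgue. 0 \<le> x \<longrightarrow> continuous (at x within {0..}) v\<^sub>0"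
    and "\<exists>\<delta>>0. \<forall>x\<in>{0..<\<delta>}. u\<^sub>0 x = 0"
    and "\<exists>\<delta>>0. \<forall>x\<in>{0..<\<delta>}. v\<^sub>0 x = 0"
  shows "\<exists>C U\<^sub>0 V\<^sub>0 :: real colombeau.
    associated C c \<and> associated U\<^sub>0 u\<^sub>0 \<and> associated V\<^sub>0 v\<^sub>0 \<and>
    globally_bounded C \<and> locally_log_growth (deriv1 C) \<and>
    vanishes_near_0 U\<^sub>0 \<and> vanishes_near_0 V\<^sub>0 \<and>
    (\<exists>U V. solves_problem C U\<^sub>0 V\<^sub>0 U V \<and>
       (\<forall>U' V'. solves_problem C U\<^sub>0 V\<^sub>0 U' V' \<longrightarrow> U' = U \<and> V' = V) \<and>
       associated U (classical_u c u\<^sub>0 v\<^sub>0) \<and> associated V (classical_v c v\<^sub>0))"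
proof -
  interpret classical_problem x\<^sub>0 c\<^sub>L c\<^sub>R c u\<^sub>0 v\<^sub>0
    using assms by unfold_locales
  show ?thesis
    using regularised_solution speed_associated globally_bounded_speed locally_log_growth_speed solution_unique
    by blast
qed

end
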